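(* Let $\nu_0$ be a probability measure on $\mathbb{R}_+$ with compact support. For each $n\ge 1$, let $(r_j^{(n)})_{1\le j\le n}$ be an increasing sequence in $\mathbb{R}_+$ such that $$\frac1n\sum_{j=1}^n\delta_{r_j^{(n)}}\underset{n\to\infty}{\longrightarrow}\nu_0 .$$ (1) For every sequence $(m_n)_{n\ge1}$ of positive integers such that $\frac{m_n}{n\log n}\to\infty$ as $n\to\infty$, and for every $t\in(0,1)$, the empirical measure of the roots of the $\lfloor n m_n t\rfloor$-th derivative of the polynomial $P_{n,m_n}(z)=\prod_{j=1}^n\bigl(z^{m_n}-(r_j^{(n)})^{m_n}\bigr)$ tends, when $n\to\infty$, to the measure $\mu_t=\nu_t\otimes \mathrm{unif}$, where $\nu_t$ is the distribution of the random variable $$\left(1-\frac{t}{V_t}\right)q_{\nu_0}(V_t),$$ $V_t$ being a uniform random variable on $[t,1]$. Moreover, the quantiles of the measure $(1-t)\nu_t$, which has total mass $1-t$, satisfy $$q_{(1-t)\nu_t}(x)=\frac{x\,q_{\nu_0}(x+t)}{x+t}\qquad\text{for } 0\le x\le 1-t .$$ (2) Suppose that, for some $A>0$, the distribution function of $\nu_0$ is a continuous and strictly increasing bijection from $[0,A]$ to $[0,1]$. Then, for $t\in(0,1)$, the distribution function of $(1-t)\nu_t$ is a continuous and strictly increasing bijection from $[0,A(1-t)]$ to $[0,1-t]$. In this case, the distribution functions $\Psi_0$ of $\nu_0$ and $\Psi_t$ of $(1-t)\nu_t$ have $q_{\nu_0}$ and $q_{(1-t)\nu_t}$ as inverse bijections,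 respectively from $[0,1]$ to $[0,A]$ and from $[0,1-t]$ to $[0,A(1-t)]$, and hence $$\frac{\Psi_t^{\langle-1\rangle}(x)}{x}=\frac{\Psi_0^{\langle-1\rangle}(x+t)}{x+t}\qquad\text{for }0<x<1-t,\ 0<t<1 .$$ (3) Suppose that, for some $A>0$, $\nu_0$ is absolutely continuous with respect to the Lebesgue measure on $[0,A]$, with a continuous, strictly positive density on $(0,A)$. Then, for all $t\in[0,1)$, the measure $(1-t)\nu_t$ is supported on the interval $[0,A(1-t)]$ and has a continuous distribution function $\Psi_t$, with a strictly positive derivative $x\mapsto\psi(x,t)$ on $(0,A(1-t))$, which is a density of $(1-t)\nu_t$ with respect to the Lebesgue measure. Moreover, $(t,x)\mapsto\Psi_t(x)$ is a continuously differentiable function of two variables on the set $$\mathcal{E}=\{(t,x)\in[0,1)\times\mathbb{R}:\ x\in(0,A(1-t))\},$$ and the following partial differential equation is satisfied on $\mathcal{E}$: $$\frac{\partial\Psi_t(x)}{\partial t}=x\,\frac{\frac{\partial\Psi_t(x)}{\partial x}}{\Psi_t(x)}-1 .$$ (4) If, in addition to the assumptions of (3), the density of $\nu_0$ is continuously differentiable on $(0,A)$, then the density $\psi$ is a continuously differentiable function of two variables on $\mathcal{E}$, satisfying there the partial differential equation $$\frac{\partial\psi}{\partial t}(x,t)=\frac{\partial}{\partial x}\left(\frac{\psi(x,t)}{\frac1x\int_0^x\psi(y,t)\,dy}\right).$$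
   Context: $\mathbb{R}_+=[0,\infty)$, and $\delta_z$ is the Dirac measure at $z$. Convergence of measures is weak convergence. The empirical measure of the roots of a polynomial of degree $d\ge1$ is $\frac1d\sum\delta_z$, the sum being over its complex roots counted with multiplicity. For a probability measure $\nu$ on $\mathbb{R}_+$, $\nu\otimes\mathrm{unif}$ denotes the rotationally invariant probability measure on $\mathbb{C}$ which is, in polar coordinates (radius, argument), the product of $\nu$ and the uniform distribution $\mathrm{unif}$ on $[0,2\pi)$; i.e. the law of $Re^{i\Theta}$ with $R\sim\nu$ and $\Theta$ uniform on $[0,2\pi)$ independent. For a finite measure $\nu$ on $\mathbb{R}_+$, its quantile function is $q_\nu(\alpha)=\inf\{y\ge0:\ \nu([0,y])\ge\alpha\}$, for $\alpha$ between $0$ and the total mass of $\nu$. The distribution function of $\nu$ is $x\mapsto\nu([0,x])$. $(\cdot)^{\langle-1\rangle}$ denotes inversion with respect to composition. For $t=0$, $(1-t)\nu_t$ is $\nu_0$ itself. At points of $\mathcal{E}$ with $t=0$, partial derivatives with respect to $t$ are right derivatives. *)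

theory Defs
  imports
    "HOL-Probability.Probability"
    "HOL-Computational_Algebra.Computational_Algebra"
begin

text \<open>
  Measures on \<open>[0,\<infinity>)\<close> are represented as Borel measures on the real line that give no mass to
  the negative numbers.
\<close>

definition measure_support :: "'a::topological_space measure \<Rightarrow> 'a set" where
  "measure_support M = {x. \<forall>U. open U \<and> x \<in> U \<longrightarrow> emeasure M U > 0}"

text \<open>
  The library provides weak convergence (\<open>weak_conv_m\<close>, convergence of distribution functions at
  continuity points of the limit) only for measures on the real line. The following is the usual
  definition by bounded continuous test functions, needed for measures on the complex plane;
  on the real line the two notions agree.
\<close>

definition weakly_converges :: "(nat \<Rightarrow> 'a::topological_space measure) \<Rightarrow> 'a measure \<Rightarrow> bool" where
  "weakly_converges M_seq M \<longleftrightarrow>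
     (\<forall>f :: 'a \<Rightarrow> real. continuous_on UNIV f \<and> bounded (range f) \<longrightarrow>
        (\<lambda>n. integral\<^sup>L (M_seq n) f) \<longlonglongrightarrow> integral\<^sup>L M f)"

lemma weakly_converges_real_iff:
  fixes M_seq :: "nat \<Rightarrow> real measure"
  assumes "\<And>n. real_distribution (M_seq n)" "real_distribution M"
  shows "weakly_converges M_seq M \<longleftrightarrow> weak_conv_m M_seq M"
proof
  assume *: "weakly_converges M_seq M"
  show "weak_conv_m M_seq M"
  proof (rule integral_bdd_continuous_conv_imp_weak_conv[OF assms])
    fix f :: "real \<Rightarrow> real"
    assume c: "\<And>x. isCont f x" and b: "\<And>x. \<bar>f x\<bar> \<le> 1"
    have "continuous_on UNIV f" "bounded (range f)"
      using c b by (auto simp: continuous_at_imp_continuous_on intro!: boundedI[where B = 1])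
    with * show "(\<lambda>n. integral\<^sup>L (M_seq n) f) \<longlonglongrightarrow> integral\<^sup>L M f"
      unfolding weakly_converges_def by blast
  qed
next
  assume *: "weak_conv_m M_seq M"
  show "weakly_converges M_seq M"
    unfolding weakly_converges_def
  proof (intro allI impI)
    fix f :: "real \<Rightarrow> real"
    assume f: "continuous_on UNIV f \<and> bounded (range f)"
    then obtain B where B: "\<And>x. norm (f x) \<le> B"
      by (auto simp: bounded_iff)
    show "(\<lambda>n. integral\<^sup>L (M_seq n) f) \<longlonglongrightarrow> integral\<^sup>L M f"
      using f B
      by (intro weak_conv_imp_integral_bdd_continuous_conv[OF assms *, where B = B])
         (auto simp: continuous_on_eq_continuous_at)
  qed
qed

text \<open>
  The measure \<open>1/N \<Sum> \<delta>\<^sub>z\<close>, the sum being over the \<open>N\<close> elements (with multiplicity) of a nonempty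
  multiset.
\<close>

definition empirical_measure :: "'a::topological_space multiset \<Rightarrow> 'a measure" where
  "empirical_measure X = distr (measure_pmf (pmf_of_multiset X)) borel (\<lambda>x. x)"

lemma measure_empirical_measure:
  assumes "X \<noteq> {#}" "B \<in> sets borel"
  shows "measure (empirical_measure X) B = real (size {#x \<in># X. x \<in> B#}) / real (size X)"
proof -
  have "measure (empirical_measure X) B = measure (measure_pmf (pmf_of_multiset X)) B"
    using assms(2) by (simp add: empirical_measure_def measure_distr)
  also have "\<dots> = measure (measure_pmf (pmf_of_multiset X)) (B \<inter> set_mset X)"
    using assms(1) by (subst measure_Int_set_pmf[symmetric]) simp
  also have "\<dots> = (\<Sum>x\<in>B \<inter> set_mset X. real (count X x) / real (size X))"
    using assms(1) by (subst measure_measure_pmf_finite) auto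
  also have "\<dots> = real (\<Sum>x\<in>B \<inter> set_mset X. count X x) / real (size X)"
    by (simp add: sum_divide_distrib)
  also have "(\<Sum>x\<in>B \<inter> set_mset X. count X x) = size {#x \<in># X. x \<in> B#}"
    by (auto simp: size_multiset_overloaded_eq intro!: sum.cong)
  finally show ?thesis .
qed

definition root_measure :: "complex poly \<Rightarrow> complex measure" where
  "root_measure p = empirical_measure (proots p)"

definition P_poly :: "(nat \<Rightarrow> nat \<Rightarrow> real) \<Rightarrow> nat \<Rightarrow> nat \<Rightarrow> complex poly" where
  "P_poly r n m = (\<Prod>j=1..n. monom 1 m - [:complex_of_real (r n j) ^ m:])"

text \<open>The rotationally invariant measure \<open>\<nu> \<otimes> unif\<close> on the complex plane.\<close>

definition times_unif :: "real measure \<Rightarrow> complex measure" where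
  "times_unif \<nu> =
     distr (\<nu> \<Otimes>\<^sub>M uniform_measure lborel {0..<2 * pi}) borel (\<lambda>(R, \<Theta>). rcis R \<Theta>)"

definition distfun :: "real measure \<Rightarrow> real \<Rightarrow> real" where
  "distfun \<nu> x = measure \<nu> {0..x}"

definition quantile :: "real measure \<Rightarrow> real \<Rightarrow> real" where
  "quantile \<nu> \<alpha> = Inf {y. 0 \<le> y \<and> \<alpha> \<le> measure \<nu> {0..y}}"

definition nu :: "real measure \<Rightarrow> real \<Rightarrow> real measure" where
  "nu \<nu>0 t = distr (uniform_measure lborel {t..1}) borel (\<lambda>v. (1 - t / v) * quantile \<nu>0 v)"

text \<open>The measure \<open>(1 - t) \<nu>\<^sub>t\<close>, which is by convention \<open>\<nu>\<^sub>0\<close> itself for \<open>t = 0\<close>.\<close>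

definition scaled_nu :: "real measure \<Rightarrow> real \<Rightarrow> real measure" where
  "scaled_nu \<nu>0 t = (if t = 0 then \<nu>0 else scale_measure (ennreal (1 - t)) (nu \<nu>0 t))"

definition Psi :: "real measure \<Rightarrow> real \<Rightarrow> real \<Rightarrow> real" where
  "Psi \<nu>0 t x = distfun (scaled_nu \<nu>0 t) x"

definition psi :: "real measure \<Rightarrow> real \<Rightarrow> real \<Rightarrow> real" where
  "psi \<nu>0 t x = deriv (Psi \<nu>0 t) x"

text \<open>The inverse, with respect to composition, of a bijection with domain \<open>S\<close>.\<close>

abbreviation comp_inverse :: "'a set \<Rightarrow> ('a \<Rightarrow> 'b) \<Rightarrow> 'b \<Rightarrow> 'a" where
  "comp_inverse S F \<equiv> the_inv_into S F"

definition cont_incr_bij :: "(real \<Rightarrow> real) \<Rightarrow> real set \<Rightarrow> real set \<Rightarrow> bool" where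
  "cont_incr_bij F S T \<longleftrightarrow> continuous_on S F \<and> strict_mono_on S F \<and> bij_betw F S T"

definition inverse_bijections :: "('a \<Rightarrow> 'b) \<Rightarrow> ('b \<Rightarrow> 'a) \<Rightarrow> 'a set \<Rightarrow> 'b set \<Rightarrow> bool" where
  "inverse_bijections F G S T \<longleftrightarrow>
     bij_betw F S T \<and> bij_betw G T S \<and> (\<forall>x\<in>S. G (F x) = x) \<and> (\<forall>y\<in>T. F (G y) = y)"

text \<open>
  \<open>M\<close> is absolutely continuous, with density \<open>f\<close> on the Borel set \<open>S\<close> and no mass outside of \<open>S\<close>.
  Since the end points of an interval are negligible, absolute continuity with respect to the
  Lebesgue measure on \<open>[a,b]\<close> is expressed with \<open>S = (a,b)\<close>; the values of \<open>f\<close> outside of \<open>S\<close>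
  are irrelevant.
\<close>

definition has_density_on :: "real measure \<Rightarrow> (real \<Rightarrow> real) \<Rightarrow> real set \<Rightarrow> bool" where
  "has_density_on M f S \<longleftrightarrow> M = density lborel (\<lambda>x. ennreal (f x) * indicator S x)"

text \<open>
  The derivative is taken within \<open>S\<close>: on a set of pairs \<open>(t,x)\<close> containing points of its boundary
  \<open>t = 0\<close>, the derivative with respect to \<open>t\<close> at these points is therefore one-sided.
\<close>

definition continuously_differentiable_on ::
    "'a set \<Rightarrow> ('a::real_normed_vector \<Rightarrow> 'b::real_normed_vector) \<Rightarrow> bool" where
  "continuously_differentiable_on S F \<longleftrightarrow>
     (\<exists>F' :: 'a \<Rightarrow> 'a \<Rightarrow>\<^sub>L 'b.
        (\<forall>p\<in>S. (F has_derivative blinfun_apply (F' p)) (at p within S)) \<and> continuous_on S F')"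

definition domain_E :: "real \<Rightarrow> (real \<times> real) set" where
  "domain_E A = {(t, x). 0 \<le> t \<and> t < 1 \<and> 0 < x \<and> x < A * (1 - t)}"

end

theory Submission
  imports Defs
begin

text \<open>
  \<^bold>\<open>(1)\<close> The \<open>N\<close>-th derivative of \<open>P\<^sub>n\<^sub>,\<^sub>m\<close> has the form \<open>z\<^sup>s G(z\<^sup>m)\<close> with \<open>s < m\<close>, and all roots of
  \<open>G\<close> are real and nonnegative: differentiation replaces \<open>G\<close> by \<open>s G + m w G'\<close> (or by \<open>G'\<close>), and the
  logarithmic derivative of \<open>w\<^sup>s G(w)\<^sup>m\<close> cannot vanish off \<open>[0,\<infinity>)\<close>. So the roots of the derivative lie
  equidistributed on circles. Their radii are read off the coefficients of \<open>G\<close>, which are explicit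
  multiples of those of \<open>\<Prod>(w - r\<^sub>j\<^sup>m)\<close>: for nonnegative \<open>x\<^sub>1 \<ge> x\<^sub>2 \<ge> \<dots>\<close> the ratio \<open>e\<^sub>k / e\<^sub>k\<^sub>-\<^sub>1\<close> of elementary
  symmetric polynomials equals \<open>x\<^sub>k\<close> up to a factor \<open>n\<^sup>2\<close>, and \<open>(n\<^sup>2)\<^bsup>1/m\<^esup> \<rightarrow> 1\<close>. The \<open>j\<close>-th radius is thus
  asymptotic to \<open>r\<^sub>j (1 - n t / j)\<close>. With \<open>j = \<lfloor>n v\<rfloor> + 1\<close> this tends to \<open>(1 - t / v) q(v)\<close> for almost
  every \<open>v\<close>, and dominated convergence gives the weak limit.

  \<^bold>\<open>(2)\<close> The function \<open>v \<mapsto> (1 - t / v) q(v)\<close> is increasing, so \<open>x \<mapsto> (1 - t / (x + t)) q(x + t)\<close> is the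
  quantile function of \<open>(1 - t) \<nu>\<^sub>t\<close>.

  \<^bold>\<open>(3), (4)\<close> If \<open>F\<close> is the distribution function of \<open>\<nu>\<^sub>0\<close>, then \<open>\<Psi>\<^sub>t(x) = F(y) - t\<close>, where \<open>y\<close> is the
  solution of \<open>y - t y / F(y) = x\<close> with \<open>F(y) > t\<close>; both equations follow by implicit differentiation.
\<close>


subsection \<open>Elementary symmetric polynomials of a decreasing sequence\<close>

text \<open>Where the factor \<open>1 - n t / j\<close> comes from: \<open>N\<close> derivatives
  multiply the coefficient of \<open>z^(l+N)\<close> by \<open>(l+1)...(l+N)\<close>, and
  consecutive coefficients of \<open>G\<close> are \<open>m\<close> apart in \<open>l\<close>. The
  quotient of two such products of \<open>N\<close> factors can be rewritten with only
  \<open>m\<close> factors, and these all lie between two quantities close to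
  \<open>1 - N / (m j)\<close>. So the quotient is an \<open>m\<close>-th power up to a small error,
  and since the radii are \<open>m\<close>-th roots of the roots of \<open>G\<close>, exactly one
  such factor survives, with \<open>N / m\<close> about \<open>n t\<close>. All bounds on radii hold
  for fixed \<open>n\<close>, \<open>m\<close> and index; limits are taken only afterwards, one
  \<open>v\<close> at a time. In (3) and (4) the obstacle is the boundary \<open>t = 0\<close>,
  which belongs to the domain. The implicit solution \<open>y\<close> is therefore first shown to be
  continuous by monotonicity alone, and then differentiable by a rule for right inverses on an
  arbitrary set. A second obstacle is that the densities may be unbounded at the end points of their
  intervals, so integrals up to these points are improper.\<close>

fun esym :: "(nat \<Rightarrow> 'a::comm_ring_1) \<Rightarrow> nat \<Rightarrow> nat \<Rightarrow> 'a" where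
  "esym x n 0 = 1"
| "esym x 0 (Suc k) = 0"
| "esym x (Suc n) (Suc k) = esym x n (Suc k) + x n * esym x n k"

lemma esym_eq_0: "n < k \<Longrightarrow> esym x n k = 0"
  by (induction x n k rule: esym.induct) auto

text \<open>Vieta's formula: the link between coefficients, on which differentiation acts
  explicitly, and roots.\<close>

lemma coeff_prod_linear_esym:
  "k \<le> n \<Longrightarrow> coeff (\<Prod>i<n. [:- x i, 1:]) (n - k) = (-1) ^ k * esym x n k"
proof (induction n arbitrary: k)
  case (Suc n)
  show ?case
  proof (cases k)
    case 0
    have "coeff (\<Prod>i<n. [:- x i, 1:]) (Suc n) = 0"
      by (intro coeff_eq_0 le_less_trans[OF degree_prod_sum_le]) auto
    with Suc.IH[of 0] 0 show ?thesis
      by simp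
  next
    case [simp]: (Suc j)
    show ?thesis
    proof (cases "k \<le> n")
      case True
      then have "n - j = Suc (n - k)" by simp
      with Suc.IH[of k] Suc.IH[of j] True show ?thesis
        by (simp add: algebra_simps)
    next
      case False
      with Suc.prems have "j = n" by simp
      with Suc.IH[of n] show ?thesis
        by (simp add: esym_eq_0 coeff_pCons)
    qed
  qed
qed simp

lemma esym_nonneg:
  fixes x :: "nat \<Rightarrow> real"
  shows "(\<And>i. i < n \<Longrightarrow> 0 \<le> x i) \<Longrightarrow> 0 \<le> esym x n k"
  by (induction x n k rule: esym.induct) auto

text \<open>Among the nonnegative terms is the product of the first \<open>k\<close> entries.
  Contrapositively, if the \<open>k\<close>-th polynomial of a decreasing sequence vanishes, then so
  does \<open>x k\<close>; this settles the degenerate case of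
  \<open>esym_ratio_bounds\<close>.\<close>

lemma esym_pos:
  fixes x :: "nat \<Rightarrow> real"
  assumes "\<And>i. i < n \<Longrightarrow> 0 \<le> x i" "k \<le> n" "\<And>i. i < k \<Longrightarrow> 0 < x i"
  shows "0 < esym x n k"
  using assms
proof (induction n arbitrary: k)
  case (Suc n)
  show ?case
  proof (cases k)
    case [simp]: (Suc j)
    have nn: "0 \<le> esym x n i" for i
      using Suc.prems by (intro esym_nonneg) auto
    show ?thesis
    proof (cases "k \<le> n")
      case True
      then have "0 < esym x n k" using Suc.IH Suc.prems by auto
      moreover have "0 \<le> x n * esym x n j" using nn Suc.prems by auto
      ultimately show ?thesis by simp
    next
      case False
      with Suc.prems have "j = n" by simp
      then have "0 < esym x n j" "0 < x n" using Suc.IH Suc.prems by auto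
      with nn[of k] show ?thesis by (simp add: add_nonneg_pos)
    qed
  qed simp
qed simp

text \<open>Removing the largest index from a set of \<open>k + 1\<close> indices removes a factor
  of at most \<open>x k\<close>, since this index is at least \<open>k\<close>; a set of
  \<open>k\<close> indices arises in this way at most \<open>n - k\<close> times. The induction on
  \<open>n\<close> splits off the last variable.\<close>

lemma esym_Suc_le:
  fixes x :: "nat \<Rightarrow> real"
  assumes "\<And>i. i < n \<Longrightarrow> 0 \<le> x i" "\<And>i j. i \<le> j \<Longrightarrow> j < n \<Longrightarrow> x j \<le> x i" "k < n"
  shows "esym x n (Suc k) \<le> real (n - k) * x k * esym x n k"
  using assms
proof (induction n)
  case (Suc n)
  have nn: "0 \<le> esym x n i" for i
    using Suc.prems by (intro esym_nonneg) auto
  have mono: "esym x n k \<le> esym x (Suc n) k"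
    using nn Suc.prems by (cases k) auto
  have xk: "0 \<le> x k" "x n \<le> x k" using Suc.prems by auto
  show ?case
  proof (cases "k < n")
    case True
    have "esym x (Suc n) (Suc k) \<le> real (n - k) * x k * esym x n k + x k * esym x n k"
      using Suc.IH True Suc.prems xk nn by (auto intro!: add_mono mult_right_mono)
    also have "\<dots> = real (Suc n - k) * x k * esym x n k"
      using True by (simp add: Suc_diff_le algebra_simps)
    also have "\<dots> \<le> real (Suc n - k) * x k * esym x (Suc n) k"
      using mono xk by (intro mult_left_mono) auto
    finally show ?thesis .
  next
    case False
    with Suc.prems have [simp]: "k = n" by simp
    show ?thesis using mono xk by (auto simp: esym_eq_0 intro: mult_left_mono)
  qed
qed simp

text \<open>A set of \<open>k\<close> indices misses some \<open>j \<le> k\<close>. Adding this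
  \<open>j\<close> multiplies the term by \<open>x j \<ge> x k\<close>, and each set of
  \<open>k + 1\<close> indices is reached at most \<open>k + 1\<close> times.\<close>

lemma le_esym_Suc:
  fixes x :: "nat \<Rightarrow> real"
  assumes "\<And>i. i < n \<Longrightarrow> 0 \<le> x i" "\<And>i j. i \<le> j \<Longrightarrow> j < n \<Longrightarrow> x j \<le> x i" "k < n"
  shows "x k * esym x n k \<le> real (Suc k) * esym x n (Suc k)"
  using assms
proof (induction n arbitrary: k)
  case (Suc n)
  have nn: "0 \<le> esym x n i" for i
    using Suc.prems by (intro esym_nonneg) auto
  have xn: "0 \<le> x n" "0 \<le> x k" using Suc.prems by auto
  \<comment> \<open>The induction hypothesis at \<open>k - 1\<close>, weakened by
    \<open>x k \<le> x j\<close>; it controls the terms that contain the last variable.\<close>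
  have step: "x k * esym x n j \<le> real k * esym x n (Suc j)" if "k = Suc j" for j
  proof -
    have "x k * esym x n j \<le> x j * esym x n j"
      using that Suc.prems nn by (intro mult_right_mono) auto
    also have "\<dots> \<le> real (Suc j) * esym x n (Suc j)"
      using that Suc.prems by (intro Suc.IH) auto
    finally show ?thesis using that by simp
  qed
  have low: "x k * esym x n k \<le> real (Suc k) * esym x n (Suc k)" if "k < n"
    using that Suc.prems by (intro Suc.IH) auto
  show ?case
  proof (cases k)
    case 0
    show ?thesis
    proof (cases "k < n")
      case True
      with low 0 xn show ?thesis by simp
    next
      case False
      with Suc.prems 0 have "n = 0" by simp
      with 0 show ?thesis by simp
    qed
  next
    case (Suc j)
    have "x k * x n * esym x n j \<le> x n * (real k * esym x n k)"
      using mult_left_mono[OF step[OF Suc] xn(1)] Suc by (simp add: mult_ac)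
    \<comment> \<open>The goal contains \<open>real (Suc k)\<close> copies of
      \<open>x n * esym x n k\<close>. The previous estimate uses \<open>real k\<close> of them; the
      one left over is spent here, and for \<open>k = n\<close> it is the whole bound.\<close>
    moreover have "x k * esym x n k \<le> real (Suc k) * esym x n (Suc k) + x n * esym x n k"
    proof (cases "k < n")
      case True
      with low xn nn[of k] show ?thesis by (simp add: add_increasing2)
    next
      case False
      with Suc.prems have "k = n" by simp
      with nn[of "Suc k"] show ?thesis by (simp add: add_increasing)
    qed
    ultimately show ?thesis
      using Suc by (simp add: algebra_simps)
  qed
qed simp

subsection \<open>Roots of derivatives of \<open>G(z\<^sup>m)\<close>\<close>

definition nonneg_roots :: "complex poly \<Rightarrow> bool" where
  "nonneg_roots G \<longleftrightarrow> G \<noteq> 0 \<and> (\<forall>w. poly G w = 0 \<longrightarrow> w \<in> \<real>\<^sub>\<ge>\<^sub>0)"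

lemma poly_pderiv_log:
  fixes z :: "nat \<Rightarrow> 'a::field"
  assumes "\<And>i. i < n \<Longrightarrow> w \<noteq> z i"
  shows "poly (pderiv (\<Prod>i<n. [:- z i, 1:])) w = poly (\<Prod>i<n. [:- z i, 1:]) w * (\<Sum>i<n. 1 / (w - z i))"
  using assms
proof (induction n)
  case (Suc n)
  have "w - z n \<noteq> 0" using Suc.prems[of n] by simp
  then have 1: "(w - z n) * (1 / (w - z n)) = 1" by simp
  have 2: "pderiv [:- z n, 1:] = 1" by (simp add: pderiv_pCons)
  let ?P = "poly (\<Prod>i<n. [:- z i, 1:]) w"
  have "poly (pderiv (\<Prod>i<Suc n. [:- z i, 1:])) w = ?P + ?P * (\<Sum>i<n. 1 / (w - z i)) * (w - z n)"
    using Suc by (simp add: pderiv_mult 2 algebra_simps del: mult_pCons_left mult_pCons_right)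
  also have "\<dots> = ?P * ((w - z n) * (1 / (w - z n))) + ?P * (\<Sum>i<n. 1 / (w - z i)) * (w - z n)"
    unfolding 1 by simp
  also have "\<dots> = poly (\<Prod>i<Suc n. [:- z i, 1:]) w * (\<Sum>i<Suc n. 1 / (w - z i))"
    by (simp add: algebra_simps del: mult_pCons_left mult_pCons_right times_divide_eq_right)
  finally show ?case .
qed simp

text \<open>All nonzero terms lie in one open half plane: off the real line their imaginary parts
  have the sign opposite to that of \<open>Im w\<close>, and for negative \<open>w\<close> the terms
  are themselves negative.\<close>

lemma sum_inverse_diff_nonzero:
  fixes w :: complex and z :: "nat \<Rightarrow> complex" and s :: real and m :: real
  assumes w: "w \<notin> \<real>\<^sub>\<ge>\<^sub>0" and z: "\<And>i. i < n \<Longrightarrow> z i \<in> \<real>\<^sub>\<ge>\<^sub>0" and "0 \<le> s" "0 < m" "s > 0 \<or> n > 0"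
  shows "complex_of_real s / w + complex_of_real m * (\<Sum>i<n. 1 / (w - z i)) \<noteq> 0"
proof
  have inv: "1 / v = Complex (Re v / (norm v)^2) (- Im v / (norm v)^2)" for v :: complex
    by (simp add: complex_eq_iff Re_divide Im_divide cmod_power2)
  assume *: "complex_of_real s / w + complex_of_real m * (\<Sum>i<n. 1 / (w - z i)) = 0"
  have zr: "Im (z i) = 0" "Re (z i) \<ge> 0" if "i < n" for i
    using z[OF that] by (auto simp: complex_nonneg_Reals_iff)
  have w0: "w \<noteq> 0" using w by auto
  have wz: "w \<noteq> z i" if "i < n" for i using w z that by auto
  show False
  proof (cases "Im w = 0")
    case True
    then have neg: "Re w < 0" using w by (auto simp: complex_nonneg_Reals_iff)
    have 1: "Re (1 / (w - z i)) < 0" if "i < n" for i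
      using zr[OF that] neg wz[OF that] by (auto simp: inv divide_less_0_iff)
    have 2: "Re (complex_of_real s / w) \<le> 0" "s > 0 \<Longrightarrow> Re (complex_of_real s / w) < 0"
      using neg \<open>0 \<le> s\<close> True by (auto simp: Re_divide divide_le_0_iff divide_less_0_iff mult_nonneg_nonpos mult_pos_neg)
    have 3: "(\<Sum>i<n. Re (1 / (w - z i))) \<le> 0" using 1 by (intro sum_nonpos) (auto simp: less_imp_le)
    have 4: "(\<Sum>i<n. Re (1 / (w - z i))) < 0" if "n > 0"
      using sum_strict_mono[of "{..<n}" "\<lambda>i. Re (1 / (w - z i))" "\<lambda>_. 0"] 1 that by auto
    have "Re (complex_of_real s / w) + m * (\<Sum>i<n. Re (1 / (w - z i))) < 0"
    proof (cases "n > 0")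
      case True
      have "m * (\<Sum>i<n. Re (1 / (w - z i))) < 0" using 4[OF True] \<open>0 < m\<close> by (rule mult_pos_neg[rotated])
      with 2 show ?thesis by linarith
    next
      case False
      with assms 2 show ?thesis by auto
    qed
    moreover have "Re (complex_of_real s / w) + m * (\<Sum>i<n. Re (1 / (w - z i))) = 0"
      using arg_cong[OF *, of Re] by simp
    ultimately show False by simp
  next
    case False
    \<comment> \<open>Up to the factor \<open>- Im w\<close> this is the imaginary part of the sum:
      nonnegative weights, at least one of them positive.\<close>
    define c where "c = s / (norm w)^2 + m * (\<Sum>i<n. 1 / (norm (w - z i))^2)"
    have Ims: "Im (complex_of_real s / w) = - Im w * (s / (norm w)^2)"
      by (simp add: Im_divide cmod_power2)
    have "Im (1 / (w - z i)) = - Im w * (1 / (norm (w - z i))^2)" if "i < n" for i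
      using zr[OF that] by (simp add: inv)
    then have "Im (\<Sum>i<n. 1 / (w - z i)) = - Im w * (\<Sum>i<n. 1 / (norm (w - z i))^2)"
      unfolding sum_distrib_left by simp
    moreover have "Im (complex_of_real s / w + complex_of_real m * u) = Im (complex_of_real s / w) + m * Im u" for u
      by simp
    ultimately have "Im (complex_of_real s / w + complex_of_real m * (\<Sum>i<n. 1 / (w - z i))) = - Im w * c"
      unfolding c_def using Ims by (simp only: distrib_left) (simp add: mult_ac)
    with * have "c = 0" using False by auto
    moreover have "c > 0"
    proof (cases "n > 0")
      case True
      have "(\<Sum>i<n. 1 / (norm (w - z i))^2) > 0"
        using True wz by (intro sum_pos) auto
      then show ?thesis unfolding c_def using assms by (intro add_nonneg_pos) auto
    next
      case False
      with assms w0 show ?thesis by (auto simp: c_def)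
    qed
    ultimately show False by simp
  qed
qed

text \<open>At \<open>w\<close> off the half line the new polynomial is \<open>w * poly G w\<close>
  times the sum treated in \<open>sum_inverse_diff_nonzero\<close>. The side condition excludes
  constant \<open>G\<close> with \<open>s = 0\<close>, which would give the zero polynomial.\<close>

lemma nonneg_roots_step:
  assumes G: "nonneg_roots G" and "m > 0" "s > 0 \<or> degree G > 0"
  shows "nonneg_roots (smult (of_nat s) G + smult (of_nat m) ([:0, 1:] * pderiv G))"
proof -
  let ?H = "smult (of_nat s) G + smult (of_nat m) ([:0, 1:] * pderiv G)"
  from G have "G \<noteq> 0" by (simp add: nonneg_roots_def)
  obtain z where z: "smult (lead_coeff G) (\<Prod>i<degree G. [:-z i, 1:]) = G"
    using complex_poly_decompose' by blast
  have zr: "z i \<in> \<real>\<^sub>\<ge>\<^sub>0" if "i < degree G" for i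
  proof -
    have "poly G (z i) = 0" using that by (subst z[symmetric]) (auto simp: poly_prod)
    with G show ?thesis by (simp add: nonneg_roots_def)
  qed
  have key: "poly ?H w \<noteq> 0" if w: "w \<notin> \<real>\<^sub>\<ge>\<^sub>0" for w
  proof
    assume 0: "poly ?H w = 0"
    have Gw: "poly G w \<noteq> 0" using w G by (auto simp: nonneg_roots_def)
    have w0: "w \<noteq> 0" using w by auto
    have "poly (pderiv G) w = poly G w * (\<Sum>i<degree G. 1 / (w - z i))"
    proof -
      have "poly (pderiv (\<Prod>i<degree G. [:- z i, 1:])) w = poly (\<Prod>i<degree G. [:- z i, 1:]) w * (\<Sum>i<degree G. 1 / (w - z i))"
        using w zr by (intro poly_pderiv_log) auto
      then have "poly (pderiv (smult (lead_coeff G) (\<Prod>i<degree G. [:- z i, 1:]))) w =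
          poly (smult (lead_coeff G) (\<Prod>i<degree G. [:- z i, 1:])) w * (\<Sum>i<degree G. 1 / (w - z i))"
        by (simp add: pderiv_smult)
      then show ?thesis unfolding z .
    qed
    with 0 have "w * poly G w * (of_nat s / w + of_nat m * (\<Sum>i<degree G. 1 / (w - z i))) = 0"
      using w0 by (simp add: field_simps)
    with Gw w0 have "of_nat s / w + of_nat m * (\<Sum>i<degree G. 1 / (w - z i)) = 0" by simp
    moreover have "complex_of_real (real s) / w + complex_of_real (real m) * (\<Sum>i<degree G. 1 / (w - z i)) \<noteq> 0"
      using assms zr w by (intro sum_inverse_diff_nonzero) auto
    ultimately show False by simp
  qed
  moreover have "?H \<noteq> 0" using key[of "-1"] by (metis poly_0 complex_nonneg_Reals_iff neg_0_le_iff_le not_one_le_zero uminus_complex.sel(1) one_complex.sel(1))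
  ultimately show ?thesis unfolding nonneg_roots_def by blast
qed

text \<open>The previous step with \<open>s = 0\<close> and \<open>m = 1\<close>; its factor
  \<open>[:0, 1:]\<close> only adds the root 0.\<close>

lemma nonneg_roots_pderiv:
  assumes G: "nonneg_roots G" and "degree G > 0"
  shows "nonneg_roots (pderiv G)"
proof -
  have "nonneg_roots ([:0, 1:] * pderiv G)"
    using nonneg_roots_step[of G 1 0] assms by simp
  then show ?thesis by (auto simp: nonneg_roots_def)
qed

lemma pderiv_monom_mult_pcompose:
  fixes G :: "complex poly"
  assumes "m > 0"
  shows "pderiv (monom 1 (Suc s) * pcompose G (monom 1 m)) =
    monom 1 s * pcompose (smult (of_nat (Suc s)) G + smult (of_nat m) ([:0, 1:] * pderiv G)) (monom 1 m)"
proof (rule poly_ext)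
  fix w :: complex
  have "w * w ^ (m - Suc 0) = w ^ m" using assms by (simp add: power_eq_if)
  then show "poly (pderiv (monom 1 (Suc s) * pcompose G (monom 1 m))) w = poly (monom 1 s *
      pcompose (smult (of_nat (Suc s)) G + smult (of_nat m) ([:0, 1:] * pderiv G)) (monom 1 m)) w"
    by (simp add: pderiv_mult pderiv_pcompose pderiv_monom poly_pcompose poly_monom algebra_simps)
qed

text \<open>Each derivative lowers \<open>s\<close> by one. At \<open>s = 0\<close> the derivative
  of \<open>G(z^m)\<close> is \<open>m z^(m-1) G'(z^m)\<close>, so \<open>s\<close> jumps to
  \<open>m - 1\<close> and \<open>G\<close> loses a degree. The bound on \<open>N\<close> keeps
  every polynomial that is differentiated nonconstant.\<close>

lemma higher_pderiv_pcompose_monom: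
  assumes G0: "nonneg_roots G0" and m: "m > 0" and N: "N \<le> m * degree G0"
  shows "\<exists>s G. s < m \<and> nonneg_roots G \<and>
    (pderiv ^^ N) (pcompose G0 (monom 1 m)) = monom 1 s * pcompose G (monom 1 m)"
  using N
proof (induction N)
  case 0
  show ?case using G0 m by (intro exI[of _ 0] exI[of _ G0]) auto
next
  case (Suc N)
  then obtain s G where IH: "s < m" "nonneg_roots G"
    "(pderiv ^^ N) (pcompose G0 (monom 1 m)) = monom 1 s * pcompose G (monom 1 m)"
    by auto
  have "degree ((pderiv ^^ N) (pcompose G0 (monom 1 m))) > 0"
    using Suc.prems by (simp add: degree_higher_pderiv degree_pcompose degree_monom_eq mult.commute)
  then have dpos: "s > 0 \<or> degree G > 0"
    using IH m degree_mult_le[of "monom 1 s" "pcompose G (monom 1 m)"]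
    by (auto simp: degree_pcompose degree_monom_eq intro!: Nat.gr0I)
  show ?case
  proof (cases s)
    case 0
    have "(pderiv ^^ Suc N) (pcompose G0 (monom 1 m)) =
      monom 1 (m - 1) * pcompose (smult (of_nat m) (pderiv G)) (monom 1 m)"
      using IH 0 by (simp add: pderiv_pcompose pderiv_monom pcompose_smult)
        (simp add: mult.commute smult_monom flip: mult_smult_left)
    moreover have "nonneg_roots (smult (of_nat m) (pderiv G))"
      using nonneg_roots_pderiv[OF IH(2)] dpos 0 m by (auto simp: nonneg_roots_def)
    ultimately show ?thesis using m by (intro exI[of _ "m - 1"] exI conjI) auto
  next
    case (Suc s')
    have "(pderiv ^^ Suc N) (pcompose G0 (monom 1 m)) =
      monom 1 s' * pcompose (smult (of_nat s) G + smult (of_nat m) ([:0, 1:] * pderiv G)) (monom 1 m)"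
      using pderiv_monom_mult_pcompose[OF m, of s' G] IH Suc by simp
    with nonneg_roots_step[OF IH(2) m dpos] IH Suc show ?thesis
      by (intro exI[of _ s'] exI conjI) auto
  qed
qed

section \<open>Radii of the root circles, read off the coefficients\<close>

lemma esym_of_real: "esym (\<lambda>i. of_real (x i)) n k = of_real (esym x n k)"
  by (induction x n k rule: esym.induct) auto

text \<open>Up to the factors in \<open>esym_Suc_le\<close> and \<open>le_esym_Suc\<close>, both
  \<open>y i\<close> and \<open>z i\<close> are quotients of consecutive elementary symmetric
  polynomials, so the assumption \<open>e\<close> at \<open>i + 1\<close> divided by the one at
  \<open>i\<close> compares them. Each direction collects two such factors, with product at most
  \<open>n^2\<close>.\<close>

lemma esym_ratio_bounds:
  fixes y z :: "nat \<Rightarrow> real"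
  assumes y: "\<And>i. i < n \<Longrightarrow> 0 \<le> y i" "\<And>i j. i \<le> j \<Longrightarrow> j < n \<Longrightarrow> y j \<le> y i"
    and z: "\<And>i. i < d \<Longrightarrow> 0 \<le> z i" "\<And>i j. i \<le> j \<Longrightarrow> j < d \<Longrightarrow> z j \<le> z i"
    and "d \<le> n" and b: "\<And>k. k \<le> d \<Longrightarrow> 0 < b k"
    and e: "\<And>k. k \<le> d \<Longrightarrow> esym z d k = b k * esym y n k"
    and i: "i < d"
  shows "z i \<le> real n ^ 2 * (b (Suc i) / b i * y i)" "b (Suc i) / b i * y i \<le> real n ^ 2 * z i"
proof -
  define B where "B = b (Suc i) / b i"
  have B: "B > 0" "b (Suc i) = B * b i" using b[of i] b[of "Suc i"] i by (auto simp: B_def)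
  have yi: "0 \<le> y i" and zi: "0 \<le> z i" using y z i \<open>d \<le> n\<close> by auto
  have yn: "0 \<le> esym y n k" for k using y by (intro esym_nonneg)
  have zn: "0 \<le> esym z d k" for k using z by (intro esym_nonneg)
  have ei: "esym z d i = b i * esym y n i" and ei': "esym z d (Suc i) = b (Suc i) * esym y n (Suc i)"
    using e i by auto
  have sq: "real (Suc i) * real (n - i) \<le> real n ^ 2" "real (d - i) * real (Suc i) \<le> real n ^ 2"
    unfolding power2_eq_square using i \<open>d \<le> n\<close> by (intro mult_mono; simp)+
  have "z i \<le> real n ^ 2 * (B * y i) \<and> B * y i \<le> real n ^ 2 * z i"
  \<comment> \<open>The denominator of the quotient. If it vanishes, then \<open>esym_pos\<close>
    forces \<open>y i = 0\<close> and \<open>z i = 0\<close>, and both bounds are trivial.\<close>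
  proof (cases "esym y n i = 0")
    case True
    have "y i = 0"
    proof (rule ccontr)
      assume "y i \<noteq> 0"
      then have "0 < y j" if "j < i" for j
        using y(2)[of j i] yi that i \<open>d \<le> n\<close> by (metis less_eq_real_def less_imp_le_nat order_less_le_trans)
      then have "0 < esym y n i" using y i \<open>d \<le> n\<close> by (intro esym_pos) auto
      with True show False by simp
    qed
    moreover have "z i = 0"
    proof (rule ccontr)
      assume "z i \<noteq> 0"
      then have "0 < z j" if "j < i" for j
        using z(2)[of j i] zi that i by (metis less_eq_real_def less_imp_le_nat order_less_le_trans)
      then have "0 < esym z d i" using z i by (intro esym_pos) auto
      with True ei show False by simp
    qed
    ultimately show ?thesis by simp
  next
    case False
    with yn[of i] have epos: "0 < esym y n i" by simp
    have bi: "0 < b i" using b i by simp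
    have "z i * (b i * esym y n i) \<le> real (Suc i) * (b (Suc i) * esym y n (Suc i))"
      using le_esym_Suc[of d z i] z i ei ei' by simp
    also have "\<dots> \<le> real (Suc i) * (b (Suc i) * (real (n - i) * y i * esym y n i))"
      using esym_Suc_le[of n y i] y i \<open>d \<le> n\<close> b[of "Suc i"] by (intro mult_left_mono) auto
    also have "\<dots> = (real (Suc i) * real (n - i)) * (B * y i) * (b i * esym y n i)"
      using B by (simp add: mult_ac)
    finally have "z i \<le> (real (Suc i) * real (n - i)) * (B * y i)"
      using epos bi by (meson mult_pos_pos mult_le_cancel_right_pos)
    also have "\<dots> \<le> real n ^ 2 * (B * y i)" using sq B yi by (intro mult_right_mono) auto
    finally have 1: "z i \<le> real n ^ 2 * (B * y i)" .
    have "B * y i * (b i * esym y n i) = b (Suc i) * (y i * esym y n i)"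
      using B by (simp add: mult_ac)
    also have "\<dots> \<le> b (Suc i) * (real (Suc i) * esym y n (Suc i))"
      using le_esym_Suc[of n y i] y i \<open>d \<le> n\<close> b[of "Suc i"] by (intro mult_left_mono) auto
    also have "\<dots> = real (Suc i) * esym z d (Suc i)" using ei' by simp
    also have "\<dots> \<le> real (Suc i) * (real (d - i) * z i * esym z d i)"
      using esym_Suc_le[of d z i] z i by (intro mult_left_mono) auto
    also have "\<dots> = (real (d - i) * real (Suc i)) * z i * (b i * esym y n i)"
      using ei by (simp add: mult_ac)
    finally have "B * y i \<le> (real (d - i) * real (Suc i)) * z i"
      using epos bi by (meson mult_pos_pos mult_le_cancel_right_pos)
    also have "\<dots> \<le> real n ^ 2 * z i" using sq zi by (intro mult_right_mono) auto
    finally show ?thesis using 1 by simp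
  qed
  then show "z i \<le> real n ^ 2 * (b (Suc i) / b i * y i)" "b (Suc i) / b i * y i \<le> real n ^ 2 * z i"
    unfolding B_def by auto
qed

text \<open>The product of the \<open>m + N\<close> factors starting at \<open>a\<close> can be cut
  after \<open>m\<close> or after \<open>N\<close> factors; this trades the \<open>N\<close> factors
  in \<open>R\<close> for \<open>m\<close> factors \<open>(a + l) / (a + N + l)\<close>. They
  increase with \<open>l\<close>, so the first and the last one bound \<open>R\<close> by exact
  \<open>m\<close>-th powers, ready for an \<open>m\<close>-th root.\<close>

lemma pochhammer_ratio_bounds:
  fixes a :: real and m N :: nat
  assumes "0 < a"
  defines "R \<equiv> pochhammer a N / pochhammer (a + real m) N"
  shows "(a / (a + real N)) ^ m \<le> R" "R \<le> ((a + real m - 1) / (a + real N + real m - 1)) ^ m"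
proof -
  have "pochhammer a m * pochhammer (a + real m) N = pochhammer a N * pochhammer (a + real N) m"
    using pochhammer_product'[of a m N] pochhammer_product'[of a N m] by (simp add: add.commute)
  moreover have pos: "0 < pochhammer (a + real m) N" "0 < pochhammer (a + real N) m"
    using assms by (auto intro!: pochhammer_pos)
  ultimately have "R = pochhammer a m / pochhammer (a + real N) m"
    by (simp add: R_def field_simps)
  also have "\<dots> = (\<Prod>l<m. (a + real l) / (a + real N + real l))"
    by (simp add: pochhammer_prod prod_dividef atLeast0LessThan)
  finally have R: "R = (\<Prod>l<m. (a + real l) / (a + real N + real l))" .
  have "(\<Prod>l<m. a / (a + real N)) \<le> R" unfolding R
    using assms by (intro prod_mono) (auto simp: field_simps)
  then show "(a / (a + real N)) ^ m \<le> R" by simp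
  have "R \<le> (\<Prod>l<m. (a + real m - 1) / (a + real N + real m - 1))" unfolding R
  proof (intro prod_mono conjI)
    fix l assume "l \<in> {..<m}"
    then have l: "real l \<le> real m - 1" by auto
    have "x / (x + real N) \<le> y / (y + real N)" if "0 < x" "x \<le> y" for x y
      using that mult_left_mono[OF that(2), of "real N"] by (simp add: divide_simps algebra_simps)
    from this[of "a + real l" "a + real m - 1"] l
    show "(a + real l) / (a + real N + real l) \<le> (a + real m - 1) / (a + real N + real m - 1)"
      using assms(1) by (simp add: algebra_simps)
  qed (use assms in auto)
  then show "R \<le> ((a + real m - 1) / (a + real N + real m - 1)) ^ m" by simp
qed

lemma coeff_pcompose_monom:
  assumes "m > 0"
  shows "coeff (pcompose p (monom (1::'a::comm_ring_1) m)) (m * j) = coeff p j"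
proof (induction p arbitrary: j)
  case (pCons a p)
  show ?case
    using pCons.IH assms by (cases j) (auto simp: pcompose_pCons coeff_monom_mult coeff_pCons split: nat.splits)
qed simp

text \<open>The decreasing numbering, obtained by sorting the real parts of the roots, is what the
  bounds on \<open>esym\<close> require.\<close>

lemma nonneg_roots_factorization:
  assumes "nonneg_roots G"
  obtains z :: "nat \<Rightarrow> real" where "G = smult (lead_coeff G) (\<Prod>i<degree G. [:- of_real (z i), 1:])"
    "\<And>i. i < degree G \<Longrightarrow> 0 \<le> z i" "\<And>i j. i \<le> j \<Longrightarrow> j < degree G \<Longrightarrow> z j \<le> z i"
proof -
  define L where "L = rev (sorted_list_of_multiset (image_mset Re (proots G)))"
  have mL: "mset L = image_mset Re (proots G)" by (simp add: L_def)
  have len: "length L = degree G"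
    using arg_cong[OF mL, of size] by (simp add: size_proots_complex)
  have roots: "w \<in> \<real>\<^sub>\<ge>\<^sub>0" if "w \<in># proots G" for w
    using that assms by (auto simp: nonneg_roots_def)
  have "(\<Prod>i<degree G. [:- of_real (L ! i), 1:]) = prod_list (map (\<lambda>x. [:- complex_of_real x, 1:]) L)"
    by (simp add: prod.list_conv_set_nth len atLeast0LessThan)
  also have "\<dots> = (\<Prod>x\<in>#mset L. [:- complex_of_real x, 1:])"
    by (metis mset_map prod_mset_prod_list)
  also have "\<dots> = (\<Prod>w\<in>#proots G. [:- complex_of_real (Re w), 1:])"
    by (simp add: mL image_mset.compositionality o_def)
  also have "\<dots> = (\<Prod>w\<in>#proots G. [:- w, 1:])"
    using roots by (intro arg_cong[where f = prod_mset] image_mset_cong)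
      (auto simp: complex_nonneg_Reals_iff complex_eq_iff)
  finally have "G = smult (lead_coeff G) (\<Prod>i<degree G. [:- of_real (L ! i), 1:])"
    by (simp add: complex_poly_decompose_multiset)
  moreover have "0 \<le> L ! i" if "i < degree G" for i
  proof -
    have "L ! i \<in># mset L" using that len by (simp add: in_set_conv_nth) blast
    then show ?thesis using roots by (auto simp: mL complex_nonneg_Reals_iff)
  qed
  moreover have "L ! j \<le> L ! i" if "i \<le> j" "j < degree G" for i j
  proof -
    have "sorted (rev L)" by (simp add: L_def)
    then show ?thesis using that len by (simp add: sorted_rev_nth_mono)
  qed
  ultimately show ?thesis using that by blast
qed

lemma proots_monom: "proots (monom (1::'a::idom) m) = replicate_mset m 0"
proof -
  have "proots (monom (1::'a) m) = repeat_mset m (proots [:0, 1:])"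
    by (simp add: monom_altdef proots_power)
  then show ?thesis
    using proots_linear_factor[of "0::'a"] by simp
qed

lemma pcompose_linear: "pcompose [:- c, 1:] p = p - [:c:]" for p :: "'a::comm_ring_1 poly"
  by (simp add: pcompose_pCons poly_eq_iff coeff_pCons split: nat.split)

lemma degree_monom_diff: "degree (monom 1 m - [:c::'a::idom:]) = m"
  by (simp add: degree_pcompose degree_monom_eq flip: pcompose_linear)

text \<open>For \<open>\<rho> = 0\<close> the \<open>m\<close> points coincide and form an
  \<open>m\<close>-fold root. Otherwise they are \<open>m\<close> distinct roots of a polynomial of
  degree \<open>m\<close>, and counting shows that there are no others.\<close>

lemma proots_monom_diff:
  assumes "m > 0" "0 \<le> \<rho>"
  shows "proots (monom 1 m - [:complex_of_real \<rho> ^ m:]) =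
    image_mset (\<lambda>l. rcis \<rho> (2 * pi * real l / real m)) (mset_set {..<m})"
proof (cases "\<rho> = 0")
  case True
  have "proots (monom 1 m :: complex poly) = replicate_mset m 0"
    by (rule proots_monom)
  also have "\<dots> = image_mset (\<lambda>l. 0) (mset_set {..<m})"
    by (simp add: image_mset_const_eq)
  finally show ?thesis using True assms by (simp add: power_0_left)
next
  case False
  let ?p = "monom 1 m - [:complex_of_real \<rho> ^ m:]" and ?f = "\<lambda>l. rcis \<rho> (2 * pi * real l / real m)"
  have deg: "degree ?p = m"
    by (rule degree_monom_diff)
  then have p0: "?p \<noteq> 0" using assms by auto
  have inj: "inj_on ?f {..<m}"
  proof (rule inj_onI)
    fix a b assume *: "a \<in> {..<m}" "b \<in> {..<m}" "?f a = ?f b"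
    then have "cis (2 * pi * real a / real m) = cis (2 * pi * real b / real m)"
      using False by (simp add: rcis_def)
    with Complex.bij_betw_roots_unity[OF assms(1)] * show "a = b"
      by (auto simp: bij_betw_def inj_on_def)
  qed
  have "mset_set (?f ` {..<m}) \<subseteq># proots ?p"
  proof (rule mset_subset_eqI)
    fix w show "count (mset_set (?f ` {..<m})) w \<le> count (proots ?p) w"
    proof (cases "w \<in> ?f ` {..<m}")
      case True
      then obtain l where l: "w = ?f l" by auto
      have "w ^ m = of_real \<rho> ^ m"
        using assms by (simp add: l DeMoivre2) (simp add: rcis_def cis_multiple_2pi)
      then have "poly ?p w = 0" by (simp add: poly_monom)
      then have "order w ?p > 0" using p0 by (subst order_gt_0_iff)
      then show ?thesis using True p0 by simp
    qed simp
  qed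
  moreover have "size (proots ?p) = size (mset_set (?f ` {..<m}))"
    using inj deg by (simp add: size_proots_complex card_image)
  ultimately have "proots ?p = mset_set (?f ` {..<m})"
    by (metis nat_less_le mset_subset_size subset_mset.le_less)
  then show ?thesis using inj by (simp add: image_mset_mset_set)
qed

lemma power_le_imp_le_pos: "a ^ m \<le> b ^ m \<Longrightarrow> 0 \<le> b \<Longrightarrow> 0 < m \<Longrightarrow> a \<le> (b::real)"
  by (metis power_le_imp_le_base gr0_implies_Suc)

text \<open>As \<open>y\<close> is decreasing, \<open>y i\<close> is the radius with number
  \<open>j = n - i\<close> in increasing order, and both brackets approximate
  \<open>1 - N / (m j)\<close>. The upper one comes from the last factor in
  \<open>pochhammer_ratio_bounds\<close>, the lower one, with \<open>n - Suc i\<close> and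
  \<open>+ 1\<close>, from the first. The \<open>s\<close> roots at the origin are too few to form a
  full circle.\<close>

lemma proots_higher_pderiv:
  fixes y :: "nat \<Rightarrow> real"
  assumes m: "m > 0" and N: "N \<le> m * n"
    and y: "\<And>i. i < n \<Longrightarrow> 0 \<le> y i" "\<And>i j. i \<le> j \<Longrightarrow> j < n \<Longrightarrow> y j \<le> y i"
  shows "\<exists>s d \<rho>. s < m \<and> N + m * d + s = m * n \<and>
    (\<forall>i<d. 0 \<le> \<rho> i \<and>
      \<rho> i \<le> root m (real n ^ 2) * y i * (1 - real N / (real m * real (n - i))) \<and>
      y i * (1 - real N / (real m * real (n - Suc i) + 1)) \<le> root m (real n ^ 2) * \<rho> i) \<and>
    proots ((pderiv ^^ N) (\<Prod>i<n. monom 1 m - [:complex_of_real (y i) ^ m:])) =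
      replicate_mset s 0 + (\<Sum>i<d. image_mset (\<lambda>l. rcis (\<rho> i) (2 * pi * real l / real m)) (mset_set {..<m}))"
proof -
  define G0 where "G0 = (\<Prod>i<n. [:- complex_of_real (y i ^ m), 1:])"
  define P where "P = (\<Prod>i<n. monom 1 m - [:complex_of_real (y i) ^ m:])"
  have P: "P = pcompose G0 (monom 1 m)"
    by (simp add: P_def G0_def pcompose_prod pcompose_linear)
  have dG0: "degree G0 = n" by (simp add: G0_def degree_prod_sum_eq)
  have "nonneg_roots G0"
    using y by (auto simp: nonneg_roots_def G0_def poly_prod simp flip: of_real_power)
  then obtain s G where s: "s < m" and G: "nonneg_roots G"
    and PN: "(pderiv ^^ N) P = monom 1 s * pcompose G (monom 1 m)"
    using higher_pderiv_pcompose_monom[of G0 m N] m N dG0 P by auto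
  define d where "d = degree G"
  have G0': "G \<noteq> 0" using G by (simp add: nonneg_roots_def)
  then have comp0: "pcompose G (monom 1 m) \<noteq> 0"
    using m by (subst pcompose_eq_0_iff) (auto simp: degree_monom_eq)
  have "degree ((pderiv ^^ N) P) = n * m - N"
    by (simp add: degree_higher_pderiv P degree_pcompose degree_monom_eq dG0)
  then have "n * m - N = s + d * m"
    using comp0 by (simp add: PN degree_mult_eq degree_pcompose degree_monom_eq d_def)
  then have eq: "N + m * d + s = m * n" using N by (simp add: algebra_simps)
  then have "m * d \<le> m * n" by linarith
  then have dn: "d \<le> n" using m by simp
  obtain z where z: "G = smult (lead_coeff G) (\<Prod>i<d. [:- of_real (z i), 1:])"
    "\<And>i. i < d \<Longrightarrow> 0 \<le> z i" "\<And>i j. i \<le> j \<Longrightarrow> j < d \<Longrightarrow> z j \<le> z i"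
    using nonneg_roots_factorization[OF G] unfolding d_def by blast
  \<comment> \<open>The factor by which \<open>N\<close> derivatives turn the coefficient of degree
    \<open>m * (n - k)\<close> of \<open>P\<close> into the one of degree
    \<open>m * (d - k) + s\<close>; by \<open>eq\<close> these degrees differ by
    \<open>N\<close>.\<close>
  define c where "c k = pochhammer (real (Suc (m * (d - k) + s))) N" for k
  have cpos: "c k > 0" for k unfolding c_def by (intro pochhammer_pos) (simp only: of_nat_0_less_iff zero_less_Suc)
  have co: "lead_coeff G * esym (\<lambda>i. of_real (z i)) d k = of_real (c k) * esym (\<lambda>i. of_real (y i ^ m)) n k"
    if k: "k \<le> d" for k
  proof -
    have "coeff G (d - k) = coeff ((pderiv ^^ N) P) (m * (d - k) + s)"
      using m by (simp add: PN coeff_monom_mult coeff_pcompose_monom)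
    also have "\<dots> = of_real (c k) * coeff P (m * (d - k) + s + N)"
      unfolding coeff_higher_pderiv c_def by (subst of_real_of_nat_eq[symmetric]) (simp only: pochhammer_of_real)
    also have "m * (d - k) + s + N = m * (n - k)"
      using mult_le_mono2[OF k, of m] eq unfolding diff_mult_distrib2 by linarith
    also have "coeff P (m * (n - k)) = coeff G0 (n - k)"
      unfolding P using m by (rule coeff_pcompose_monom)
    also have "\<dots> = (-1) ^ k * esym (\<lambda>i. of_real (y i ^ m)) n k"
      unfolding G0_def using k dn by (intro coeff_prod_linear_esym) simp
    finally have "coeff G (d - k) = of_real (c k) * ((-1) ^ k * esym (\<lambda>i. of_real (y i ^ m)) n k)" .
    moreover have "coeff G (d - k) = lead_coeff G * ((-1) ^ k * esym (\<lambda>i. of_real (z i)) d k)"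
      by (subst z(1)) (simp add: coeff_prod_linear_esym[OF k])
    ultimately show ?thesis by simp
  qed
  \<comment> \<open>At \<open>k = 0\<close> both symmetric polynomials are 1, which determines the
    leading coefficient; dividing by it normalises the factors to \<open>c k / c 0\<close>.\<close>
  have lc: "lead_coeff G = of_real (c 0)" using co[of 0] by simp
  have e: "esym z d k = c k / c 0 * esym (\<lambda>i. y i ^ m) n k" if "k \<le> d" for k
  proof -
    have "complex_of_real (c 0 * esym z d k) = of_real (c k * esym (\<lambda>i. y i ^ m) n k)"
      using co[OF that] unfolding lc esym_of_real by simp
    then have "c 0 * esym z d k = c k * esym (\<lambda>i. y i ^ m) n k" by (simp only: of_real_eq_iff)
    then show ?thesis using cpos[of 0] by (simp add: field_simps)
  qed
  define \<rho> where "\<rho> i = root m (z i)" for i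
  have \<rho>m: "\<rho> i ^ m = z i" "0 \<le> \<rho> i" if "i < d" for i
    using z(2)[OF that] m by (auto simp: \<rho>_def)
  have bounds: "\<rho> i \<le> root m (real n ^ 2) * y i * (1 - real N / (real m * real (n - i))) \<and>
      y i * (1 - real N / (real m * real (n - Suc i) + 1)) \<le> root m (real n ^ 2) * \<rho> i"
    if i: "i < d" for i
  proof -
    have yi: "0 \<le> y i" using y i dn by simp
    have "z i \<le> real n ^ 2 * (c (Suc i) / c 0 / (c i / c 0) * y i ^ m)"
      "c (Suc i) / c 0 / (c i / c 0) * y i ^ m \<le> real n ^ 2 * z i"
      using y z e i dn cpos
      by (intro esym_ratio_bounds[where b = "\<lambda>k. c k / c 0" and d = d]; auto intro: power_mono)+
    moreover have "c (Suc i) / c 0 / (c i / c 0) = c (Suc i) / c i" using cpos[of 0] by simp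
    ultimately have zb: "z i \<le> real n ^ 2 * (c (Suc i) / c i * y i ^ m)"
      "c (Suc i) / c i * y i ^ m \<le> real n ^ 2 * z i" by auto
    \<comment> \<open>Chosen so that \<open>c (Suc i)\<close> and \<open>c i\<close> are the
      Pochhammer products starting at \<open>a\<close> and at \<open>a + real m\<close>.\<close>
    define a where "a = real (Suc (m * (d - Suc i) + s))"
    have "d - i = Suc (d - Suc i)" using i by simp
    then have "real (Suc (m * (d - i) + s)) = a + real m" by (simp add: a_def)
    then have cc: "c (Suc i) / c i = pochhammer a N / pochhammer (a + real m) N"
      unfolding c_def a_def by (simp only:)
    have a0: "0 < a" unfolding a_def by (simp only: of_nat_0_less_iff zero_less_Suc)
    have "N + m * (d - Suc i) + s = m * (n - Suc i)"
      using mult_le_mono2[OF Suc_leI[OF i], of m] eq unfolding diff_mult_distrib2 by linarith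
    then have aN: "a + real N = real m * real (n - Suc i) + 1"
      unfolding a_def by (simp flip: of_nat_mult of_nat_add)
    have "n - i = Suc (n - Suc i)" using i dn by simp
    then have "real m * real (n - i) = real m * real (n - Suc i) + real m" by (simp add: algebra_simps)
    then have aNm: "a + real N + real m - 1 = real m * real (n - i)" using aN by simp
    have pos: "0 < real m * real (n - i)" using m i dn by simp
    have posD: "0 < a + real N + real m - 1" unfolding aNm by (rule pos)
    have "a / (a + real N) = 1 - real N / (real m * real (n - Suc i) + 1)"
      unfolding aN[symmetric] using a0 by (simp add: field_simps)
    moreover have "(a + real m - 1) / (a + real N + real m - 1) = 1 - real N / (real m * real (n - i))"
      unfolding aNm[symmetric] using posD by (simp add: divide_simps)
    ultimately have lo: "(1 - real N / (real m * real (n - Suc i) + 1)) ^ m \<le> c (Suc i) / c i"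
      and hi: "c (Suc i) / c i \<le> (1 - real N / (real m * real (n - i))) ^ m"
      using pochhammer_ratio_bounds[OF a0, of N m] unfolding cc by simp_all
    \<comment> \<open>The base on the right must be nonnegative before \<open>m\<close>-th powers
      can be stripped; it is the quotient of \<open>a + m - 1\<close> and
      \<open>a + N + m - 1\<close>.\<close>
    have u0: "0 \<le> 1 - real N / (real m * real (n - i))"
      unfolding aNm[symmetric] diff_ge_0_iff_ge pos_divide_le_eq[OF posD] using a0 m by simp
    have rm: "root m (real n ^ 2) ^ m = real n ^ 2" using m by simp
    have "\<rho> i ^ m \<le> (root m (real n ^ 2) * y i * (1 - real N / (real m * real (n - i)))) ^ m"
      unfolding power_mult_distrib rm \<rho>m(1)[OF i]
      using order_trans[OF zb(1) mult_left_mono[OF mult_right_mono[OF hi, of "y i ^ m"], of "real n ^ 2"]] yi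
      by (simp only: mult.assoc mult.commute[of "y i ^ m"]) simp
    then have 1: "\<rho> i \<le> root m (real n ^ 2) * y i * (1 - real N / (real m * real (n - i)))"
      by (rule power_le_imp_le_pos) (use yi u0 m in \<open>auto intro!: mult_nonneg_nonneg\<close>)
    have "(y i * (1 - real N / (real m * real (n - Suc i) + 1))) ^ m \<le> (root m (real n ^ 2) * \<rho> i) ^ m"
      unfolding power_mult_distrib rm \<rho>m(1)[OF i]
      using order_trans[OF mult_right_mono[OF lo, of "y i ^ m"] zb(2)] yi
      by (simp only: mult.commute[of "y i ^ m"]) simp
    then have "y i * (1 - real N / (real m * real (n - Suc i) + 1)) \<le> root m (real n ^ 2) * \<rho> i"
      by (rule power_le_imp_le_pos) (use \<rho>m(2)[OF i] m in \<open>auto intro!: mult_nonneg_nonneg\<close>)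
    with 1 show ?thesis by blast
  qed
  have "pcompose G (monom 1 m) = smult (lead_coeff G) (\<Prod>i<d. monom 1 m - [:complex_of_real (\<rho> i) ^ m:])"
    by (subst z(1)) (auto simp: pcompose_smult pcompose_prod pcompose_linear \<rho>m simp flip: of_real_power intro!: prod.cong)
  then have "proots (pcompose G (monom 1 m)) = proots (\<Prod>i<d. monom 1 m - [:complex_of_real (\<rho> i) ^ m:])"
    using G0' by simp
  also have "\<dots> = (\<Sum>i<d. proots (monom 1 m - [:complex_of_real (\<rho> i) ^ m:]))"
  proof (rule proots_prod)
    fix i
    have "degree (monom 1 m - [:complex_of_real (\<rho> i) ^ m:]) = m"
      by (rule degree_monom_diff)
    then show "monom 1 m - [:complex_of_real (\<rho> i) ^ m:] \<noteq> 0" using m by auto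
  qed
  also have "\<dots> = (\<Sum>i<d. image_mset (\<lambda>l. rcis (\<rho> i) (2 * pi * real l / real m)) (mset_set {..<m}))"
    using \<rho>m m by (intro sum.cong refl proots_monom_diff) auto
  finally have pG: "proots (pcompose G (monom 1 m)) =
    (\<Sum>i<d. image_mset (\<lambda>l. rcis (\<rho> i) (2 * pi * real l / real m)) (mset_set {..<m}))" .
  have "proots (monom 1 s :: complex poly) = replicate_mset s 0"
    by (rule proots_monom)
  with pG have "proots ((pderiv ^^ N) P) = replicate_mset s 0 +
    (\<Sum>i<d. image_mset (\<lambda>l. rcis (\<rho> i) (2 * pi * real l / real m)) (mset_set {..<m}))"
    using comp0 by (simp add: PN proots_mult)
  with s eq bounds \<rho>m(2) show ?thesis unfolding P_def by blast
qed

subsection \<open>Quantiles\<close>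

locale compact_distribution = real_distribution \<nu> for \<nu> :: "real measure" +
  assumes AE_nonneg: "AE x in \<nu>. 0 \<le> x" and compact_support: "compact (measure_support \<nu>)"
begin

lemma distfun_eq_cdf: "distfun \<nu> y = cdf \<nu> y"
  unfolding distfun_def cdf_def using AE_nonneg by (intro finite_measure_eq_AE) auto

lemma mono_distfun: "x \<le> y \<Longrightarrow> distfun \<nu> x \<le> distfun \<nu> y"
  by (simp add: distfun_eq_cdf cdf_nondecreasing)

text \<open>Every point off the support has an open null neighbourhood, and by Lindelof countably
  many of these cover the complement.\<close>

lemma AE_support: "AE x in \<nu>. x \<in> measure_support \<nu>"
proof -
  define \<F> where "\<F> = {U. open U \<and> emeasure \<nu> U = 0}"
  obtain \<G> where \<G>: "\<G> \<subseteq> \<F>" "countable \<G>" "\<Union>\<G> = \<Union>\<F>"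
    using Lindelof[of \<F>] by (auto simp: \<F>_def)
  have "\<Union>\<G> \<in> null_sets \<nu>"
    using \<G> by (intro null_sets_UN'[of \<G> id, simplified]) (auto simp: \<F>_def null_sets_def)
  moreover have "{x \<in> space \<nu>. x \<notin> measure_support \<nu>} \<subseteq> \<Union>\<G>"
    unfolding \<G>(3) by (auto simp: measure_support_def \<F>_def)
  ultimately show ?thesis by (rule AE_I')
qed

text \<open>This is where compactness enters: the infimum defining the quantile is over a nonempty
  set even at level 1.\<close>

lemma ex_distfun_eq_1: "\<exists>B\<ge>0. distfun \<nu> B = 1"
proof -
  obtain B where "\<And>x. x \<in> measure_support \<nu> \<Longrightarrow> norm x \<le> B"
    using compact_imp_bounded[OF compact_support] by (auto simp: bounded_iff)
  then have "x \<in> {0..max 0 B}" if "x \<in> measure_support \<nu>" "0 \<le> x" for x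
    using that by force
  with AE_support AE_nonneg have "AE x in \<nu>. x \<in> {0..max 0 B}"
    by auto
  then have "distfun \<nu> (max 0 B) = 1"
    unfolding distfun_def by (subst prob_eq_1) auto
  then show ?thesis by (intro exI[of _ "max 0 B"]) auto
qed

lemma ex_le_distfun: "v \<le> 1 \<Longrightarrow> \<exists>B\<ge>0. v \<le> distfun \<nu> B"
  using ex_distfun_eq_1 by auto

lemma distfun_le_1: "distfun \<nu> y \<le> 1" and distfun_nonneg: "0 \<le> distfun \<nu> y"
  by (simp_all add: distfun_def)

text \<open>Right continuity of the distribution function turns the infimum into a minimum. At
  \<open>v = 0\<close> the equivalence fails for negative \<open>y\<close>: the quantile is 0, while
  \<open>0 \<le> distfun \<nu> y\<close> holds.\<close>

lemma quantile_le_iff: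
  assumes v: "0 < v" "v \<le> 1"
  shows "quantile \<nu> v \<le> y \<longleftrightarrow> v \<le> distfun \<nu> y"
proof -
  define S where "S = {y. 0 \<le> y \<and> v \<le> distfun \<nu> y}"
  have q: "quantile \<nu> v = Inf S" by (simp add: quantile_def S_def distfun_def)
  obtain B where "B \<in> S" using ex_le_distfun[OF v(2)] by (auto simp: S_def)
  then have ne: "S \<noteq> {}" by auto
  have bdd: "bdd_below S" by (auto simp: S_def)
  have nn: "0 \<le> Inf S" using ne by (intro cInf_greatest) (auto simp: S_def)
  have "Inf S \<in> S"
  proof (rule ccontr)
    assume notin: "Inf S \<notin> S"
    with nn have "cdf \<nu> (Inf S) < v" by (auto simp: S_def distfun_eq_cdf)
    then have "eventually (\<lambda>y. cdf \<nu> y < v) (at_right (Inf S))"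
      using cdf_is_right_cont[of "Inf S"] unfolding continuous_within by (rule order_tendstoD(2)[rotated])
    then obtain b where b: "b > Inf S" "\<And>y. Inf S < y \<Longrightarrow> y < b \<Longrightarrow> cdf \<nu> y < v"
      using eventually_at_right[of "Inf S" "Inf S + 1"] by auto
    then obtain y where y: "y \<in> S" "y < b" using ne bdd by (auto simp: cInf_less_iff)
    then have "Inf S < y" using notin cInf_lower[OF y(1) bdd] by (metis less_eq_real_def)
    then have "cdf \<nu> y < v" using b(2) y(2) by blast
    with y show False by (simp add: S_def distfun_eq_cdf)
  qed
  then have "v \<le> distfun \<nu> y" if "Inf S \<le> y"
    using mono_distfun[OF that] by (auto simp: S_def)
  moreover have "Inf S \<le> y" if "v \<le> distfun \<nu> y"
  proof -
    have "0 \<le> y" using that v by (cases "0 \<le> y") (auto simp: distfun_def)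
    then show ?thesis using that bdd by (intro cInf_lower) (auto simp: S_def)
  qed
  ultimately show ?thesis unfolding q by blast
qed

lemma quantile_0: "quantile \<nu> 0 = 0"
  by (auto simp: quantile_def intro!: cInf_eq_minimum)

lemma quantile_nonneg: "v \<le> 1 \<Longrightarrow> 0 \<le> quantile \<nu> v"
proof -
  assume v: "v \<le> 1"
  obtain B where "B \<ge> 0" "v \<le> distfun \<nu> B" using ex_le_distfun[OF v] by auto
  then show ?thesis unfolding quantile_def distfun_def by (intro cInf_greatest) auto
qed

lemma quantile_mono: "u \<le> v \<Longrightarrow> v \<le> 1 \<Longrightarrow> quantile \<nu> u \<le> quantile \<nu> v"
proof -
  assume uv: "u \<le> v" "v \<le> 1"
  obtain B where "B \<ge> 0" "v \<le> distfun \<nu> B" using ex_le_distfun[OF uv(2)] by auto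
  with uv show ?thesis unfolding quantile_def distfun_def by (intro cInf_superset_mono) auto
qed

text \<open>\<open>y < quantile \<nu> v\<close> means \<open>distfun \<nu> y < v\<close>, a strict
  inequality that survives for levels slightly below \<open>v\<close>; the other half is
  monotonicity.\<close>

lemma quantile_left_cont:
  assumes v: "0 < v" "v \<le> 1"
  shows "(quantile \<nu> \<longlongrightarrow> quantile \<nu> v) (at_left v)"
proof (rule order_tendstoI)
  fix y assume "y < quantile \<nu> v"
  then have "distfun \<nu> y < v" using quantile_le_iff[OF v] by (simp add: not_le[symmetric])
  then have "eventually (\<lambda>u. max 0 (distfun \<nu> y) < u) (at_left v)"
    using v by (auto simp: eventually_at_left intro!: exI[of _ "max 0 (distfun \<nu> y)"])
  then show "eventually (\<lambda>u. y < quantile \<nu> u) (at_left v)"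
    using eventually_at_left_real[of 0 v, OF v(1)]
  proof eventually_elim
    case (elim u)
    then show ?case using quantile_le_iff[of u y] v by auto
  qed
next
  fix y assume "quantile \<nu> v < y"
  then have "quantile \<nu> u < y" if "u < v" for u using quantile_mono[of u v] that v by simp
  then show "eventually (\<lambda>u. quantile \<nu> u < y) (at_left v)"
    by (auto simp: eventually_at_filter)
qed

lemma quantile_measurable [measurable]: "quantile \<nu> \<in> borel_measurable borel"
proof -
  \<comment> \<open>The quantile is monotone only up to level 1. Beyond, the defining set is empty
    and the value is the constant \<open>Inf {}\<close>; \<open>g\<close> replaces this by a
    monotone continuation.\<close>
  define g where "g v = quantile \<nu> (min v 1)" for v
  have empty: "{y. 0 \<le> y \<and> v \<le> measure \<nu> {0..y}} = {}" if "1 < v" for v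
    using distfun_le_1 that unfolding distfun_def by (smt (verit) Collect_empty_eq)
  have eq: "quantile \<nu> = (\<lambda>v. if v \<le> 1 then g v else Inf {})"
  proof
    fix v show "quantile \<nu> v = (if v \<le> 1 then g v else Inf {})"
      using arg_cong[OF empty[of v], of Inf] by (auto simp: g_def quantile_def)
  qed
  have [measurable]: "g \<in> borel_measurable borel"
    unfolding g_def by (intro borel_measurable_mono monoI quantile_mono) auto
  show ?thesis unfolding eq by measurable
qed

section \<open>The law of the limiting radii and its quantiles\<close>

definition level :: "real \<Rightarrow> real \<Rightarrow> real" where
  "level t v = (1 - t / v) * quantile \<nu> v"

lemma level_measurable [measurable]: "level t \<in> borel_measurable borel"
  unfolding level_def by measurable

lemma level_self: "level t t = 0"
  using quantile_0 by (cases "t = 0") (auto simp: level_def)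

lemma level_nonneg: "0 \<le> t \<Longrightarrow> t \<le> v \<Longrightarrow> v \<le> 1 \<Longrightarrow> 0 \<le> level t v"
  unfolding level_def by (intro mult_nonneg_nonneg quantile_nonneg) (auto simp: divide_le_eq_1)

lemma level_mono:
  assumes "0 < t" "t \<le> u" "u \<le> v" "v \<le> 1"
  shows "level t u \<le> level t v"
  unfolding level_def using assms
  by (intro mult_mono quantile_mono quantile_nonneg) (auto simp: divide_le_eq_1 intro!: divide_left_mono)

lemma level_left_cont:
  assumes "0 \<le> t" "t < v" "v \<le> 1"
  shows "(level t \<longlongrightarrow> level t v) (at_left v)"
  unfolding level_def using assms by (intro tendsto_intros quantile_left_cont) auto

text \<open>The factor \<open>1 - t\<close> cancels the normalisation of the uniform law, which
  leaves the image of plain Lebesgue measure on \<open>{t..1}\<close>. This is why the quantiles of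
  the scaled measure involve nothing but a shift of the argument by \<open>t\<close>.\<close>

lemma scaled_nu_emeasure:
  assumes t: "t \<in> {0<..<1}" and A: "A \<in> sets borel"
  shows "emeasure (scaled_nu \<nu> t) A = emeasure lborel ({t..1} \<inter> level t -` A)"
proof -
  have m: "(\<lambda>v. (1 - t / v) * quantile \<nu> v) \<in> borel_measurable (uniform_measure lborel {t..1})"
    by measurable
  have "emeasure (nu \<nu> t) A = emeasure (uniform_measure lborel {t..1}) (level t -` A)"
    unfolding nu_def using A m by (subst emeasure_distr) (auto simp: level_def[abs_def])
  also have "\<dots> = emeasure lborel ({t..1} \<inter> level t -` A) / ennreal (1 - t)"
    using A t measurable_sets[OF level_measurable, of A t] by (subst emeasure_uniform_measure) auto
  finally have "emeasure (scaled_nu \<nu> t) A = ennreal (1 - t) * (emeasure lborel ({t..1} \<inter> level t -` A) / ennreal (1 - t))"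
    using t by (simp add: scaled_nu_def)
  also have "\<dots> = emeasure lborel ({t..1} \<inter> level t -` A)"
    using t unfolding ennreal_times_divide by (subst mult.commute, subst ennreal_mult_divide_eq) auto
  finally show ?thesis .
qed

lemma Psi_eq:
  assumes t: "t \<in> {0<..<1}"
  shows "Psi \<nu> t y = measure lborel {v \<in> {t..1}. level t v \<le> y}"
proof -
  have "{t..1} \<inter> level t -` {0..y} = {v \<in> {t..1}. level t v \<le> y}"
    using t level_nonneg by auto
  then show ?thesis
    using scaled_nu_emeasure[OF t, of "{0..y}"] by (simp add: Psi_def distfun_def measure_def)
qed

text \<open>\<open>Psi \<nu> t y\<close> is the length of the set where \<open>level t\<close> is at
  most \<open>y\<close>. If nonempty, this set is an interval beginning at \<open>t\<close> by
  monotonicity, and left continuity makes it closed, so its length decides whether it contains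
  \<open>v\<close>.\<close>

lemma le_Psi_iff:
  assumes t: "t \<in> {0<..<1}" and v: "t < v" "v \<le> 1"
  shows "v - t \<le> Psi \<nu> t y \<longleftrightarrow> level t v \<le> y"
proof
  have meas: "{v \<in> {t..1}. level t v \<le> y} \<in> sets lborel" by measurable
  have fm: "{v \<in> {t..1}. level t v \<le> y} \<in> fmeasurable lborel"
    by (rule fmeasurableI2[of "{t..1}"]) (use meas in \<open>auto simp: fmeasurable_def emeasure_lborel_Icc_eq\<close>)
  assume "level t v \<le> y"
  then have "{t..v} \<subseteq> {v \<in> {t..1}. level t v \<le> y}"
    using level_mono[of t _ v] t v by force
  then have "measure lborel {t..v} \<le> Psi \<nu> t y"
    unfolding Psi_eq[OF t] by (intro measure_mono_fmeasurable fm) auto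
  then show "v - t \<le> Psi \<nu> t y" using v by simp
next
  assume le: "v - t \<le> Psi \<nu> t y"
  show "level t v \<le> y"
  proof (rule ccontr)
    assume "\<not> level t v \<le> y"
    then have "eventually (\<lambda>u. y < level t u) (at_left v)"
      using level_left_cont[of t v] t v by (intro order_tendstoD) auto
    moreover have "eventually (\<lambda>u. u \<in> {t<..<v}) (at_left v)"
      using v by (intro eventually_at_left_real)
    ultimately have "eventually (\<lambda>u. y < level t u \<and> u \<in> {t<..<v}) (at_left v)" by eventually_elim auto
    then obtain u where u: "y < level t u" "t < u" "u < v"
      using eventually_happens'[OF trivial_limit_at_left_real] by force
    have "w \<le> u" if "w \<in> {t..1}" "level t w \<le> y" for w
    proof (rule ccontr)
      assume "\<not> w \<le> u"
      then have "level t u \<le> level t w" using that u t by (intro level_mono) auto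
      with u that show False by simp
    qed
    then have "Psi \<nu> t y \<le> measure lborel {t..u}"
      unfolding Psi_eq[OF t] by (intro measure_mono_fmeasurable) (auto simp: fmeasurable_def emeasure_lborel_Icc_eq)
    with le u show False by simp
  qed
qed

lemma Psi_nonneg: "0 \<le> Psi \<nu> t y"
  by (simp add: Psi_def distfun_def)

lemma scaled_nu_mass: "t \<in> {0<..<1} \<Longrightarrow> emeasure (scaled_nu \<nu> t) UNIV = ennreal (1 - t)"
  by (subst scaled_nu_emeasure) auto

lemma quantile_scaled_nu_level:
  assumes t: "t \<in> {0<..<1}" and x: "0 \<le> x" "x \<le> 1 - t"
  shows "quantile (scaled_nu \<nu> t) x = level t (x + t)"
proof (cases "x = 0")
  case True
  then show ?thesis by (auto simp: level_self quantile_def intro!: cInf_eq_minimum)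
next
  case False
  have "{y. 0 \<le> y \<and> x \<le> measure (scaled_nu \<nu> t) {0..y}} = {level t (x + t)..}"
    using le_Psi_iff[OF t, of "x + t"] level_nonneg[of t "x + t"] False x t
    unfolding Psi_def distfun_def by force
  then show ?thesis by (simp add: quantile_def)
qed

lemma quantile_scaled_nu:
  assumes t: "t \<in> {0<..<1}" and x: "0 \<le> x" "x \<le> 1 - t"
  shows "quantile (scaled_nu \<nu> t) x = x * quantile \<nu> (x + t) / (x + t)"
  using assms by (simp add: quantile_scaled_nu_level level_def divide_simps)

end

subsection \<open>Convergence of quantiles and of empirical measures\<close>

lemma integral_uniform_lborel:
  fixes g :: "real \<Rightarrow> real"
  assumes A: "A \<in> sets borel" "emeasure lborel A = ennreal c" "0 < c" and g: "g \<in> borel_measurable borel"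
  shows "(\<integral>x. g x \<partial>uniform_measure lborel A) = (\<integral>x. indicator A x * g x \<partial>lborel) / c"
proof -
  have "uniform_measure lborel A = density lborel (\<lambda>x. ennreal (indicator A x / c))"
    unfolding uniform_measure_def A(2)
    using A divide_ennreal[of 1 c] by (intro density_cong) (auto split: split_indicator)
  then have "(\<integral>x. g x \<partial>uniform_measure lborel A) = (\<integral>x. (indicator A x / c) *\<^sub>R g x \<partial>lborel)"
    using A g by (simp add: integral_density)
  also have "\<dots> = (\<integral>x. indicator A x * g x / c \<partial>lborel)"
    by (simp add: field_simps)
  finally show ?thesis by simp
qed

text \<open>Makes averages over \<open>k\<close> indices accessible to dominated convergence: with
  \<open>T = 1\<close> for the numbering of the circles, with \<open>T = 2 * pi\<close> for the
  angles on one circle.\<close>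

lemma integral_step_function:
  fixes h :: "nat \<Rightarrow> real"
  assumes k: "k > 0" and T: "0 < T"
  shows "(\<integral>x. h (nat \<lfloor>real k * x / T\<rfloor>) \<partial>uniform_measure lborel {0..<T}) = (\<Sum>l<k. h l) / real k"
proof -
  define J where "J l = {real l * T / real k..<real (Suc l) * T / real k}" for l
  have Jle: "real l * T / real k \<le> real (Suc l) * T / real k" for l
    using T by (intro divide_right_mono mult_right_mono) auto
  have J: "x \<in> J l \<longleftrightarrow> 0 \<le> x \<and> nat \<lfloor>real k * x / T\<rfloor> = l" for x l
  proof -
    have "x \<in> J l \<longleftrightarrow> real l \<le> real k * x / T \<and> real k * x / T < real l + 1"
      using k T by (simp add: J_def field_simps)
    also have "\<dots> \<longleftrightarrow> \<lfloor>real k * x / T\<rfloor> = int l" by (simp add: floor_eq_iff)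
    also have "\<dots> \<longleftrightarrow> 0 \<le> x \<and> nat \<lfloor>real k * x / T\<rfloor> = l"
    proof (cases "0 \<le> x")
      case True
      then have "0 \<le> \<lfloor>real k * x / T\<rfloor>" using T by simp
      with True show ?thesis by auto
    next
      case False
      then have "real k * x / T < 0" using k T by (simp add: divide_less_0_iff mult_pos_neg)
      then have "\<lfloor>real k * x / T\<rfloor> \<noteq> int l" by linarith
      with False show ?thesis by auto
    qed
    finally show ?thesis .
  qed
  have lt: "nat \<lfloor>real k * x / T\<rfloor> < k \<longleftrightarrow> x < T" for x
  proof -
    have "nat \<lfloor>real k * x / T\<rfloor> < k \<longleftrightarrow> \<lfloor>real k * x / T\<rfloor> < int k" using k by linarith
    also have "\<dots> \<longleftrightarrow> x < T" using k T by (simp add: floor_less_iff field_simps)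
    finally show ?thesis .
  qed
  have "indicator {0..<T} x * h (nat \<lfloor>real k * x / T\<rfloor>) = (\<Sum>l<k. h l * indicator (J l) x)" for x
  proof (cases "x \<in> {0..<T}")
    case True
    then have "(\<Sum>l<k. h l * indicator (J l) x) = (\<Sum>l<k. if nat \<lfloor>real k * x / T\<rfloor> = l then h l else 0)"
      by (intro sum.cong) (auto simp: indicator_def J)
    also have "\<dots> = h (nat \<lfloor>real k * x / T\<rfloor>)" using lt[of x] True by simp
    finally show ?thesis using True by simp
  next
    case False
    then have "x \<notin> J l" if "l < k" for l using J[of x l] lt[of x] that by auto
    with False show ?thesis by simp
  qed
  then have "(\<integral>x. indicator {0..<T} x * h (nat \<lfloor>real k * x / T\<rfloor>) \<partial>lborel) =
      (\<integral>x. (\<Sum>l<k. h l * indicator (J l) x) \<partial>lborel)"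
    by simp
  also have "\<dots> = (\<Sum>l<k. h l * measure lborel (J l))"
    using Jle by (subst Bochner_Integration.integral_sum) (auto simp: J_def intro!: integrable_real_indicator)
  also have "\<dots> = (\<Sum>l<k. h l * (T / real k))"
    using T k Jle by (intro sum.cong refl, subst J_def, subst measure_lborel_Ico) (auto simp: field_simps)
  finally have "(\<integral>x. indicator {0..<T} x * h (nat \<lfloor>real k * x / T\<rfloor>) \<partial>lborel) = (\<Sum>l<k. h l) * (T / real k)"
    by (simp add: sum_distrib_right sum_divide_distrib)
  moreover have "(\<lambda>x. h (nat \<lfloor>real k * x / T\<rfloor>)) \<in> borel_measurable borel"
    by measurable
  ultimately show ?thesis
    using T by (subst integral_uniform_lborel[of _ T]) auto
qed

lemma sum_mset_eq_sum_count:
  fixes f :: "'a \<Rightarrow> real"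
  shows "(\<Sum>x\<in>#X. f x) = (\<Sum>x\<in>set_mset X. real (count X x) * f x)"
proof (induction X)
  case (add a X)
  have "(\<Sum>x\<in>set_mset (add_mset a X). real (count (add_mset a X) x) * f x) =
      (\<Sum>x\<in>insert a (set_mset X). real (count X x) * f x + (if x = a then f x else 0))"
    by (intro sum.cong) (auto simp: algebra_simps)
  also have "\<dots> = (\<Sum>x\<in>insert a (set_mset X). real (count X x) * f x) + f a"
    by (simp add: sum.distrib)
  also have "(\<Sum>x\<in>insert a (set_mset X). real (count X x) * f x) = (\<Sum>x\<in>set_mset X. real (count X x) * f x)"
    by (intro sum.mono_neutral_right) (auto simp: count_eq_zero_iff)
  finally show ?case using add.IH by simp
qed simp

lemma integral_empirical_measure:
  fixes f :: "'a::topological_space \<Rightarrow> real"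
  assumes X: "X \<noteq> {#}" and f: "f \<in> borel_measurable borel"
  shows "(\<integral>x. f x \<partial>empirical_measure X) = (\<Sum>x\<in>#X. f x) / real (size X)"
proof -
  have "(\<integral>x. f x \<partial>empirical_measure X) = (\<integral>x. f x \<partial>measure_pmf (pmf_of_multiset X))"
    unfolding empirical_measure_def using f by (subst integral_distr) auto
  also have "\<dots> = (\<Sum>x\<in>set_mset X. f x * (real (count X x) / real (size X)))"
    using X by (subst integral_measure_pmf_real[of "set_mset X"]) auto
  also have "\<dots> = (\<Sum>x\<in>set_mset X. real (count X x) * f x) / real (size X)"
    by (simp add: sum_divide_distrib mult.commute)
  also have "(\<Sum>x\<in>set_mset X. real (count X x) * f x) = (\<Sum>x\<in>#X. f x)"
    by (rule sum_mset_eq_sum_count[symmetric])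
  finally show ?thesis .
qed

lemma rcis_measurable [measurable]: "(\<lambda>(x, \<theta>). rcis x \<theta>) \<in> borel_measurable (borel \<Otimes>\<^sub>M borel)"
  unfolding borel_prod by (intro borel_measurable_continuous_onI) (auto simp: rcis_def split_beta intro!: continuous_intros)

lemma integral_times_unif:
  fixes f :: "complex \<Rightarrow> real"
  assumes \<nu>: "prob_space \<nu>" "sets \<nu> = sets borel" and f: "f \<in> borel_measurable borel" "\<And>z. \<bar>f z\<bar> \<le> B"
  shows "(\<integral>z. f z \<partial>times_unif \<nu>) = (\<integral>x. (\<integral>\<theta>. f (rcis x \<theta>) \<partial>uniform_measure lborel {0..<2 * pi}) \<partial>\<nu>)"
proof -
  let ?U = "uniform_measure lborel {0..<2 * pi}"
  interpret \<nu>: prob_space \<nu> by fact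
  interpret U: prob_space ?U by (rule prob_space_uniform_measure) auto
  interpret P: pair_prob_space \<nu> ?U ..
  note [measurable] = f(1)
  note [measurable_cong] = \<nu>(2)
  have "(\<integral>z. f z \<partial>times_unif \<nu>) = (\<integral>p. f (case p of (x, \<theta>) \<Rightarrow> rcis x \<theta>) \<partial>(\<nu> \<Otimes>\<^sub>M ?U))"
    unfolding times_unif_def by (subst integral_distr) auto
  also have "\<dots> = (\<integral>x. (\<integral>\<theta>. f (rcis x \<theta>) \<partial>?U) \<partial>\<nu>)"
  proof -
    have "integrable (\<nu> \<Otimes>\<^sub>M ?U) (\<lambda>p. f (case p of (x, \<theta>) \<Rightarrow> rcis x \<theta>))"
      using f(2) by (intro P.integrable_const_bound[of _ B]) auto
    from P.integral_fst'[OF this] show ?thesis by simp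
  qed
  finally show ?thesis .
qed

text \<open>A monotone function has only countably many discontinuities, so points at which weak
  convergence gives information lie in every interval.\<close>

lemma ex_isCont_cdf:
  assumes "real_distribution M" "a < b"
  obtains y where "a < y" "y < b" "isCont (cdf M) y"
proof -
  interpret real_distribution M by fact
  have "countable {x. \<not> isCont (cdf M) x}"
    using mono_on_ctble_discont[of UNIV "cdf M"] cdf_nondecreasing by (auto simp: mono_on_def)
  from open_minus_countable[OF this, of "{a<..<b}"] \<open>a < b\<close> that show ?thesis by auto
qed

context compact_distribution
begin

lemma cdf_empirical:
  assumes "n \<ge> 1"
  shows "cdf (empirical_measure (image_mset (r n) (mset_set {1..n}))) y = real (card {j \<in> {1..n}. r n j \<le> y}) / real n"
  using assms unfolding cdf_def
  by (subst measure_empirical_measure) (auto simp: filter_mset_image_mset mset_set_empty_iff)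

text \<open>The index is the least integer exceeding \<open>n v\<close>, so this entry is at most
  \<open>y\<close> exactly if the empirical distribution function exceeds \<open>v\<close> at
  \<open>y\<close>. It is compared with the limit at continuity points \<open>y'\<close> close to
  \<open>y\<close>. The upper bound uses a quantile at a level \<open>u > v\<close>, hence the
  continuity at \<open>v\<close>.\<close>

lemma quantile_convergence:
  assumes mono: "\<And>n. n \<ge> 1 \<Longrightarrow> mono_on {1..n} (r n)"
    and nn: "\<And>n j. 1 \<le> j \<Longrightarrow> j \<le> n \<Longrightarrow> 0 \<le> r n j"
    and conv: "weak_conv_m (\<lambda>n. empirical_measure (image_mset (r n) (mset_set {1..n}))) \<nu>"
    and v: "0 < v" "v < 1" and cont: "isCont (quantile \<nu>) v"
  shows "(\<lambda>n. r n (Suc (nat \<lfloor>real n * v\<rfloor>))) \<longlonglongrightarrow> quantile \<nu> v"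
proof (rule order_tendstoI)
  let ?F = "\<lambda>n. cdf (empirical_measure (image_mset (r n) (mset_set {1..n})))"
  let ?c = "\<lambda>n. Suc (nat \<lfloor>real n * v\<rfloor>)"
  have c: "?c n \<in> {1..n}" "real n * v < real (?c n)" "real (?c n) \<le> real n * v + 1" if "n \<ge> 1" for n
  proof -
    have "real n * v < real n" "0 \<le> real n * v" using that v by auto
    then have "nat \<lfloor>real n * v\<rfloor> < n" by (simp add: nat_less_iff floor_less_iff)
    then show "?c n \<in> {1..n}" by auto
    show "real n * v < real (?c n)" "real (?c n) \<le> real n * v + 1" using \<open>0 \<le> real n * v\<close> by linarith+
  qed
  have F: "(\<lambda>n. ?F n y) \<longlonglongrightarrow> cdf \<nu> y" if "isCont (cdf \<nu>) y" for y
    using conv that by (auto simp: weak_conv_m_def weak_conv_def)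
  {
    fix y assume "y < quantile \<nu> v"
    then obtain y' where y': "y < y'" "y' < quantile \<nu> v" "isCont (cdf \<nu>) y'"
      using ex_isCont_cdf[OF real_distribution_axioms] by metis
    then have "cdf \<nu> y' < v" using quantile_le_iff[of v y'] v by (auto simp: distfun_eq_cdf)
    with F[OF y'(3)] have "eventually (\<lambda>n. ?F n y' < v) sequentially" by (rule order_tendstoD)
    then show "eventually (\<lambda>n. y < r n (?c n)) sequentially"
      using eventually_ge_at_top[of 1]
    proof eventually_elim
      case (elim n)
      show ?case
      proof (rule ccontr)
        assume "\<not> y < r n (?c n)"
        then have "{1..?c n} \<subseteq> {j \<in> {1..n}. r n j \<le> y'}"
          using c[OF elim(2)] y'(1) mono_onD[OF mono[OF elim(2)], of _ "?c n"] by force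
        then have "card {1..?c n} \<le> card {j \<in> {1..n}. r n j \<le> y'}" by (intro card_mono) auto
        then have "real (?c n) \<le> real (card {j \<in> {1..n}. r n j \<le> y'})" by simp
        also have "\<dots> < real n * v"
          using elim(1) elim(2) unfolding cdf_empirical[OF elim(2)] by (simp add: field_simps)
        finally show False using c(2)[OF elim(2)] by simp
      qed
    qed
  next
    fix y assume "quantile \<nu> v < y"
    then have "eventually (\<lambda>u. quantile \<nu> u < y) (at_right v)"
      using cont by (intro order_tendstoD) (auto simp: continuous_within intro: tendsto_mono[OF at_le])
    moreover have "eventually (\<lambda>u. u \<in> {v<..<1}) (at_right v)" using v by (intro eventually_at_right_real)
    ultimately have "eventually (\<lambda>u. quantile \<nu> u < y \<and> u \<in> {v<..<1}) (at_right v)" by eventually_elim auto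
    then obtain u where u: "quantile \<nu> u < y" "v < u" "u < 1"
      using eventually_happens'[OF trivial_limit_at_right_real] by force
    then obtain y' where y': "quantile \<nu> u < y'" "y' < y" "isCont (cdf \<nu>) y'"
      using ex_isCont_cdf[OF real_distribution_axioms] by metis
    then have "v < cdf \<nu> y'" using quantile_le_iff[of u y'] u v by (auto simp: distfun_eq_cdf)
    with F[OF y'(3)] have "eventually (\<lambda>n. v < ?F n y') sequentially" by (rule order_tendstoD)
    then show "eventually (\<lambda>n. r n (?c n) < y) sequentially"
      using eventually_ge_at_top[of 1]
    proof eventually_elim
      case (elim n)
      show ?case
      proof (rule ccontr)
        assume "\<not> r n (?c n) < y"
        then have *: "y' < r n (?c n)" using y' by simp
        have "{j \<in> {1..n}. r n j \<le> y'} \<subseteq> {1..<?c n}"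
        proof
          fix j assume j: "j \<in> {j \<in> {1..n}. r n j \<le> y'}"
          have "j < ?c n"
          proof (rule ccontr)
            assume "\<not> j < ?c n"
            then have "r n (?c n) \<le> r n j"
              using j c[OF elim(2)] by (intro mono_onD[OF mono[OF elim(2)]]) auto
            with j * show False by simp
          qed
          with j show "j \<in> {1..<?c n}" by simp
        qed
        then have "card {j \<in> {1..n}. r n j \<le> y'} \<le> card {1..<?c n}" by (intro card_mono) auto
        then have "real (card {j \<in> {1..n}. r n j \<le> y'}) \<le> real (?c n) - 1" by simp
        also have "\<dots> \<le> real n * v" using c(3)[OF elim(2)] by simp
        also have "\<dots> < real (card {j \<in> {1..n}. r n j \<le> y'})"
          using elim(1) elim(2) unfolding cdf_empirical[OF elim(2)] by (simp add: field_simps)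
        finally show False by simp
      qed
    qed
  }
qed

lemma AE_isCont_quantile: "AE v in lborel. 0 < v \<and> v < 1 \<longrightarrow> isCont (quantile \<nu>) v"
proof -
  have "countable {v \<in> {0<..<1}. \<not> continuous (at v within {0<..<1}) (quantile \<nu>)}"
    by (intro mono_on_ctble_discont mono_onI quantile_mono) auto
  then have "AE v in lborel. v \<notin> {v \<in> {0<..<1}. \<not> continuous (at v within {0<..<1}) (quantile \<nu>)}"
    by (intro AE_not_in countable_imp_null_set_lborel)
  then show ?thesis
    by eventually_elim (auto simp: at_within_open[of _ "{0<..<1}"])
qed

end

text \<open>The average over the grid is the integral of \<open>f\<close> at the angle
  \<open>\<Theta> n \<theta>\<close>, which is \<open>\<theta>\<close> rounded down to the grid.
  Radius and rounded angle converge together, so dominated convergence handles the moving radius as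
  well.\<close>

lemma circle_average_convergence:
  fixes f :: "complex \<Rightarrow> real"
  assumes f: "continuous_on UNIV f" "\<And>z. \<bar>f z\<bar> \<le> B"
    and m: "filterlim m at_top sequentially" and X: "X \<longlonglongrightarrow> x"
  shows "(\<lambda>n. (\<Sum>l<m n. f (rcis (X n) (2 * pi * real l / real (m n)))) / real (m n))
    \<longlonglongrightarrow> (\<integral>\<theta>. f (rcis x \<theta>) \<partial>uniform_measure lborel {0..<2 * pi})"
proof -
  let ?U = "uniform_measure lborel {0..<2 * pi}"
  interpret U: prob_space ?U by (rule prob_space_uniform_measure) auto
  have [measurable]: "f \<in> borel_measurable borel" using f(1) by (rule borel_measurable_continuous_onI)
  define \<Theta> where "\<Theta> n \<theta> = 2 * pi * real (nat \<lfloor>real (m n) * \<theta> / (2 * pi)\<rfloor>) / real (m n)" for n \<theta>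
  have cont: "continuous_on UNIV (\<lambda>p. f (rcis (fst p) (snd p)))"
    by (intro continuous_on_compose2[OF f(1)]) (auto simp: rcis_def intro!: continuous_intros)
  have mr: "filterlim (\<lambda>n. real (m n)) at_top sequentially"
    using m by (rule filterlim_compose[OF filterlim_real_sequentially])
  have m0: "eventually (\<lambda>n. m n > 0) sequentially"
    using m[unfolded filterlim_at_top, rule_format, of 1] by eventually_elim simp
  have \<Theta>: "(\<lambda>n. \<Theta> n \<theta>) \<longlonglongrightarrow> \<theta>" if "0 \<le> \<theta>" for \<theta>
  proof (rule tendsto_sandwich)
    have bounds: "\<theta> - 2 * pi / real (m n) \<le> \<Theta> n \<theta> \<and> \<Theta> n \<theta> \<le> \<theta>" if n: "m n > 0" for n
    proof -
      define a where "a = real (m n) * \<theta> / (2 * pi)"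
      define u where "u = real (nat \<lfloor>a\<rfloor>)"
      have "0 \<le> a" using \<open>0 \<le> \<theta>\<close> by (simp add: a_def)
      then have "a - 1 \<le> u" "u \<le> a" unfolding u_def by linarith+
      then have "2 * pi / real (m n) * (a - 1) \<le> 2 * pi / real (m n) * u"
        "2 * pi / real (m n) * u \<le> 2 * pi / real (m n) * a"
        by (intro mult_left_mono; simp)+
      moreover have "2 * pi / real (m n) * a = \<theta>" using n by (simp add: a_def)
      moreover have "\<Theta> n \<theta> = 2 * pi / real (m n) * u" by (simp add: \<Theta>_def u_def a_def)
      ultimately show ?thesis by (simp add: right_diff_distrib)
    qed
    show "eventually (\<lambda>n. \<theta> - 2 * pi / real (m n) \<le> \<Theta> n \<theta>) sequentially"
      using m0 by eventually_elim (use bounds in auto)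
    show "eventually (\<lambda>n. \<Theta> n \<theta> \<le> \<theta>) sequentially"
      using m0 by eventually_elim (use bounds in auto)
    have "(\<lambda>n. \<theta> - 2 * pi / real (m n)) \<longlonglongrightarrow> \<theta> - 0"
      by (intro tendsto_diff tendsto_const real_tendsto_divide_at_top[OF tendsto_const mr])
    then show "(\<lambda>n. \<theta> - 2 * pi / real (m n)) \<longlonglongrightarrow> \<theta>" by simp
  qed auto
  have "(\<lambda>n. \<integral>\<theta>. f (rcis (X n) (\<Theta> n \<theta>)) \<partial>?U) \<longlonglongrightarrow> (\<integral>\<theta>. f (rcis x \<theta>) \<partial>?U)"
  proof (rule integral_dominated_convergence[where w = "\<lambda>_. B"])
    show "AE \<theta> in ?U. (\<lambda>n. f (rcis (X n) (\<Theta> n \<theta>))) \<longlonglongrightarrow> f (rcis x \<theta>)"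
    proof (rule AE_uniform_measureI)
      show "AE \<theta> in lborel. \<theta> \<in> {0..<2 * pi} \<longrightarrow> (\<lambda>n. f (rcis (X n) (\<Theta> n \<theta>))) \<longlonglongrightarrow> f (rcis x \<theta>)"
      proof (intro AE_I2 impI)
        fix \<theta> assume "\<theta> \<in> {0..<2 * pi}"
        then have "(\<lambda>n. (X n, \<Theta> n \<theta>)) \<longlonglongrightarrow> (x, \<theta>)" using X \<Theta>[of \<theta>] by (intro tendsto_Pair) auto
        from continuous_on_tendsto_compose[OF cont this]
        show "(\<lambda>n. f (rcis (X n) (\<Theta> n \<theta>))) \<longlonglongrightarrow> f (rcis x \<theta>)" by simp
      qed
    qed simp
    show "(\<lambda>\<theta>. f (rcis (X n) (\<Theta> n \<theta>))) \<in> borel_measurable ?U" for n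
      unfolding \<Theta>_def by measurable
  qed (use f(2) in auto)
  moreover have "eventually (\<lambda>n. (\<integral>\<theta>. f (rcis (X n) (\<Theta> n \<theta>)) \<partial>?U) =
      (\<Sum>l<m n. f (rcis (X n) (2 * pi * real l / real (m n)))) / real (m n)) sequentially"
    using m0
  proof eventually_elim
    case (elim n)
    show ?case unfolding \<Theta>_def
      using integral_step_function[OF elim, of "2 * pi" "\<lambda>l. f (rcis (X n) (2 * pi * real l / real (m n)))"]
      by simp
  qed
  ultimately show ?thesis by (rule Lim_transform_eventually)
qed

section \<open>Elementary limits, and integrals against root measures\<close>

lemma floor_mult_div_tendsto:
  fixes v :: real
  assumes "0 \<le> v"
  shows "(\<lambda>n. real (nat \<lfloor>real n * v\<rfloor>) / real n) \<longlonglongrightarrow> v"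
proof (rule tendsto_sandwich)
  have b: "v - 1 / real n \<le> real (nat \<lfloor>real n * v\<rfloor>) / real n \<and> real (nat \<lfloor>real n * v\<rfloor>) / real n \<le> v" if "n > 0" for n
  proof -
    define u where "u = real (nat \<lfloor>real n * v\<rfloor>)"
    have "0 \<le> real n * v" using assms by simp
    then have "real n * v - 1 \<le> u" "u \<le> real n * v" unfolding u_def by linarith+
    then have "(real n * v - 1) / real n \<le> u / real n" "u / real n \<le> real n * v / real n"
      by (intro divide_right_mono; simp)+
    then show ?thesis using that unfolding u_def[symmetric] by (simp add: diff_divide_distrib)
  qed
  show "eventually (\<lambda>n. v - 1 / real n \<le> real (nat \<lfloor>real n * v\<rfloor>) / real n) sequentially"
    using eventually_gt_at_top[of 0] by eventually_elim (use b in auto)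
  show "eventually (\<lambda>n. real (nat \<lfloor>real n * v\<rfloor>) / real n \<le> v) sequentially"
    using eventually_gt_at_top[of 0] by eventually_elim (use b in auto)
  have "(\<lambda>n. v - 1 / real n) \<longlonglongrightarrow> v - 0"
    by (intro tendsto_diff tendsto_const lim_1_over_n)
  then show "(\<lambda>n. v - 1 / real n) \<longlonglongrightarrow> v" by simp
qed auto

lemma growth_imp_at_top:
  assumes "filterlim (\<lambda>n. real (m n) / (real n * ln (real n))) at_top sequentially"
  shows "filterlim m at_top sequentially"
proof -
  have "eventually (\<lambda>n. real (m n) / (real n * ln (real n)) \<le> real (m n)) sequentially"
    \<comment> \<open>From \<open>n = 3\<close> on, \<open>ln (real n) \<ge> 1\<close>, because e is
      at most 3.\<close>
    using eventually_ge_at_top[of 3]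
  proof eventually_elim
    case (elim n)
    have "1 \<le> ln (real n)" using elim exp_le by (subst ln_ge_iff) auto
    then have "1 \<le> real n * ln (real n)" using elim mult_mono[of 1 "real n" 1 "ln (real n)"] by simp
    then show ?case using divide_left_mono[of 1 "real n * ln (real n)" "real (m n)"] by simp
  qed
  then have "filterlim (\<lambda>n. real (m n)) at_top sequentially"
    by (rule filterlim_at_top_mono[OF assms])
  then show ?thesis unfolding filterlim_sequentially_iff_filterlim_real .
qed

text \<open>The logarithm of the root is \<open>2 * ln (real n) / real (m n)\<close>, which the
  growth assumption sends to 0. This removes the loss of \<open>n^2\<close> in the bounds on the
  radii.\<close>

lemma growth_imp_root_tendsto:
  assumes m: "\<And>n. n \<ge> 1 \<Longrightarrow> m n > 0"
    and gr: "filterlim (\<lambda>n. real (m n) / (real n * ln (real n))) at_top sequentially"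
  shows "(\<lambda>n. root (m n) (real n ^ 2)) \<longlonglongrightarrow> 1"
proof -
  have lim: "(\<lambda>n. inverse (real (m n) / (real n * ln (real n)))) \<longlonglongrightarrow> 0"
    by (rule tendsto_inverse_0_at_top[OF gr])
  have "(\<lambda>n. ln (real n) / real (m n)) \<longlonglongrightarrow> 0"
  proof (rule tendsto_sandwich[OF _ _ tendsto_const lim])
    show "eventually (\<lambda>n. 0 \<le> ln (real n) / real (m n)) sequentially"
      using eventually_ge_at_top[of 1] by eventually_elim auto
    show "eventually (\<lambda>n. ln (real n) / real (m n) \<le> inverse (real (m n) / (real n * ln (real n)))) sequentially"
      using eventually_ge_at_top[of 1]
    proof eventually_elim
      case (elim n)
      have "ln (real n) \<le> real n * ln (real n)" using elim by (intro mult_le_cancel_right1[THEN iffD2]) auto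
      then show ?case by (simp add: divide_right_mono)
    qed
  qed
  then have "(\<lambda>n. exp (2 * (ln (real n) / real (m n)))) \<longlonglongrightarrow> exp (2 * 0)"
    by (intro tendsto_intros)
  moreover have "eventually (\<lambda>n. exp (2 * (ln (real n) / real (m n))) = root (m n) (real n ^ 2)) sequentially"
    using eventually_ge_at_top[of 1]
  proof eventually_elim
    case (elim n)
    then show ?case using m[OF elim] by (simp add: root_powr_inverse powr_def ln_realpow)
  qed
  ultimately show ?thesis by (auto intro: Lim_transform_eventually)
qed

text \<open>Renumbers the given radii in decreasing order, as \<open>proots_higher_pderiv\<close>
  expects them.\<close>

lemma P_poly_eq: "P_poly r n m = (\<Prod>i<n. monom 1 m - [:complex_of_real (r n (n - i)) ^ m:])"
  unfolding P_poly_def by (rule prod.reindex_bij_witness[of _ "\<lambda>i. n - i" "\<lambda>j. n - j"]) auto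

text \<open>The circles are numbered from the largest radius, \<open>h\<close> from the smallest:
  \<open>k = nat \<lfloor>real n * v\<rfloor>\<close> belongs to the circle \<open>n - Suc k\<close>
  and to the given radius with index \<open>Suc k\<close>. Indices without a circle contribute 0.
  Numerator and denominator are divided by \<open>m * n\<close> so that each part has a
  limit.\<close>

lemma integral_root_measure:
  fixes f :: "complex \<Rightarrow> real"
  assumes p: "proots p = replicate_mset s 0 +
      (\<Sum>i<d. image_mset (\<lambda>l. rcis (\<rho> i) (2 * pi * real l / real m)) (mset_set {..<m}))"
    and f: "f \<in> borel_measurable borel" and dn: "d \<le> n" and N: "N + m * d + s = m * n" "N < m * n"
  defines "h \<equiv> \<lambda>k. if n - Suc k < d
    then (\<Sum>l<m. f (rcis (\<rho> (n - Suc k)) (2 * pi * real l / real m))) / real m else 0"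
  shows "(\<integral>z. f z \<partial>root_measure p) =
    (real s / real (m * n) * f 0 + (\<integral>v. h (nat \<lfloor>real n * v\<rfloor>) \<partial>uniform_measure lborel {0..<1})) /
    (1 - real N / real (m * n))"
proof -
  have pos: "0 < n" "0 < m" using N by (auto intro: Nat.gr0I)
  define a where "a i = (\<Sum>l<m. f (rcis (\<rho> i) (2 * pi * real l / real m)))" for i
  have size: "size (proots p) = s + d * m"
  proof -
    have "size (\<Sum>i<k. image_mset (\<lambda>l. rcis (\<rho> i) (2 * pi * real l / real m)) (mset_set {..<m})) = k * m" for k
      by (induction k) auto
    then show ?thesis unfolding p by simp
  qed
  have D: "real (s + d * m) = real (m * n) - real N"
    using arg_cong[OF N(1), of real] by (simp add: algebra_simps)
  have "s + m * d > 0" using N by linarith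
  then have "s + d * m > 0" by (simp only: mult.commute)
  then have ne: "proots p \<noteq> {#}" using size by auto
  have fsum: "(\<Sum>x\<in>#proots p. f x) = real s * f 0 + (\<Sum>i<d. a i)"
  proof -
    have "(\<Sum>x\<in>#(\<Sum>i<k. image_mset (\<lambda>l. rcis (\<rho> i) (2 * pi * real l / real m)) (mset_set {..<m})). f x) = (\<Sum>i<k. a i)" for k
    proof (induction k)
      case (Suc k)
      have "(\<Sum>x\<in>#image_mset (\<lambda>l. rcis (\<rho> k) (2 * pi * real l / real m)) (mset_set {..<m}). f x) = a k"
        by (simp add: a_def sum_unfold_sum_mset image_mset.compositionality o_def)
      with Suc.IH show ?case by simp
    qed simp
    then show ?thesis unfolding p by simp
  qed
  have "(\<Sum>k<n. h k) = (\<Sum>k<n. (\<lambda>i. if i < d then a i / real m else 0) (n - Suc k))"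
    unfolding h_def a_def ..
  also have "\<dots> = (\<Sum>i<n. if i < d then a i / real m else 0)"
    by (rule sum.nat_diff_reindex)
  also have "\<dots> = (\<Sum>i<d. a i / real m)"
    using dn by (intro sum.mono_neutral_cong_right) auto
  finally have hs: "(\<Sum>k<n. h k) = (\<Sum>i<d. a i) / real m" by (simp add: sum_divide_distrib)
  have step: "(\<integral>v. h (nat \<lfloor>real n * v\<rfloor>) \<partial>uniform_measure lborel {0..<1}) = (\<Sum>k<n. h k) / real n"
    using integral_step_function[OF pos(1), of 1 h] by simp
  have "(\<integral>z. f z \<partial>root_measure p) = (real s * f 0 + (\<Sum>i<d. a i)) / (real (m * n) - real N)"
    using integral_empirical_measure[OF ne f] unfolding root_measure_def fsum size D .
  also have "\<dots> = ((real s * f 0 + (\<Sum>i<d. a i)) / real (m * n)) / ((real (m * n) - real N) / real (m * n))"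
    using pos by simp
  also have "(real s * f 0 + (\<Sum>i<d. a i)) / real (m * n) = real s / real (m * n) * f 0 + (\<Sum>k<n. h k) / real n"
    unfolding hs by (simp add: add_divide_distrib)
  also have "(real (m * n) - real N) / real (m * n) = 1 - real N / real (m * n)"
    using pos by (simp add: diff_divide_distrib)
  finally show ?thesis unfolding step .
qed

section \<open>The weak limit of the root measures\<close>

context compact_distribution
begin

lemma derivative_roots_convergence:
  assumes mono: "\<And>n. n \<ge> 1 \<Longrightarrow> mono_on {1..n} (r n)"
    and nn: "\<And>n j. 1 \<le> j \<Longrightarrow> j \<le> n \<Longrightarrow> 0 \<le> r n j"
    and conv: "weak_conv_m (\<lambda>n. empirical_measure (image_mset (r n) (mset_set {1..n}))) \<nu>"
    and m: "\<And>n. n \<ge> 1 \<Longrightarrow> m n > 0"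
    and gr: "filterlim (\<lambda>n. real (m n) / (real n * ln (real n))) at_top sequentially"
    and t: "t \<in> {0<..<1}"
  shows "weakly_converges (\<lambda>n. root_measure ((pderiv ^^ nat \<lfloor>real n * real (m n) * t\<rfloor>) (P_poly r n (m n))))
    (times_unif (nu \<nu> t))"
  unfolding weakly_converges_def
proof (intro allI impI)
  fix f :: "complex \<Rightarrow> real"
  assume "continuous_on UNIV f \<and> bounded (range f)"
  then obtain B where f: "continuous_on UNIV f" "\<And>z. \<bar>f z\<bar> \<le> B" by (auto simp: bounded_iff)
  have fm [measurable]: "f \<in> borel_measurable borel" using f(1) by (rule borel_measurable_continuous_onI)
  have B0: "0 \<le> B" using f(2)[of 0] by linarith
  have mtop: "filterlim m at_top sequentially" using gr by (rule growth_imp_at_top)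
  let ?U1 = "uniform_measure lborel {0..<1::real}" and ?U = "uniform_measure lborel {0..<2 * pi}"
  interpret U1: prob_space ?U1 by (rule prob_space_uniform_measure) auto
  interpret U: prob_space ?U by (rule prob_space_uniform_measure) auto
  define N where "N n = nat \<lfloor>real n * real (m n) * t\<rfloor>" for n
  define p where "p n = (pderiv ^^ N n) (P_poly r n (m n))" for n
  have N: "real (N n) \<le> real n * real (m n) * t" "real n * real (m n) * t - 1 \<le> real (N n)" for n
  proof -
    have "0 \<le> real n * real (m n) * t" using t by simp
    then show "real (N n) \<le> real n * real (m n) * t" "real n * real (m n) * t - 1 \<le> real (N n)"
      unfolding N_def by linarith+
  qed
  have Nlt: "N n < m n * n" if "n \<ge> 1" for n
  proof -
    have "real n * real (m n) * t < real n * real (m n) * 1"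
      using that m[OF that] t by (intro mult_strict_left_mono) auto
    then have "real (N n) < real (m n * n)" using N(1)[of n] by (simp add: mult.commute)
    then show ?thesis by (simp only: of_nat_less_iff)
  qed
  \<comment> \<open>One predicate for all properties, so that \<open>s\<close>, \<open>d\<close> and
    \<open>\<rho>\<close> can be chosen as functions of \<open>n\<close>.\<close>
  define Q where "Q n s d \<rho> \<longleftrightarrow> s < m n \<and> N n + m n * d + s = m n * n \<and>
    (\<forall>i<d. 0 \<le> \<rho> i \<and>
      \<rho> i \<le> root (m n) (real n ^ 2) * r n (n - i) * (1 - real (N n) / (real (m n) * real (n - i))) \<and>
      r n (n - i) * (1 - real (N n) / (real (m n) * real (n - Suc i) + 1)) \<le> root (m n) (real n ^ 2) * \<rho> i) \<and>
    proots (p n) = replicate_mset s 0 +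
      (\<Sum>i<d. image_mset (\<lambda>l. rcis (\<rho> i) (2 * pi * real l / real (m n))) (mset_set {..<m n}))"
    for n s d and \<rho> :: "nat \<Rightarrow> real"
  have "\<exists>s d \<rho>. Q n s d \<rho>" if n: "n \<ge> 1" for n
  proof -
    have "r n (n - j) \<le> r n (n - i)" if "i \<le> j" "j < n" for i j
      using that n by (intro mono_onD[OF mono[OF n]]) auto
    moreover have "0 \<le> r n (n - i)" if "i < n" for i using that by (intro nn) auto
    ultimately show ?thesis
      unfolding Q_def p_def P_poly_eq
      by (intro proots_higher_pderiv[OF m[OF n] less_imp_le[OF Nlt[OF n]]])
  qed
  then obtain s d \<rho> where Q: "\<And>n. n \<ge> 1 \<Longrightarrow> Q n (s n) (d n) (\<rho> n)"
    by metis
  have qs: "s n < m n" "N n + m n * d n + s n = m n * n"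
    "proots (p n) = replicate_mset (s n) 0 +
      (\<Sum>i<d n. image_mset (\<lambda>l. rcis (\<rho> n i) (2 * pi * real l / real (m n))) (mset_set {..<m n}))"
    and q\<rho>: "\<And>i. i < d n \<Longrightarrow> \<rho> n i \<le> root (m n) (real n ^ 2) * r n (n - i) * (1 - real (N n) / (real (m n) * real (n - i)))"
      "\<And>i. i < d n \<Longrightarrow> r n (n - i) * (1 - real (N n) / (real (m n) * real (n - Suc i) + 1)) \<le> root (m n) (real n ^ 2) * \<rho> n i"
    if "n \<ge> 1" for n
    using Q[OF that] unfolding Q_def by auto
  have dn: "d n \<le> n" if "n \<ge> 1" for n
  proof -
    have "m n * d n \<le> m n * n" using qs(2)[OF that] by linarith
    then show ?thesis using m[OF that] by simp
  qed
  define h where "h n k = (if n - Suc k < d n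
    then (\<Sum>l<m n. f (rcis (\<rho> n (n - Suc k)) (2 * pi * real l / real (m n)))) / real (m n) else 0)" for n k
  define H where "H n v = h n (nat \<lfloor>real n * v\<rfloor>)" for n v
  define I where "I x = (\<integral>\<theta>. f (rcis x \<theta>) \<partial>?U)" for x
  \<comment> \<open>The limit of \<open>H n v\<close>. About \<open>n (1 - t)\<close> circles exist,
    so for \<open>v < t\<close> there is eventually none; for \<open>v > t\<close> the average over
    the circle of radius \<open>level t v\<close> appears.\<close>
  define G where "G v = (if t < v then I (level t v) else 0)" for v
  have I_meas [measurable]: "I \<in> borel_measurable borel"
    unfolding I_def by measurable
  have G_meas [measurable]: "G \<in> borel_measurable borel"
    unfolding G_def by measurable
  have root_int: "(\<integral>z. f z \<partial>root_measure (p n)) =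
      (real (s n) / real (m n * n) * f 0 + (\<integral>v. H n v \<partial>?U1)) / (1 - real (N n) / real (m n * n))"
    if "n \<ge> 1" for n
    unfolding H_def h_def
    by (rule integral_root_measure[OF qs(3)[OF that] fm dn[OF that] qs(2)[OF that] Nlt[OF that]])
  have Nlim: "(\<lambda>n. real (N n) / real (m n * n)) \<longlonglongrightarrow> t"
  proof (rule tendsto_sandwich)
    have b: "t - 1 / real n \<le> real (N n) / real (m n * n) \<and> real (N n) / real (m n * n) \<le> t" if n: "n \<ge> 1" for n
    proof -
      have mn: "0 < real (m n * n)" using n m[OF n] by simp
      have "real (N n) \<le> t * real (m n * n)" "t * real (m n * n) - 1 \<le> real (N n)"
        using N[of n] by (simp_all add: mult_ac)
      moreover have "1 / real n * real (m n * n) \<ge> 1" using n m[OF n] by simp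
      ultimately show ?thesis unfolding pos_le_divide_eq[OF mn] pos_divide_le_eq[OF mn] left_diff_distrib by linarith
    qed
    show "eventually (\<lambda>n. t - 1 / real n \<le> real (N n) / real (m n * n)) sequentially"
      using eventually_ge_at_top[of 1] by eventually_elim (use b in blast)
    show "eventually (\<lambda>n. real (N n) / real (m n * n) \<le> t) sequentially"
      using eventually_ge_at_top[of 1] by eventually_elim (use b in blast)
    have "(\<lambda>n. t - 1 / real n) \<longlonglongrightarrow> t - 0" by (intro tendsto_diff tendsto_const lim_1_over_n)
    then show "(\<lambda>n. t - 1 / real n) \<longlonglongrightarrow> t" by simp
  qed auto
  have slim: "(\<lambda>n. real (s n) / real (m n * n)) \<longlonglongrightarrow> 0"
  proof (rule tendsto_sandwich[OF _ _ tendsto_const lim_1_over_n])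
    show "eventually (\<lambda>n. real (s n) / real (m n * n) \<le> 1 / real n) sequentially"
      using eventually_ge_at_top[of 1]
    proof eventually_elim
      case (elim n)
      then show ?case using qs(1)[OF elim] m[OF elim] by (simp add: divide_simps)
    qed
  qed simp
  have rootlim: "(\<lambda>n. root (m n) (real n ^ 2)) \<longlonglongrightarrow> 1"
    using m gr by (rule growth_imp_root_tendsto)
  have Hlim: "(\<lambda>n. H n v) \<longlonglongrightarrow> G v" if v: "0 < v" "v < 1" "v \<noteq> t" "isCont (quantile \<nu>) v" for v
  proof -
    define u where "u n = nat \<lfloor>real n * v\<rfloor>" for n
    have u: "real n * v - 1 \<le> real (u n)" "real (u n) \<le> real n * v" for n
    proof -
      have "0 \<le> real n * v" using v by simp
      then show "real n * v - 1 \<le> real (u n)" "real (u n) \<le> real n * v" unfolding u_def by linarith+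
    qed
    have ulim: "(\<lambda>n. real (u n) / real n) \<longlonglongrightarrow> v" unfolding u_def using v by (intro floor_mult_div_tendsto) auto
    have un: "u n < n" if "n \<ge> 1" for n
    proof -
      have "real n * v < real n * 1" using that v by (intro mult_strict_left_mono) auto
      with u(2)[of n] show ?thesis by simp
    qed
    consider "v < t" | "t < v" using v by linarith
    then show ?thesis
    proof cases
      case 1
      \<comment> \<open>The two units in \<open>2 \<le> n (t - v)\<close> pay for the
        \<open>+ 1\<close> in \<open>Suc (u n)\<close> and for the rounding of
        \<open>N n\<close>.\<close>
      have "eventually (\<lambda>n. 2 / (t - v) \<le> real n) sequentially"
        by (rule eventually_ge_at_top[THEN filterlim_real_sequentially[unfolded filterlim_iff, rule_format]])
      then have "eventually (\<lambda>n. H n v = 0) sequentially"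
        using eventually_ge_at_top[of 1]
      proof eventually_elim
        case (elim n)
        have "2 \<le> real n * (t - v)" using elim(1) 1 by (simp add: pos_divide_le_eq)
        then have "real (m n) * (real (u n) + 1) \<le> real (m n) * (real n * t - 1)"
          using u(2)[of n] by (intro mult_left_mono) (auto simp: algebra_simps)
        also have "\<dots> \<le> real (N n) + real (s n)"
          using N(2)[of n] m[OF elim(2)] by (simp add: algebra_simps)
        finally have "real (m n * (u n + 1)) \<le> real (N n + s n)" by (simp add: algebra_simps)
        then have "m n * (u n + 1) \<le> N n + s n" by (simp only: of_nat_le_iff)
        then have "m n * (u n + 1 + d n) \<le> m n * n" using qs(2)[OF elim(2)] by (simp add: algebra_simps)
        then have "u n + 1 + d n \<le> n" using m[OF elim(2)] mult_le_cancel1[of "m n" "u n + 1 + d n" n] by blast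
        then have "\<not> n - Suc (u n) < d n" by linarith
        then show ?case by (simp add: H_def h_def u_def)
      qed
      then show ?thesis using 1 by (simp add: G_def tendsto_eventually)
    next
      case 2
      define x where "x n = \<rho> n (n - Suc (u n))" for n
      define R where "R n = root (m n) (real n ^ 2)" for n
      have Rlim: "R \<longlonglongrightarrow> 1" unfolding R_def[abs_def] by (rule rootlim)
      \<comment> \<open>Of the three units, one pays for the rounding in \<open>u n\<close>, one for
        the fewer than \<open>m n\<close> roots at the origin, and one gives strictness.\<close>
      have "eventually (\<lambda>n. 3 / (v - t) \<le> real n) sequentially"
        by (rule eventually_ge_at_top[THEN filterlim_real_sequentially[unfolded filterlim_iff, rule_format]])
      then have ev: "eventually (\<lambda>n. n \<ge> 1 \<and> n - Suc (u n) < d n) sequentially"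
        using eventually_ge_at_top[of 1]
      proof eventually_elim
        case (elim n)
        have "3 \<le> real n * (v - t)" using elim(1) 2 by (simp add: pos_divide_le_eq)
        then have "real n * t + 1 < real (u n)"
          using u(1)[of n] by (simp add: algebra_simps)
        then have "real (m n) * (real n * t + 1) < real (m n) * real (u n)"
          using m[OF elim(2)] by (intro mult_strict_left_mono) auto
        moreover have "real (N n) + real (s n) \<le> real (m n) * (real n * t + 1)"
          using N(1)[of n] qs(1)[OF elim(2)] by (simp add: algebra_simps)
        ultimately have "real (N n + s n) < real (m n * u n)" by simp
        then have "N n + s n < m n * u n" by (simp only: of_nat_less_iff)
        then have "m n * n < m n * (u n + d n)" using qs(2)[OF elim(2)] by (simp add: algebra_simps)
        then have "n < u n + d n" by simp
        then show ?case using elim(2) un[OF elim(2)] by linarith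
      qed
      have rlim: "(\<lambda>n. r n (Suc (u n))) \<longlonglongrightarrow> quantile \<nu> v"
        unfolding u_def using mono nn conv v(1,2,4) by (rule quantile_convergence)
      have l1: "(\<lambda>n. real (N n) / (real (m n) * real (Suc (u n)))) \<longlonglongrightarrow> t / v"
      proof -
        have "(\<lambda>n. (real (N n) / real (m n * n)) / (real (u n) / real n + 1 / real n)) \<longlonglongrightarrow> t / (v + 0)"
          using v by (intro tendsto_divide Nlim tendsto_add ulim lim_1_over_n) auto
        moreover have "eventually (\<lambda>n. (real (N n) / real (m n * n)) / (real (u n) / real n + 1 / real n) =
            real (N n) / (real (m n) * real (Suc (u n)))) sequentially"
          using eventually_ge_at_top[of 1]
        proof eventually_elim
          case (elim n)
          have "real (u n) / real n + 1 / real n = real (Suc (u n)) / real n" by (simp add: add_divide_distrib)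
          then show ?case using elim by (simp only:) (simp add: mult_ac)
        qed
        ultimately show ?thesis by (auto intro: Lim_transform_eventually)
      qed
      have l2: "(\<lambda>n. real (N n) / (real (m n) * real (u n) + 1)) \<longlonglongrightarrow> t / v"
      proof -
        have "(\<lambda>n. inverse (real (m n))) \<longlonglongrightarrow> 0"
          using mtop by (intro tendsto_inverse_0_at_top filterlim_compose[OF filterlim_real_sequentially])
        then have "(\<lambda>n. (real (N n) / real (m n * n)) / (real (u n) / real n + inverse (real (m n)) * (1 / real n))) \<longlonglongrightarrow> t / (v + 0 * 0)"
          using v by (intro tendsto_divide Nlim tendsto_add ulim tendsto_mult lim_1_over_n) auto
        moreover have "eventually (\<lambda>n. (real (N n) / real (m n * n)) / (real (u n) / real n + inverse (real (m n)) * (1 / real n)) =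
            real (N n) / (real (m n) * real (u n) + 1)) sequentially"
          using eventually_ge_at_top[of 1]
        proof eventually_elim
          case (elim n)
          have "real (u n) / real n + inverse (real (m n)) * (1 / real n) = (real (m n) * real (u n) + 1) / real (m n * n)"
            using elim m[OF elim] by (simp add: field_simps)
          then show ?case using elim m[OF elim] by (simp only:) simp
        qed
        ultimately show ?thesis by (auto intro: Lim_transform_eventually)
      qed
      have "x \<longlonglongrightarrow> level t v"
      proof (rule tendsto_sandwich)
        have idx: "n - (n - Suc (u n)) = Suc (u n)" "n - Suc (n - Suc (u n)) = u n" if "n \<ge> 1" for n
          using un[OF that] by auto
        show "eventually (\<lambda>n. x n \<le> R n * r n (Suc (u n)) * (1 - real (N n) / (real (m n) * real (Suc (u n))))) sequentially"
          using ev
        proof eventually_elim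
          case (elim n)
          then show ?case using q\<rho>(1)[of n "n - Suc (u n)"] unfolding x_def R_def by (simp only: idx)
        qed
        show "eventually (\<lambda>n. r n (Suc (u n)) * (1 - real (N n) / (real (m n) * real (u n) + 1)) / R n \<le> x n) sequentially"
          using ev
        proof eventually_elim
          case (elim n)
          then have "0 < R n" using m unfolding R_def by (intro real_root_gt_zero) auto
          then show ?case using q\<rho>(2)[of n "n - Suc (u n)"] elim unfolding x_def R_def
            by (simp only: idx pos_divide_le_eq mult.commute[of "\<rho> n _"])
        qed
        have "(\<lambda>n. R n * r n (Suc (u n)) * (1 - real (N n) / (real (m n) * real (Suc (u n))))) \<longlonglongrightarrow> 1 * quantile \<nu> v * (1 - t / v)"
          by (intro tendsto_mult tendsto_diff tendsto_const Rlim rlim l1)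
        then show "(\<lambda>n. R n * r n (Suc (u n)) * (1 - real (N n) / (real (m n) * real (Suc (u n))))) \<longlonglongrightarrow> level t v"
          by (simp add: level_def mult.commute)
        have "(\<lambda>n. r n (Suc (u n)) * (1 - real (N n) / (real (m n) * real (u n) + 1)) / R n) \<longlonglongrightarrow> quantile \<nu> v * (1 - t / v) / 1"
          by (intro tendsto_mult tendsto_divide tendsto_diff tendsto_const Rlim rlim l2) simp
        then show "(\<lambda>n. r n (Suc (u n)) * (1 - real (N n) / (real (m n) * real (u n) + 1)) / R n) \<longlonglongrightarrow> level t v"
          by (simp add: level_def mult.commute)
      qed
      then have "(\<lambda>n. (\<Sum>l<m n. f (rcis (x n) (2 * pi * real l / real (m n)))) / real (m n)) \<longlonglongrightarrow> I (level t v)"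
        unfolding I_def by (intro circle_average_convergence[OF f mtop])
      moreover have "eventually (\<lambda>n. (\<Sum>l<m n. f (rcis (x n) (2 * pi * real l / real (m n)))) / real (m n) = H n v) sequentially"
        using ev by eventually_elim (simp add: H_def h_def x_def u_def)
      ultimately show ?thesis using 2 by (auto simp: G_def intro: Lim_transform_eventually)
    qed
  qed
  have "(\<lambda>n. \<integral>v. H n v \<partial>?U1) \<longlonglongrightarrow> (\<integral>v. G v \<partial>?U1)"
  proof (rule integral_dominated_convergence[where w = "\<lambda>_. B"])
    show "AE v in ?U1. (\<lambda>n. H n v) \<longlonglongrightarrow> G v"
    proof (rule AE_uniform_measureI)
      have "AE v in lborel. v \<noteq> 0 \<and> v \<noteq> t" using AE_lborel_singleton[of 0] AE_lborel_singleton[of t] by auto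
      then show "AE v in lborel. v \<in> {0..<1} \<longrightarrow> (\<lambda>n. H n v) \<longlonglongrightarrow> G v"
        using AE_isCont_quantile by eventually_elim (auto intro!: Hlim)
    qed simp
    show "H n \<in> borel_measurable ?U1" for n unfolding H_def by measurable
    show "AE v in ?U1. norm (H n v) \<le> B" for n
    proof (intro AE_I2)
      fix v
      have "\<bar>\<Sum>l<m n. f (rcis x (2 * pi * real l / real (m n)))\<bar> / real (m n) \<le> B" for x
      proof (cases "m n = 0")
        case False
        have "\<bar>\<Sum>l<m n. f (rcis x (2 * pi * real l / real (m n)))\<bar> \<le> (\<Sum>l<m n. B)"
          by (rule order_trans[OF sum_abs sum_mono]) (rule f(2))
        with False show ?thesis by (simp add: pos_divide_le_eq mult.commute)
      qed (use B0 in simp)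
      then show "norm (H n v) \<le> B" using B0 by (simp add: H_def h_def)
    qed
  qed simp_all
  then have "(\<lambda>n. (real (s n) / real (m n * n) * f 0 + (\<integral>v. H n v \<partial>?U1)) / (1 - real (N n) / real (m n * n)))
      \<longlonglongrightarrow> (0 * f 0 + (\<integral>v. G v \<partial>?U1)) / (1 - t)"
    using t by (intro tendsto_divide tendsto_add tendsto_mult slim tendsto_const tendsto_diff Nlim) auto
  moreover have "eventually (\<lambda>n. (real (s n) / real (m n * n) * f 0 + (\<integral>v. H n v \<partial>?U1)) / (1 - real (N n) / real (m n * n)) =
      (\<integral>z. f z \<partial>root_measure (p n))) sequentially"
    using eventually_ge_at_top[of 1] by eventually_elim (simp only: root_int)
  \<comment> \<open>The normalisation \<open>1 - t\<close> of the uniform law on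
    \<open>{t..1}\<close> is the limit of the proportion \<open>1 - N / (m n)\<close> of roots that
    are left after differentiating.\<close>
  moreover have "(\<integral>z. f z \<partial>times_unif (nu \<nu> t)) = (\<integral>v. G v \<partial>?U1) / (1 - t)"
  proof -
    let ?V = "uniform_measure lborel {t..1}"
    have Vp: "prob_space ?V" using t by (intro prob_space_uniform_measure) auto
    have lev: "(\<lambda>v. (1 - t / v) * quantile \<nu> v) = level t" by (simp add: level_def[abs_def])
    have lm: "level t \<in> measurable ?V borel" by measurable
    have "prob_space (nu \<nu> t)" unfolding nu_def lev by (rule prob_space.prob_space_distr[OF Vp lm])
    then have "(\<integral>z. f z \<partial>times_unif (nu \<nu> t)) = (\<integral>x. I x \<partial>nu \<nu> t)"
      unfolding I_def by (intro integral_times_unif[OF _ _ fm f(2)]) (auto simp: nu_def)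
    also have "\<dots> = (\<integral>v. I (level t v) \<partial>?V)"
      unfolding nu_def lev by (rule integral_distr[OF lm I_meas])
    also have "\<dots> = (\<integral>v. indicator {t..1} v * I (level t v) \<partial>lborel) / (1 - t)"
      using t by (intro integral_uniform_lborel) auto
    also have "(\<integral>v. indicator {t..1} v * I (level t v) \<partial>lborel) = (\<integral>v. indicator {0..<1} v * G v \<partial>lborel)"
    proof (rule integral_cong_AE)
      have "AE v in lborel. v \<noteq> t \<and> v \<noteq> 1" using AE_lborel_singleton[of 1] AE_lborel_singleton[of t] by auto
      then show "AE v in lborel. indicator {t..1} v * I (level t v) = indicator {0..<1} v * G v"
        by eventually_elim (use t in \<open>auto simp: G_def indicator_def\<close>)
    qed measurable
    also have "\<dots> = (\<integral>v. G v \<partial>?U1)"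
      by (subst integral_uniform_lborel[of _ 1]) auto
    finally show ?thesis .
  qed
  ultimately have "(\<lambda>n. \<integral>z. f z \<partial>root_measure (p n)) \<longlonglongrightarrow> (\<integral>z. f z \<partial>times_unif (nu \<nu> t))"
    by (auto intro: Lim_transform_eventually)
  then show "(\<lambda>n. \<integral>z. f z \<partial>root_measure ((pderiv ^^ nat \<lfloor>real n * real (m n) * t\<rfloor>) (P_poly r n (m n))))
      \<longlonglongrightarrow> (\<integral>z. f z \<partial>times_unif (nu \<nu> t))"
    unfolding p_def N_def .
qed

end

subsection \<open>Continuous, strictly increasing distribution functions\<close>

lemma strict_mono_image_Icc:
  fixes Q :: "real \<Rightarrow> real"
  assumes "a \<le> b" "continuous_on {a..b} Q" "strict_mono_on {a..b} Q"
  shows "Q ` {a..b} = {Q a..Q b}"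
proof
  show "Q ` {a..b} \<subseteq> {Q a..Q b}"
    using assms(1) strict_mono_on_leD[OF assms(3)] by auto
  show "{Q a..Q b} \<subseteq> Q ` {a..b}"
  proof
    fix y assume "y \<in> {Q a..Q b}"
    then obtain x where "a \<le> x" "x \<le> b" "Q x = y"
      using IVT'[of Q a y b] assms(1,2) by auto
    then show "y \<in> Q ` {a..b}" by auto
  qed
qed

text \<open>\<open>P\<close> need only undo \<open>Q\<close> on the interval; compactness then gives
  its continuity. Used for the quantile as inverse of the distribution function of
  \<open>\<nu>\<^sub>0\<close>, and with the roles exchanged for the scaled measures.\<close>

lemma inverse_of_strict_mono:
  fixes Q P :: "real \<Rightarrow> real"
  assumes "a \<le> b" and Q: "continuous_on {a..b} Q" "strict_mono_on {a..b} Q"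
    and P: "\<And>x. x \<in> {a..b} \<Longrightarrow> P (Q x) = x"
  shows "cont_incr_bij P {Q a..Q b} {a..b}" "inverse_bijections P Q {Q a..Q b} {a..b}"
proof -
  have im: "Q ` {a..b} = {Q a..Q b}" by (rule strict_mono_image_Icc[OF assms(1) Q])
  have bijQ: "bij_betw Q {a..b} {Q a..Q b}"
    using im strict_mono_on_imp_inj_on[OF Q(2)] by (simp add: bij_betw_def)
  have QP: "P y \<in> {a..b}" "Q (P y) = y" if y: "y \<in> {Q a..Q b}" for y
  proof -
    obtain x where "x \<in> {a..b}" "y = Q x" using y unfolding im[symmetric] by blast
    then show "P y \<in> {a..b}" "Q (P y) = y" using P by auto
  qed
  have bijP: "bij_betw P {Q a..Q b} {a..b}"
  proof (rule bij_betw_byWitness[of _ Q])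
    show "Q ` {a..b} \<subseteq> {Q a..Q b}" using im by simp
  qed (use QP P in blast)+
  have cont: "continuous_on {Q a..Q b} P"
    unfolding im[symmetric] by (rule continuous_on_inv[OF Q(1) compact_Icc]) (use P in blast)
  have "strict_mono_on {Q a..Q b} P"
  proof (rule strict_mono_onI)
    fix y z assume yz: "y \<in> {Q a..Q b}" "z \<in> {Q a..Q b}" "y < z"
    show "P y < P z"
    proof (rule ccontr)
      assume "\<not> P y < P z"
      then have "Q (P z) \<le> Q (P y)" using QP yz by (intro strict_mono_on_leD[OF Q(2)]) auto
      with QP yz show False by auto
    qed
  qed
  with cont bijP show "cont_incr_bij P {Q a..Q b} {a..b}" by (simp add: cont_incr_bij_def)
  show "inverse_bijections P Q {Q a..Q b} {a..b}"
    using bijP bijQ QP P unfolding inverse_bijections_def by blast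
qed

lemma cont_incr_bij_endpoints:
  assumes "cont_incr_bij P {0..b} {0..c}" "0 \<le> b" "0 \<le> c"
  shows "P 0 = 0" "P b = c"
proof -
  have im: "P ` {0..b} = {0..c}" and sm: "strict_mono_on {0..b} P"
    using assms(1) by (auto simp: cont_incr_bij_def bij_betw_def)
  have "0 \<in> P ` {0..b}" "c \<in> P ` {0..b}" unfolding im using assms by auto
  then obtain x y where xy: "0 = P x" "x \<in> {0..b}" "c = P y" "y \<in> {0..b}" by auto
  have "P 0 \<in> {0..c}" "P b \<in> {0..c}" using im assms(2) by auto
  then show "P 0 = 0" "P b = c"
    using strict_mono_on_leD[OF sm, of 0 x] strict_mono_on_leD[OF sm, of y b] xy assms(2) by auto
qed

lemma inverse_bijections_sym: "inverse_bijections F G S T \<Longrightarrow> inverse_bijections G F T S"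
  unfolding inverse_bijections_def by blast

lemma comp_inverse_eq: "inverse_bijections F G S T \<Longrightarrow> x \<in> T \<Longrightarrow> comp_inverse S F x = G x"
  unfolding inverse_bijections_def by (intro the_inv_into_f_eq) (auto simp: bij_betw_def)

lemma Psi_0: "Psi \<nu> 0 = distfun \<nu>"
  by (simp add: Psi_def scaled_nu_def fun_eq_iff)

context compact_distribution
begin

lemma Psi_le: "t \<in> {0<..<1} \<Longrightarrow> Psi \<nu> t y \<le> 1 - t"
proof -
  assume t: "t \<in> {0<..<1}"
  have "Psi \<nu> t y \<le> measure lborel {t..1}"
    unfolding Psi_eq[OF t] by (intro measure_mono_fmeasurable) (auto simp: fmeasurable_def emeasure_lborel_Icc_eq)
  then show ?thesis using t by simp
qed

end

locale bijective_distribution = compact_distribution +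
  fixes A :: real
  assumes A_pos: "0 < A" and distfun_bij: "cont_incr_bij (distfun \<nu>) {0..A} {0..1}"
begin

lemma distfun_0: "distfun \<nu> 0 = 0" and distfun_A: "distfun \<nu> A = 1"
  using cont_incr_bij_endpoints[OF distfun_bij] A_pos by auto

lemma distfun_less_iff:
  assumes "x \<in> {0..A}" "y \<in> {0..A}"
  shows "distfun \<nu> x < distfun \<nu> y \<longleftrightarrow> x < y"
  using distfun_bij assms by (auto simp: cont_incr_bij_def strict_mono_on_less)

text \<open>By \<open>quantile_le_iff\<close> both sides have the same upper bounds
  \<open>z\<close>.\<close>

lemma quantile_distfun:
  assumes y: "y \<in> {0..A}"
  shows "quantile \<nu> (distfun \<nu> y) = y"
proof (cases "y = 0")
  case False
  have pos: "0 < distfun \<nu> y" using distfun_less_iff[of 0 y] distfun_0 y False A_pos by auto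
  have "quantile \<nu> (distfun \<nu> y) \<le> z \<longleftrightarrow> y \<le> z" for z
  proof -
    have "distfun \<nu> y \<le> distfun \<nu> z \<longleftrightarrow> y \<le> z"
    proof (cases "z \<in> {0..A}")
      case True
      then show ?thesis using distfun_less_iff[OF True y] by auto
    next
      case False
      then consider "z < 0" | "A < z" by force
      then show ?thesis
      proof cases
        case 1
        then show ?thesis using pos y by (auto simp: distfun_def)
      next
        case 2
        then show ?thesis using mono_distfun[of y z] y by auto
      qed
    qed
    then show ?thesis using quantile_le_iff[OF pos distfun_le_1] by simp
  qed
  then show ?thesis by (meson order_antisym order_refl)
qed (simp add: distfun_0 quantile_0)

lemma quantile_cont_incr: "cont_incr_bij (quantile \<nu>) {0..1} {0..A}"
  and quantile_inverse: "inverse_bijections (distfun \<nu>) (quantile \<nu>) {0..A} {0..1}"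
proof -
  have "continuous_on {0..A} (distfun \<nu>)" "strict_mono_on {0..A} (distfun \<nu>)"
    using distfun_bij by (auto simp: cont_incr_bij_def)
  note inv = inverse_of_strict_mono[OF less_imp_le[OF A_pos] this quantile_distfun]
  from inv(1) inverse_bijections_sym[OF inv(2)]
  show "cont_incr_bij (quantile \<nu>) {0..1} {0..A}"
    "inverse_bijections (distfun \<nu>) (quantile \<nu>) {0..A} {0..1}"
    by (simp_all add: distfun_0 distfun_A)
qed

lemma quantile_1: "quantile \<nu> 1 = A"
  using quantile_distfun[of A] A_pos by (simp add: distfun_A)

text \<open>Strictness comes from the factor \<open>1 - t / v\<close>, as the quantile at
  \<open>v\<close> is positive.\<close>

lemma level_strict_mono:
  assumes "0 < t" "t \<le> u" "u < v" "v \<le> 1"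
  shows "level t u < level t v"
proof -
  have "quantile \<nu> 0 < quantile \<nu> v"
    using quantile_cont_incr assms by (auto simp: cont_incr_bij_def strict_mono_on_def)
  then have qv: "0 < quantile \<nu> v" by (simp add: quantile_0)
  have "level t u \<le> (1 - t / u) * quantile \<nu> v"
    unfolding level_def using assms by (intro mult_left_mono quantile_mono) (auto simp: divide_le_eq_1)
  also have "\<dots> < level t v"
    unfolding level_def using assms qv
    by (intro mult_strict_right_mono) (auto intro!: divide_strict_left_mono)
  finally show ?thesis .
qed

text \<open>One inequality is \<open>le_Psi_iff\<close>. If the value exceeded \<open>v - t\<close>,
  the same equivalence at some \<open>w > v\<close> would give
  \<open>level t w \<le> level t v\<close>, against strict monotonicity.\<close>

lemma Psi_level:
  assumes t: "t \<in> {0<..<1}" and v: "t \<le> v" "v \<le> 1"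
  shows "Psi \<nu> t (level t v) = v - t"
proof (rule antisym)
  show "Psi \<nu> t (level t v) \<le> v - t"
  proof (rule ccontr)
    define w where "w = Psi \<nu> t (level t v) + t"
    assume "\<not> Psi \<nu> t (level t v) \<le> v - t"
    then have "v < w" by (simp add: w_def)
    moreover have "w \<le> 1" using Psi_le[OF t] by (simp add: w_def le_diff_eq)
    moreover have "w - t \<le> Psi \<nu> t (level t v)" by (simp add: w_def)
    ultimately show False
      using le_Psi_iff[OF t, of w "level t v"] level_strict_mono[of t v w] t v by auto
  qed
  show "v - t \<le> Psi \<nu> t (level t v)"
    using le_Psi_iff[OF t, of v "level t v"] v Psi_nonneg by (cases "v = t") auto
qed

lemma quantile_scaled_nu_mono_cont:
  assumes t: "t \<in> {0<..<1}"
  shows "continuous_on {0..1 - t} (quantile (scaled_nu \<nu> t))"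
    "strict_mono_on {0..1 - t} (quantile (scaled_nu \<nu> t))"
proof -
  have q: "quantile (scaled_nu \<nu> t) x = level t (x + t)" if "x \<in> {0..1 - t}" for x
    using quantile_scaled_nu_level[OF t] that by auto
  have "continuous_on {0..1} (quantile \<nu>)" using quantile_cont_incr by (simp add: cont_incr_bij_def)
  then have "continuous_on {0..1 - t} (\<lambda>x. quantile \<nu> (x + t))"
    by (rule continuous_on_compose2) (use t in \<open>auto intro!: continuous_intros\<close>)
  then have "continuous_on {0..1 - t} (\<lambda>x. level t (x + t))"
    unfolding level_def using t by (intro continuous_on_mult) (auto intro!: continuous_intros)
  then show "continuous_on {0..1 - t} (quantile (scaled_nu \<nu> t))"
    by (subst continuous_on_cong[OF refl q])
  show "strict_mono_on {0..1 - t} (quantile (scaled_nu \<nu> t))"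
  proof (rule strict_mono_onI)
    fix x y assume "x \<in> {0..1 - t}" "y \<in> {0..1 - t}" "x < y"
    then show "quantile (scaled_nu \<nu> t) x < quantile (scaled_nu \<nu> t) y"
      using q level_strict_mono[of t "x + t" "y + t"] t by auto
  qed
qed

lemma Psi_cont_incr:
  assumes t: "t \<in> {0<..<1}"
  shows "cont_incr_bij (Psi \<nu> t) {0..A * (1 - t)} {0..1 - t}"
    and "inverse_bijections (Psi \<nu> t) (quantile (scaled_nu \<nu> t)) {0..A * (1 - t)} {0..1 - t}"
proof -
  have "Psi \<nu> t (quantile (scaled_nu \<nu> t) x) = x" if "x \<in> {0..1 - t}" for x
    using quantile_scaled_nu_level[OF t] Psi_level[OF t, of "x + t"] that by auto
  note inv = inverse_of_strict_mono[OF _ quantile_scaled_nu_mono_cont[OF t] this]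
  have "quantile (scaled_nu \<nu> t) 0 = 0" "quantile (scaled_nu \<nu> t) (1 - t) = A * (1 - t)"
    using quantile_scaled_nu[OF t, of 0] quantile_scaled_nu[OF t, of "1 - t"] t by (auto simp: quantile_1)
  then show "cont_incr_bij (Psi \<nu> t) {0..A * (1 - t)} {0..1 - t}"
    "inverse_bijections (Psi \<nu> t) (quantile (scaled_nu \<nu> t)) {0..A * (1 - t)} {0..1 - t}"
    using inv t by simp_all
qed

lemma comp_inverse_Psi:
  assumes t: "t \<in> {0<..<1}" and x: "x \<in> {0<..<1 - t}"
  shows "comp_inverse {0..A * (1 - t)} (Psi \<nu> t) x / x = comp_inverse {0..A} (Psi \<nu> 0) (x + t) / (x + t)"
proof -
  have "comp_inverse {0..A * (1 - t)} (Psi \<nu> t) x = quantile (scaled_nu \<nu> t) x"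
    using x by (intro comp_inverse_eq[OF Psi_cont_incr(2)[OF t]]) auto
  moreover have "comp_inverse {0..A} (Psi \<nu> 0) (x + t) = quantile \<nu> (x + t)"
    unfolding Psi_0 using x t by (intro comp_inverse_eq[OF quantile_inverse]) auto
  ultimately show ?thesis using quantile_scaled_nu[OF t, of x] x by simp
qed

end

subsection \<open>Differential calculus\<close>

text \<open>Made for boundary points: \<open>S\<close> is arbitrary, and only \<open>f\<close> has
  an unrestricted derivative. Let \<open>w = g z - g y\<close>, which is small by continuity.
  Applying \<open>g'\<close> to the linearisation error of \<open>f\<close> bounds the difference of
  \<open>w\<close> and \<open>g' (z - y)\<close> by a small multiple of \<open>norm w\<close>;
  absorbing this bounds \<open>norm w\<close> by a multiple of \<open>norm (z - y)\<close>.\<close>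

lemma has_derivative_inverse_within:
  fixes f :: "'a::real_normed_vector \<Rightarrow> 'b::real_normed_vector"
  assumes derf: "(f has_derivative f') (at (g y))"
    and g': "bounded_linear g'" "\<And>x. g' (f' x) = x"
    and contg: "continuous (at y within S) g" and y: "y \<in> S"
    and fg: "\<And>z. z \<in> S \<Longrightarrow> f (g z) = z"
  shows "(g has_derivative g') (at y within S)"
proof -
  interpret f': bounded_linear f' using derf by (rule has_derivative_bounded_linear)
  interpret g': bounded_linear g' by fact
  obtain C where C: "0 < C" "\<And>x. norm (g' x) \<le> norm x * C" using g'.pos_bounded by blast
  show ?thesis unfolding has_derivative_within_alt
  proof (intro conjI allI impI)
    fix e :: real assume e: "0 < e"
    \<comment> \<open>The first bound makes the error at most half of \<open>norm w\<close>, so that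
      it can be absorbed; the second brings the resulting \<open>k * C * (2 * C)\<close> below
      \<open>e\<close>.\<close>
    define k where "k = min (1 / (2 * C)) (e / (2 * C * C))"
    have k: "0 < k" "k * C \<le> 1 / 2" "k * C * (2 * C) \<le> e"
    proof -
      show "0 < k" using C e by (simp add: k_def)
      have "k \<le> 1 / (2 * C)" "k \<le> e / (2 * C * C)" by (simp_all add: k_def)
      then have "k * (2 * C) \<le> 1" "k * (2 * C * C) \<le> e"
        using C(1) by (simp_all only: pos_le_divide_eq mult_pos_pos zero_less_numeral)
      then show "k * C \<le> 1 / 2" "k * C * (2 * C) \<le> e" by (simp_all add: mult_ac)
    qed
    obtain d0 where d0: "0 < d0"
      "\<And>u. norm (u - g y) < d0 \<Longrightarrow> norm (f u - f (g y) - f' (u - g y)) \<le> k * norm (u - g y)"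
      using derf[unfolded has_derivative_at_alt, THEN conjunct2, rule_format, OF k(1)] by blast
    obtain d where d: "0 < d" "\<And>z. z \<in> S \<Longrightarrow> dist z y < d \<Longrightarrow> dist (g z) (g y) < d0"
      using contg[unfolded continuous_within_eps_delta, rule_format, OF d0(1)] by blast
    show "\<exists>d>0. \<forall>z\<in>S. norm (z - y) < d \<longrightarrow> norm (g z - g y - g' (z - y)) \<le> e * norm (z - y)"
    proof (intro exI[of _ d] conjI ballI impI)
      fix z assume z: "z \<in> S" "norm (z - y) < d"
      define w where "w = g z - g y"
      have "norm (z - y - f' w) \<le> k * norm w"
        using d0(2)[of "g z"] d(2)[of z] z fg[OF z(1)] fg[OF y] by (simp add: dist_norm w_def)
      then have "norm (g' (z - y - f' w)) \<le> k * norm w * C"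
        using C(1) by (intro order_trans[OF C(2) mult_right_mono]) auto
      then have A: "norm (w - g' (z - y)) \<le> k * C * norm w"
        by (simp add: g'.diff g'(2) norm_minus_commute mult_ac)
      also have "\<dots> \<le> 1 / 2 * norm w" using k by (intro mult_right_mono) auto
      finally have "norm w \<le> 2 * norm (g' (z - y))" using norm_triangle_sub[of w "g' (z - y)"] by simp
      also have "\<dots> \<le> 2 * C * norm (z - y)" using C(2)[of "z - y"] by (simp add: mult_ac)
      finally have "k * C * norm w \<le> k * C * (2 * C) * norm (z - y)"
        using mult_left_mono[of "norm w" "2 * C * norm (z - y)" "k * C"] k C by (simp add: mult_ac)
      also have "\<dots> \<le> e * norm (z - y)" using k by (intro mult_right_mono) auto
      finally show "norm (g z - g y - g' (z - y)) \<le> e * norm (z - y)" using A by (simp add: w_def)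
    qed (rule d)
  qed (rule g')
qed

lemma continuously_differentiable_on_partials:
  fixes F :: "real \<times> real \<Rightarrow> real"
  assumes "\<And>p. p \<in> S \<Longrightarrow> (F has_derivative (\<lambda>h. fst h * a p + snd h * b p)) (at p within S)"
    and "continuous_on S a" "continuous_on S b"
  shows "continuously_differentiable_on S F"
  unfolding continuously_differentiable_on_def
proof (intro exI[of _ "\<lambda>p. a p *\<^sub>R fst_blinfun + b p *\<^sub>R snd_blinfun"] conjI ballI)
  fix p assume p: "p \<in> S"
  have eq: "blinfun_apply (a p *\<^sub>R fst_blinfun + b p *\<^sub>R snd_blinfun) = (\<lambda>h. fst h * a p + snd h * b p)"
    by (rule ext) (simp add: blinfun.add_left blinfun.scaleR_left)
  show "(F has_derivative blinfun_apply (a p *\<^sub>R fst_blinfun + b p *\<^sub>R snd_blinfun)) (at p within S)"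
    unfolding eq by (rule assms(1)[OF p])
qed (intro continuous_on_add continuous_on_scaleR continuous_on_const assms(2,3))

lemma continuously_differentiable_on_realD:
  fixes f :: "real \<Rightarrow> real"
  assumes "continuously_differentiable_on S f" "open S"
  obtains f' where "\<And>x. x \<in> S \<Longrightarrow> (f has_real_derivative f' x) (at x)" "continuous_on S f'"
proof -
  obtain F' where F': "\<And>x. x \<in> S \<Longrightarrow> (f has_derivative blinfun_apply (F' x)) (at x within S)" "continuous_on S F'"
    using assms(1) unfolding continuously_differentiable_on_def by blast
  have "(f has_real_derivative blinfun_apply (F' x) 1) (at x)" if "x \<in> S" for x
  proof -
    have "blinfun_apply (F' x) h = blinfun_apply (F' x) 1 * h" for h
      by (metis blinfun.scaleR_right mult.commute mult.right_neutral real_scaleR_def)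
    then have "blinfun_apply (F' x) = (*) (blinfun_apply (F' x) 1)" by (rule ext)
    then show ?thesis
      using F'(1)[OF that] at_within_open[OF that assms(2)] unfolding has_field_derivative_def by argo
  qed
  moreover have "continuous_on S (\<lambda>x. blinfun_apply (F' x) 1)"
    by (rule blinfun.continuous_on[OF F'(2) continuous_on_const])
  ultimately show ?thesis by (rule that)
qed

lemma domain_E_iff: "(t, x) \<in> domain_E A \<longleftrightarrow> 0 \<le> t \<and> t < 1 \<and> 0 < x \<and> x < A * (1 - t)"
  by (simp add: domain_E_def)

text \<open>Near \<open>t\<close> the slice of the domain at fixed \<open>x\<close> coincides with
  \<open>{0..}\<close>: the derivative in \<open>t\<close> is two-sided for \<open>t > 0\<close> and
  a right derivative at \<open>t = 0\<close>. The slice at fixed \<open>t\<close> is open.\<close>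

lemma partial_derivatives_domain_E:
  fixes F :: "real \<times> real \<Rightarrow> real"
  assumes F: "(F has_derivative (\<lambda>h. fst h * a + snd h * b)) (at (t, x) within domain_E A)"
    and p: "(t, x) \<in> domain_E A" and A: "0 < A"
  shows "((\<lambda>s. F (s, x)) has_real_derivative a) (at t within {0..})"
    and "((\<lambda>y. F (t, y)) has_real_derivative b) (at x)"
proof -
  have px: "0 \<le> t" "0 < x" "x < A * (1 - t)" "t < 1" using p by (auto simp: domain_E_iff)
  let ?T = "{s. (s, x) \<in> domain_E A}"
  have f1: "((\<lambda>s. (s, x)) has_derivative (\<lambda>h. (h, 0))) (at t within ?T)"
    by (intro derivative_intros)
  have g1: "(F has_derivative (\<lambda>h. fst h * a + snd h * b)) (at (t, x) within (\<lambda>s. (s, x)) ` ?T)"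
    by (rule has_derivative_subset[OF F]) auto
  have "((\<lambda>s. F (s, x)) has_derivative (\<lambda>h. fst (h, 0::real) * a + snd (h, 0) * b)) (at t within ?T)"
    by (rule has_derivative_in_compose[OF f1 g1])
  then have 1: "((\<lambda>s. F (s, x)) has_real_derivative a) (at t within ?T)"
    by (simp add: has_field_derivative_def mult_commute_abs)
  have "at t within ?T = at t within {0..}"
  proof (rule at_within_nhd)
    have key: "x < A * (1 - s) \<longleftrightarrow> s < 1 - x / A" for s
      using A by (simp add: field_simps)
    have "0 < x / A" using px A by simp
    then have lt: "s < 1" if "s < 1 - x / A" for s using that by linarith
    show "t \<in> {..<1 - x / A}" "open {..<1 - x / A}" using px(3) unfolding key by auto
    show "?T \<inter> {..<1 - x / A} - {t} = {0..} \<inter> {..<1 - x / A} - {t}"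
      using px(2) lt unfolding domain_E_iff key by blast
  qed
  with 1 show "((\<lambda>s. F (s, x)) has_real_derivative a) (at t within {0..})" by simp
  have f2: "((\<lambda>y. (t, y)) has_derivative (\<lambda>h. (0, h))) (at x within {0<..<A * (1 - t)})"
    by (intro derivative_intros)
  have g2: "(F has_derivative (\<lambda>h. fst h * a + snd h * b)) (at (t, x) within (\<lambda>y. (t, y)) ` {0<..<A * (1 - t)})"
    by (rule has_derivative_subset[OF F]) (use px in \<open>auto simp: domain_E_iff\<close>)
  have "((\<lambda>y. F (t, y)) has_derivative (\<lambda>h. fst (0::real, h) * a + snd (0::real, h) * b)) (at x within {0<..<A * (1 - t)})"
    by (rule has_derivative_in_compose[OF f2 g2])
  then show "((\<lambda>y. F (t, y)) has_real_derivative b) (at x)"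
    using px by (simp add: has_field_derivative_def mult_commute_abs at_within_open[of _ "{0<..<A * (1 - t)}"])
qed

text \<open>As \<open>g\<close> may be unbounded near the end points, the fundamental theorem is
  used in its improper form for nonnegative integrands, which asks only for limits of
  \<open>G\<close> there. The two measures then have the same distribution function.\<close>

lemma density_of_cdf_derivative:
  fixes M :: "real measure" and G g :: "real \<Rightarrow> real"
  assumes M: "finite_borel_measure M" and B: "0 < B"
    and G: "\<And>y. cdf M y = G y" "continuous_on UNIV G"
      "\<And>y. y \<le> 0 \<Longrightarrow> G y = 0" "\<And>y. B \<le> y \<Longrightarrow> G y = G B"
    and der: "\<And>x. x \<in> {0<..<B} \<Longrightarrow> (G has_real_derivative g x) (at x)"
    and g: "continuous_on {0<..<B} g" "\<And>x. x \<in> {0<..<B} \<Longrightarrow> 0 \<le> g x"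
  shows "has_density_on M g {0<..<B}"
    and "\<And>y. 0 < y \<Longrightarrow> y < B \<Longrightarrow> (LBINT z:{0..y}. g z) = G y"
proof -
  have gi: "(\<lambda>x. indicator {0<..<B} x *\<^sub>R g x) \<in> borel_measurable borel"
    by (rule borel_measurable_continuous_on_indicator[OF _ g(1)]) simp
  have FTC: "set_integrable lborel {0<..<y} g \<and> (LBINT z:{0<..<y}. g z) = G y \<and> (LBINT z:{0..y}. g z) = G y" if y: "0 < y" "y \<le> B" for y
  proof -
    have cont: "isCont g x" if "0 < x" "x < y" for x
      using g(1) that y by (simp add: continuous_on_eq_continuous_at)
    have l: "((G \<circ> real_of_ereal) \<longlongrightarrow> G 0) (at_right (ereal 0))" "((G \<circ> real_of_ereal) \<longlongrightarrow> G y) (at_left (ereal y))"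
      using G(2) unfolding comp_def at_right_ereal at_left_ereal filterlim_filtermap
      by (auto simp: continuous_on_def intro: tendsto_mono[OF at_le])
    have "set_integrable lborel (einterval (ereal 0) (ereal y)) g" "interval_lebesgue_integral lborel (ereal 0) (ereal y) g = G y - G 0"
      using y cont by (intro interval_integral_FTC_nonneg[OF _ _ _ _ l]; auto intro!: der g)+
    then show ?thesis using y G(3)[of 0] interval_integral_Icc[of 0 y g] by (simp add: interval_lebesgue_integral_def)
  qed
  let ?M' = "density lborel (\<lambda>x. ennreal (g x) * indicator {0<..<B} x)"
  have M'eq: "?M' = density lborel (\<lambda>x. ennreal (indicator {0<..<B} x *\<^sub>R g x))"
    by (intro arg_cong[where f = "density lborel"] ext) (auto split: split_indicator)
  have em: "emeasure ?M' {..y} = ennreal (G y)" for y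
  proof -
    have "emeasure ?M' {..y} = (\<integral>\<^sup>+x. ennreal (indicator {0<..<B} x *\<^sub>R g x) * indicator {..y} x \<partial>lborel)"
      unfolding M'eq using gi by (subst emeasure_density) auto
    also have "\<dots> = ennreal (G y)"
    proof (cases "0 < y")
      case False
      then have "(\<integral>\<^sup>+x. ennreal (indicator {0<..<B} x *\<^sub>R g x) * indicator {..y} x \<partial>lborel) = (\<integral>\<^sup>+x. 0 \<partial>(lborel :: real measure))"
        by (intro nn_integral_cong) (auto split: split_indicator)
      then show ?thesis using False G(3) by simp
    next
      case True
      define c where "c = min y B"
      have c: "0 < c" "c \<le> B" "G c = G y" using True B G(4)[of y] by (auto simp: c_def min_def)
      have "(\<integral>\<^sup>+x. ennreal (indicator {0<..<B} x *\<^sub>R g x) * indicator {..y} x \<partial>lborel) =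
          (\<integral>\<^sup>+x. ennreal (indicator {0<..<c} x *\<^sub>R g x) \<partial>lborel)"
      proof (rule nn_integral_cong_AE)
        have "AE x in lborel. x \<noteq> y" by (rule AE_lborel_singleton)
        then show "AE x in lborel. ennreal (indicator {0<..<B} x *\<^sub>R g x) * indicator {..y} x = ennreal (indicator {0<..<c} x *\<^sub>R g x)"
          by eventually_elim (auto simp: c_def split: split_indicator)
      qed
      also have "\<dots> = ennreal (\<integral>x. indicator {0<..<c} x *\<^sub>R g x \<partial>lborel)"
        using FTC[OF c(1,2)] c g(2) unfolding set_integrable_def
        by (intro nn_integral_eq_integral) (auto split: split_indicator)
      also have "\<dots> = ennreal (G y)"
        using FTC[OF c(1,2)] c(3) by (simp add: set_lebesgue_integral_def)
      finally show ?thesis .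
    qed
    finally show ?thesis .
  qed
  have "finite_borel_measure ?M'"
  proof (intro finite_borel_measure.intro finite_borel_measure_axioms.intro finite_measureI)
    have "AE x in ?M'. x \<le> B"
      unfolding M'eq using gi by (subst AE_density) (auto intro!: AE_I2 split: split_indicator)
    then have "emeasure ?M' (space ?M') = emeasure ?M' {..B}"
      by (intro emeasure_eq_AE) auto
    then show "emeasure ?M' (space ?M') \<noteq> \<infinity>" by (simp add: em)
  qed simp
  moreover have "cdf M = cdf ?M'"
  proof
    fix y
    have "0 \<le> G y" using G(1)[of y] by (simp add: cdf_def flip: G(1))
    then show "cdf M y = cdf ?M' y" by (simp add: G(1)) (simp add: cdf_def measure_def em)
  qed
  ultimately show "has_density_on M g {0<..<B}"
    unfolding has_density_on_def using cdf_unique'[OF M] by blast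
  show "(LBINT z:{0..y}. g z) = G y" if "0 < y" "y < B" for y
    using FTC[of y] that by simp
qed

subsection \<open>Absolutely continuous distributions\<close>

locale density_distribution = compact_distribution +
  fixes A :: real and f :: "real \<Rightarrow> real"
  assumes A_positive: "0 < A" and density: "has_density_on \<nu> f {0<..<A}"
    and f_cont: "continuous_on {0<..<A} f" and f_pos: "\<And>x. x \<in> {0<..<A} \<Longrightarrow> 0 < f x"
begin

lemma density_measurable: "(\<lambda>x. ennreal (f x) * indicator {0<..<A} x) \<in> borel_measurable borel"
proof -
  have "(\<lambda>x. indicator {0<..<A} x *\<^sub>R f x) \<in> borel_measurable borel"
    by (rule borel_measurable_continuous_on_indicator[OF _ f_cont]) simp
  then have "(\<lambda>x. ennreal (indicator {0<..<A} x *\<^sub>R f x)) \<in> borel_measurable borel" by measurable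
  moreover have "(\<lambda>x. ennreal (f x) * indicator {0<..<A} x) = (\<lambda>x. ennreal (indicator {0<..<A} x *\<^sub>R f x))"
    by (auto split: split_indicator)
  ultimately show ?thesis by simp
qed

lemma emeasure_eq_nn_integral:
  assumes "X \<in> sets borel"
  shows "emeasure \<nu> X = (\<integral>\<^sup>+x. ennreal (f x) * indicator {0<..<A} x * indicator X x \<partial>lborel)"
proof -
  have "emeasure \<nu> X = emeasure (density lborel (\<lambda>x. ennreal (f x) * indicator {0<..<A} x)) X"
    using density unfolding has_density_on_def by (rule arg_cong)
  also have "\<dots> = (\<integral>\<^sup>+x. ennreal (f x) * indicator {0<..<A} x * indicator X x \<partial>lborel)"
    using density_measurable assms by (intro emeasure_density) auto
  finally show ?thesis .
qed

lemma measure_singleton: "measure \<nu> {y} = 0"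
proof -
  have "emeasure \<nu> {y} = (\<integral>\<^sup>+x. 0 \<partial>(lborel :: real measure))"
    unfolding emeasure_eq_nn_integral[OF borel_singleton[OF sets.empty_sets]]
  proof (rule nn_integral_cong_AE)
    have "AE x in lborel. x \<noteq> y" by (rule AE_lborel_singleton)
    then show "AE x in lborel. ennreal (f x) * indicator {0<..<A} x * indicator {y} x = 0"
      by eventually_elim auto
  qed
  then show ?thesis by (simp add: measure_def)
qed

lemma distfun_cont: "continuous_on S (distfun \<nu>)"
proof -
  have "distfun \<nu> = cdf \<nu>" by (simp add: distfun_eq_cdf fun_eq_iff)
  then show ?thesis
    using isCont_cdf measure_singleton by (simp add: continuous_at_imp_continuous_on)
qed

text \<open>Continuity of \<open>f\<close> is known on the open interval only, so the integral is
  started at an interior point \<open>a\<close> and taken inside a compact interval around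
  \<open>y\<close>.\<close>

lemma distfun_deriv:
  assumes y: "y \<in> {0<..<A}"
  shows "(distfun \<nu> has_real_derivative f y) (at y)"
proof -
  define a b where "a = y / 2" and "b = (y + A) / 2"
  have ab: "0 < a" "a < y" "y < b" "b < A" using y by (auto simp: a_def b_def)
  have cont: "continuous_on {a..b} f" using ab by (intro continuous_on_subset[OF f_cont]) auto
  have eq: "distfun \<nu> u = distfun \<nu> a + integral {a..u} f" if u: "u \<in> {a<..<b}" for u
  proof -
    have "f integrable_on {a..u}" using u by (intro integrable_continuous_real continuous_on_subset[OF cont]) auto
    then have "(f has_integral integral {a..u} f) {a..u}" by (rule integrable_integral)
    then have 1: "(\<integral>\<^sup>+x. ennreal (f x) * indicator {a..u} x \<partial>lborel) = ennreal (integral {a..u} f)"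
      using u ab f_pos by (intro nn_integral_has_integral_lebesgue') (auto intro: less_imp_le)
    have "emeasure \<nu> {a<..u} = (\<integral>\<^sup>+x. ennreal (f x) * indicator {0<..<A} x * indicator {a<..u} x \<partial>lborel)"
      by (rule emeasure_eq_nn_integral) simp
    also have "\<dots> = (\<integral>\<^sup>+x. ennreal (f x) * indicator {a..u} x \<partial>lborel)"
    proof (rule nn_integral_cong_AE)
      have "AE x in lborel. x \<noteq> a" by (rule AE_lborel_singleton)
      then show "AE x in lborel. ennreal (f x) * indicator {0<..<A} x * indicator {a<..u} x = ennreal (f x) * indicator {a..u} x"
        by eventually_elim (use u ab in \<open>auto split: split_indicator\<close>)
    qed
    finally have "emeasure \<nu> {a<..u} = ennreal (integral {a..u} f)" unfolding 1 .
    moreover have "0 \<le> integral {a..u} f"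
      using u ab f_pos by (intro integral_nonneg \<open>f integrable_on {a..u}\<close>) (auto intro: less_imp_le)
    ultimately have "measure \<nu> {a<..u} = integral {a..u} f" by (simp add: measure_def)
    then show ?thesis using cdf_diff_eq[of a u] u by (simp add: distfun_eq_cdf)
  qed
  have "((\<lambda>u. integral {a..u} f) has_real_derivative f y) (at y within {a..b})"
    using ab by (intro integral_has_real_derivative cont) auto
  then have "((\<lambda>u. integral {a..u} f) has_real_derivative f y) (at y)"
    using ab by (simp add: at_within_Icc_at)
  then have "((\<lambda>u. distfun \<nu> a + integral {a..u} f) has_real_derivative f y) (at y)"
    by (auto intro!: derivative_eq_intros)
  then show ?thesis
    by (rule has_field_derivative_transform_within_open[of _ _ _ "{a<..<b}"]) (use ab eq in auto)
qed

lemma distfun_cont_incr: "cont_incr_bij (distfun \<nu>) {0..A} {0..1}"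
proof -
  have 0: "distfun \<nu> 0 = 0" using measure_singleton by (simp add: distfun_def)
  have "AE x in \<nu>. x \<in> {0..A}"
  proof -
    have "AE x in density lborel (\<lambda>x. ennreal (f x) * indicator {0<..<A} x). x \<in> {0..A}"
      using density_measurable by (subst AE_density) (auto intro!: AE_I2 split: split_indicator_asm)
    with density[unfolded has_density_on_def] show ?thesis
      by (rule ssubst[where P = "\<lambda>M. AE x in M. x \<in> {0..A}"])
  qed
  then have 1: "distfun \<nu> A = 1" unfolding distfun_def by (subst prob_eq_1) auto
  have sm: "strict_mono_on {0..A} (distfun \<nu>)"
  proof (rule strict_mono_onI)
    fix x y assume xy: "x \<in> {0..A}" "y \<in> {0..A}" "x < y"
    show "distfun \<nu> x < distfun \<nu> y"
    proof (rule DERIV_pos_imp_increasing_open[OF xy(3) _ distfun_cont])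
      fix z assume "x < z" "z < y"
      then have "z \<in> {0<..<A}" using xy by auto
      then show "\<exists>w. (distfun \<nu> has_real_derivative w) (at z) \<and> 0 < w"
        using distfun_deriv f_pos by blast
    qed
  qed
  have "distfun \<nu> ` {0..A} = {0..1}"
    using strict_mono_image_Icc[OF less_imp_le[OF A_positive] distfun_cont sm] by (simp add: 0 1)
  then show ?thesis
    using sm distfun_cont strict_mono_on_imp_inj_on[OF sm] by (simp add: cont_incr_bij_def bij_betw_def)
qed

sublocale bijective_distribution \<nu> A
  by unfold_locales (rule A_positive, rule distfun_cont_incr)

lemma Psi_cont_incr_bij:
  assumes "t \<in> {0..<1}"
  shows "cont_incr_bij (Psi \<nu> t) {0..A * (1 - t)} {0..1 - t}"
  using assms distfun_bij Psi_cont_incr(1)[of t] by (cases "t = 0") (auto simp: Psi_0)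

lemma scaled_nu_finite_borel:
  assumes "t \<in> {0..<1}"
  shows "finite_borel_measure (scaled_nu \<nu> t)"
proof (cases "t = 0")
  case True
  then show ?thesis using finite_borel_measure_M by (simp add: scaled_nu_def)
next
  case False
  have s: "sets (scaled_nu \<nu> t) = sets borel" using False by (simp add: scaled_nu_def nu_def)
  have "emeasure (scaled_nu \<nu> t) (space (scaled_nu \<nu> t)) \<noteq> \<infinity>"
    using scaled_nu_mass[of t] False assms sets_eq_imp_space_eq[OF s] by simp
  then show ?thesis
    by (intro finite_borel_measure.intro finite_borel_measure_axioms.intro finite_measureI s)
qed

lemma cdf_scaled_nu:
  assumes "t \<in> {0..<1}"
  shows "cdf (scaled_nu \<nu> t) y = Psi \<nu> t y"
proof (cases "t = 0")
  case True
  then show ?thesis by (simp add: Psi_0 distfun_eq_cdf) (simp add: scaled_nu_def)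
next
  case False
  then have t: "t \<in> {0<..<1}" using assms by auto
  have "{t..1} \<inter> level t -` {..y} = {v \<in> {t..1}. level t v \<le> y}" by auto
  then show ?thesis
    using scaled_nu_emeasure[OF t, of "{..y}"] by (simp add: Psi_eq[OF t] cdf_def measure_def)
qed

lemma Psi_outside:
  assumes t: "t \<in> {0..<1}"
  shows "y \<le> 0 \<Longrightarrow> Psi \<nu> t y = 0" "A * (1 - t) \<le> y \<Longrightarrow> Psi \<nu> t y = 1 - t"
proof -
  have B: "0 \<le> A * (1 - t)" using t A_pos by auto
  note ends = cont_incr_bij_endpoints[OF Psi_cont_incr_bij[OF t] B]
  show "Psi \<nu> t y = 0" if "y \<le> 0"
    using that ends(1) t by (cases "y = 0") (auto simp: Psi_def distfun_def)
  interpret finite_borel_measure "scaled_nu \<nu> t" using t by (rule scaled_nu_finite_borel)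
  show "Psi \<nu> t y = 1 - t" if "A * (1 - t) \<le> y"
  proof (rule antisym)
    show "Psi \<nu> t y \<le> 1 - t"
      using Psi_le[of t y] distfun_le_1 t by (cases "t = 0") (auto simp: Psi_0)
    have "1 - t = Psi \<nu> t (A * (1 - t))" using ends(2) t by simp
    also have "\<dots> \<le> Psi \<nu> t y"
      using cdf_nondecreasing[OF that] by (simp add: cdf_scaled_nu[OF t])
    finally show "1 - t \<le> Psi \<nu> t y" .
  qed
qed

lemma Psi_cont:
  assumes t: "t \<in> {0..<1}"
  shows "continuous_on UNIV (Psi \<nu> t)"
proof -
  \<comment> \<open>Clamping to the interval, outside of which the function is constant, carries
    continuity from the interval to the whole line.\<close>
  let ?c = "\<lambda>y. max 0 (min y (A * (1 - t)))"
  have B: "0 \<le> A * (1 - t)" using t A_pos by auto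
  have "Psi \<nu> t (?c y) = Psi \<nu> t y" for y
    using Psi_outside[OF t] B by (auto simp: max_def min_def)
  moreover have "continuous_on UNIV (\<lambda>y. Psi \<nu> t (?c y))"
  proof (rule continuous_on_compose2[of "{0..A * (1 - t)}" "Psi \<nu> t"])
    show "continuous_on {0..A * (1 - t)} (Psi \<nu> t)"
      using Psi_cont_incr_bij[OF t] by (simp add: cont_incr_bij_def)
  qed (use B in \<open>auto intro!: continuous_intros\<close>)
  ultimately show ?thesis by simp
qed

end

subsection \<open>The partial differential equations\<close>

context density_distribution
begin

text \<open>The solution \<open>y\<close> of the implicit equation. Taking it as a quantile makes
  its existence immediate; that it solves the equation is proved in
  \<open>source_props\<close>.\<close>

definition source :: "real \<Rightarrow> real \<Rightarrow> real" where
  "source t x = quantile \<nu> (Psi \<nu> t x + t)"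

text \<open>For \<open>t > 0\<close> the last equation is \<open>quantile_scaled_nu\<close> at the
  level \<open>Psi \<nu> t x\<close>, whose quantile is \<open>x\<close>.\<close>

lemma source_props:
  assumes p: "(t, x) \<in> domain_E A"
  defines "y \<equiv> source t x"
  shows "y \<in> {0<..<A}" "t < distfun \<nu> y" "Psi \<nu> t x = distfun \<nu> y - t" "y - t * (y / distfun \<nu> y) = x"
proof -
  have px: "0 \<le> t" "t < 1" "0 < x" "x < A * (1 - t)" using p by (auto simp: domain_E_iff)
  then have t: "t \<in> {0..<1}" by auto
  have sm: "strict_mono_on {0..A * (1 - t)} (Psi \<nu> t)"
    using Psi_cont_incr_bij[OF t] by (simp add: cont_incr_bij_def)
  have u: "0 < Psi \<nu> t x" "Psi \<nu> t x < 1 - t"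
    using strict_mono_onD[OF sm, of 0 x] strict_mono_onD[OF sm, of x "A * (1 - t)"] Psi_outside[OF t] px
    by auto
  have smq: "strict_mono_on {0..1} (quantile \<nu>)" using quantile_cont_incr by (simp add: cont_incr_bij_def)
  show y: "y \<in> {0<..<A}"
    using strict_mono_onD[OF smq, of 0 "Psi \<nu> t x + t"] strict_mono_onD[OF smq, of "Psi \<nu> t x + t" 1] u px
    by (auto simp: y_def source_def quantile_0 quantile_1)
  have F: "distfun \<nu> y = Psi \<nu> t x + t"
    using quantile_inverse u px by (auto simp: y_def source_def inverse_bijections_def)
  then show "t < distfun \<nu> y" "Psi \<nu> t x = distfun \<nu> y - t" using u by auto
  show "y - t * (y / distfun \<nu> y) = x"
  proof (cases "t = 0")
    case True
    then show ?thesis using quantile_distfun[of x] px by (simp add: y_def source_def Psi_0)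
  next
    case False
    then have t': "t \<in> {0<..<1}" using t by auto
    have "x = quantile (scaled_nu \<nu> t) (Psi \<nu> t x)"
      using Psi_cont_incr(2)[OF t'] px by (simp add: inverse_bijections_def)
    also have "\<dots> = Psi \<nu> t x * y / (Psi \<nu> t x + t)"
      using quantile_scaled_nu[OF t', of "Psi \<nu> t x"] u by (simp add: y_def source_def)
    also have "\<dots> = y - t * (y / distfun \<nu> y)"
      using u px unfolding F by (simp add: field_simps)
    finally show ?thesis by simp
  qed
qed

text \<open>The map is \<open>(1 - t / distfun \<nu> y) * y\<close>, a product of a nondecreasing
  positive factor and \<open>y\<close>. The condition \<open>t < distfun \<nu> y\<close> is imposed
  at the smaller point only, which is all that the comparisons in \<open>source_cont\<close> can
  supply.\<close>

lemma shift_strict_mono: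
  assumes "0 \<le> t" "0 < y" "y < z" "z < A" "t < distfun \<nu> y"
  shows "y - t * (y / distfun \<nu> y) < z - t * (z / distfun \<nu> z)"
proof -
  have F: "distfun \<nu> y \<le> distfun \<nu> z" using assms by (intro mono_distfun) auto
  have "(1 - t / distfun \<nu> y) * y \<le> (1 - t / distfun \<nu> z) * y"
    using assms F by (intro mult_right_mono diff_left_mono divide_left_mono) auto
  also have "\<dots> < (1 - t / distfun \<nu> z) * z"
    using assms F by (intro mult_strict_left_mono) auto
  finally show ?thesis by (simp add: algebra_simps)
qed

text \<open>At a fixed \<open>z\<close> near the solution, the sign of
  \<open>x - (z - t * (z / distfun \<nu> z))\<close> is stable under small changes of
  \<open>(t, x)\<close>, and strict monotonicity then keeps the solution on its side of
  \<open>z\<close>. No derivative is involved, and \<open>t = 0\<close> is no exception.\<close>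

lemma source_cont: "continuous_on (domain_E A) (\<lambda>p. source (fst p) (snd p))"
  unfolding continuous_on_def
proof
  fix p assume p: "p \<in> domain_E A"
  obtain t x where tx: "p = (t, x)" by force
  let ?y = "source t x"
  let ?N = "at p within domain_E A"
  note y = source_props[OF p[unfolded tx]]
  have Fc: "isCont (distfun \<nu>) ?y"
    using distfun_cont[of UNIV] by (simp add: continuous_on_eq_continuous_at)
  have inE: "eventually (\<lambda>p. p \<in> domain_E A) ?N"
    by (simp add: eventually_at_filter)
  have t0: "0 \<le> t" using p tx by (simp add: domain_E_iff)
  have shift: "((\<lambda>p. snd p - (z - fst p * (z / distfun \<nu> z))) \<longlongrightarrow> x - (z - t * (z / distfun \<nu> z))) ?N" for z
    unfolding tx by (intro tendsto_eq_intros | simp)+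
  have "((\<lambda>p. source (fst p) (snd p)) \<longlongrightarrow> ?y) ?N"
  proof (rule order_tendstoI)
    fix a assume "a < ?y"
    have "eventually (\<lambda>z. t < distfun \<nu> z) (at_left ?y)"
      by (rule order_tendstoD(1)[OF tendsto_mono[OF at_le[OF subset_UNIV] Fc[unfolded isCont_def]] y(2)])
    moreover have "eventually (\<lambda>z. z \<in> {max a 0<..<?y}) (at_left ?y)"
      using \<open>a < ?y\<close> y(1) by (intro eventually_at_left_real) auto
    ultimately have "eventually (\<lambda>z. t < distfun \<nu> z \<and> z \<in> {max a 0<..<?y}) (at_left ?y)"
      by eventually_elim auto
    then obtain z where z: "t < distfun \<nu> z" "a < z" "0 < z" "z < ?y"
      using eventually_happens'[OF trivial_limit_at_left_real] by force
    have "z - t * (z / distfun \<nu> z) < x"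
      using shift_strict_mono[of t z ?y] z t0 y by auto
    then have "eventually (\<lambda>p. 0 < snd p - (z - fst p * (z / distfun \<nu> z))) ?N"
      by (intro order_tendstoD[OF shift]) simp
    then show "eventually (\<lambda>p. a < source (fst p) (snd p)) ?N"
      using inE
    proof eventually_elim
      case (elim q)
      have q: "(fst q, snd q) \<in> domain_E A" using elim by simp
      then have q0: "0 \<le> fst q" unfolding domain_E_iff by simp
      note sq = source_props[OF q]
      show ?case
      proof (rule ccontr)
        assume "\<not> a < source (fst q) (snd q)"
        then have lt: "source (fst q) (snd q) < z" using z by simp
        have "snd q < z - fst q * (z / distfun \<nu> z)"
          using shift_strict_mono[of "fst q" "source (fst q) (snd q)" z] sq lt q0 z y(1) by auto
        with elim show False by simp
      qed
    qed
  next
    fix b assume "?y < b"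
    define z where "z = (?y + min b A) / 2"
    have z: "?y < z" "z < b" "z < A" using \<open>?y < b\<close> y(1) by (auto simp: z_def min_def)
    have tz: "t < distfun \<nu> z" using y(2) mono_distfun[of ?y z] z by simp
    have "x < z - t * (z / distfun \<nu> z)"
      using shift_strict_mono[of t ?y z] z t0 y by auto
    then have "eventually (\<lambda>p. snd p - (z - fst p * (z / distfun \<nu> z)) < 0) ?N"
      by (intro order_tendstoD[OF shift]) simp
    \<comment> \<open>Here \<open>z\<close> is the smaller of the two points to be compared, so this
      condition of \<open>shift_strict_mono\<close> must be secured near \<open>p\<close>
      too.\<close>
    moreover have "eventually (\<lambda>p. fst p < distfun \<nu> z) ?N"
      using tz by (intro order_tendstoD[of fst t]) (auto simp: tx intro!: tendsto_eq_intros)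
    ultimately show "eventually (\<lambda>p. source (fst p) (snd p) < b) ?N"
      using inE
    proof eventually_elim
      case (elim q)
      have q: "(fst q, snd q) \<in> domain_E A" using elim by simp
      then have q0: "0 \<le> fst q" unfolding domain_E_iff by simp
      note sq = source_props[OF q]
      show ?case
      proof (rule ccontr)
        assume "\<not> source (fst q) (snd q) < b"
        then have lt: "z < source (fst q) (snd q)" using z by simp
        have "z - fst q * (z / distfun \<nu> z) < snd q"
          using shift_strict_mono[of "fst q" z "source (fst q) (snd q)"] sq lt q0 z y(1) elim by auto
        with elim show False by simp
      qed
    qed
  qed
  then show "((\<lambda>p. source (fst p) (snd p)) \<longlongrightarrow> source (fst p) (snd p)) ?N" by (simp add: tx)
qed

lemma comp_source_cont:
  assumes "continuous_on {0<..<A} h"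
  shows "continuous_on (domain_E A) (\<lambda>p. h (source (fst p) (snd p)))"
proof (rule continuous_on_compose2[OF assms source_cont])
  show "(\<lambda>p. source (fst p) (snd p)) ` domain_E A \<subseteq> {0<..<A}"
    using source_props(1) by force
qed

definition ratio_deriv :: "real \<Rightarrow> real" where
  "ratio_deriv y = (distfun \<nu> y - y * f y) / (distfun \<nu> y)\<^sup>2"

lemma distfun_pos: "y \<in> {0<..<A} \<Longrightarrow> 0 < distfun \<nu> y"
  using distfun_less_iff[of 0 y] by (simp add: distfun_0)

lemma ratio_has_deriv:
  assumes y: "y \<in> {0<..<A}"
  shows "((\<lambda>y. y / distfun \<nu> y) has_real_derivative ratio_deriv y) (at y)"
  using distfun_pos[OF y] distfun_deriv[OF y]
  by (auto intro!: derivative_eq_intros simp: ratio_deriv_def power2_eq_square)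

text \<open>The derivative of \<open>y - t * (y / distfun \<nu> y)\<close> in \<open>y\<close>,
  hence the Jacobian determinant of the map from \<open>(t, y)\<close> to
  \<open>(t, x)\<close>.\<close>

definition jac :: "real \<Rightarrow> real \<Rightarrow> real" where
  "jac t y = 1 - t * ratio_deriv y"

text \<open>Multiplied by \<open>F^2\<close>, the expression becomes
  \<open>F (F - t) + t y f(y)\<close>.\<close>

lemma jac_pos:
  assumes y: "y \<in> {0<..<A}" and t: "0 \<le> t" "t < distfun \<nu> y"
  shows "0 < jac t y"
proof -
  define F where "F = distfun \<nu> y"
  have F: "0 < F" "t < F" using distfun_pos[OF y] t by (auto simp: F_def)
  have "t * F < F * F" using F by (intro mult_strict_right_mono) auto
  moreover have "0 \<le> t * (y * f y)" using t y f_pos[OF y] by auto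
  ultimately have "0 < F * F - t * (F - y * f y)" unfolding right_diff_distrib by linarith
  then have "0 < (F * F - t * (F - y * f y)) / F\<^sup>2" using F by simp
  also have "\<dots> = jac t y" using F by (simp add: jac_def ratio_deriv_def F_def field_simps power2_eq_square)
  finally show ?thesis .
qed

lemma jac_source_pos: "(t, x) \<in> domain_E A \<Longrightarrow> 0 < jac t (source t x)"
  using source_props[of t x] by (intro jac_pos) (auto simp: domain_E_iff)

abbreviation src :: "real \<times> real \<Rightarrow> real" where "src p \<equiv> source (fst p) (snd p)"
abbreviation jc :: "real \<times> real \<Rightarrow> real" where "jc p \<equiv> jac (fst p) (src p)"

lemma src_props:
  assumes "p \<in> domain_E A"
  shows "src p \<in> {0<..<A}" "fst p < distfun \<nu> (src p)" "Psi \<nu> (fst p) (snd p) = distfun \<nu> (src p) - fst p"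
    "src p - fst p * (src p / distfun \<nu> (src p)) = snd p" "0 < jc p" "0 < distfun \<nu> (src p)"
  using source_props[of "fst p" "snd p"] jac_source_pos[of "fst p" "snd p"] distfun_pos[of "src p"] assms by simp_all

text \<open>The map \<open>(t, y) \<mapsto> (t, y - t y / F(y))\<close>, of which \<open>(t, x) \<mapsto> (t, src (t, x))\<close> is a right inverse,
  is differentiable on a full neighbourhood also at \<open>t = 0\<close>.\<close>

lemma src_has_derivative:
  assumes p: "p \<in> domain_E A"
  shows "(src has_derivative (\<lambda>h. fst h * ((src p / distfun \<nu> (src p)) / jc p) + snd h * (1 / jc p)))
    (at p within domain_E A)"
proof -
  let ?y = "src p" and ?r = "src p / distfun \<nu> (src p)"
  let ?G = "\<lambda>q. (fst q, snd q - fst q * (snd q / distfun \<nu> (snd q)))"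
  let ?g = "\<lambda>q. (fst q, src q)"
  note y = src_props[OF p]
  have r: "((\<lambda>q. snd q / distfun \<nu> (snd q)) has_derivative (\<lambda>h. snd h * ratio_deriv ?y)) (at (?g p))"
    by (rule DERIV_compose_FDERIV[where f = "\<lambda>y. y / distfun \<nu> y"])
      (simp_all add: ratio_has_deriv[OF y(1)] has_derivative_snd[OF has_derivative_ident])
  have G: "(?G has_derivative (\<lambda>h. (fst h, snd h * jc p - fst h * ?r))) (at (?g p))"
    by (rule has_derivative_eq_rhs[OF has_derivative_Pair[OF has_derivative_fst[OF has_derivative_ident]
          has_derivative_diff[OF has_derivative_snd[OF has_derivative_ident]
            has_derivative_mult[OF has_derivative_fst[OF has_derivative_ident] r]]]])
      (simp add: jac_def algebra_simps fun_eq_iff)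
  have "(?g has_derivative (\<lambda>h. (fst h, (snd h + fst h * ?r) / jc p))) (at p within domain_E A)"
  proof (rule has_derivative_inverse_within[where f = ?G and g = ?g, OF G])
    show "bounded_linear (\<lambda>h. (fst h, (snd h + fst h * ?r) / jc p))"
      unfolding linear_conv_bounded_linear[symmetric]
      by (intro linearI) (simp_all add: add_divide_distrib algebra_simps)
    show "(fst (fst h, snd h * jc p - fst h * ?r), (snd (fst h, snd h * jc p - fst h * ?r) +
       fst (fst h, snd h * jc p - fst h * ?r) * ?r) / jc p) = h" for h
      using y(5) by (simp add: prod_eq_iff)
    show "continuous (at p within domain_E A) ?g"
      using source_cont p by (intro continuous_intros) (auto simp: continuous_on_eq_continuous_within)
    show "?G (?g q) = q" if "q \<in> domain_E A" for q
      using src_props(4)[OF that] by (simp add: prod_eq_iff)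
  qed (rule p)
  then have "((\<lambda>q. snd (?g q)) has_derivative (\<lambda>h. snd (fst h, (snd h + fst h * ?r) / jc p))) (at p within domain_E A)"
    by (rule has_derivative_snd)
  then show ?thesis by (simp add: add_divide_distrib add.commute)
qed

lemma comp_src_has_derivative:
  assumes "p \<in> domain_E A" "(h has_real_derivative h') (at (src p))"
  shows "((\<lambda>q. h (src q)) has_derivative
    (\<lambda>d. (fst d * ((src p / distfun \<nu> (src p)) / jc p) + snd d * (1 / jc p)) * h')) (at p within domain_E A)"
  by (rule DERIV_compose_FDERIV[OF assms(2) src_has_derivative[OF assms(1)]])

lemma Psi_has_derivative:
  assumes p: "p \<in> domain_E A"
  shows "((\<lambda>(t, x). Psi \<nu> t x) has_derivative
    (\<lambda>h. fst h * (f (src p) * (src p / distfun \<nu> (src p)) / jc p - 1) + snd h * (f (src p) / jc p)))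
    (at p within domain_E A)"
proof (rule has_derivative_transform[OF p])
  show "(case q of (t, x) \<Rightarrow> Psi \<nu> t x) = distfun \<nu> (src q) - fst q" if "q \<in> domain_E A" for q
    using src_props(3)[OF that] by (simp add: split_beta)
  show "((\<lambda>q. distfun \<nu> (src q) - fst q) has_derivative
    (\<lambda>h. fst h * (f (src p) * (src p / distfun \<nu> (src p)) / jc p - 1) + snd h * (f (src p) / jc p)))
    (at p within domain_E A)"
    by (rule has_derivative_eq_rhs[OF has_derivative_diff[OF
          comp_src_has_derivative[OF p distfun_deriv[OF src_props(1)[OF p]]] has_derivative_fst[OF has_derivative_ident]]])
      (auto simp: fun_eq_iff algebra_simps)
qed

lemma Psi_deriv_x:
  assumes p: "(t, x) \<in> domain_E A"
  shows "(Psi \<nu> t has_real_derivative f (source t x) / jac t (source t x)) (at x)"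
  using partial_derivatives_domain_E(2)[OF Psi_has_derivative[OF p] p A_pos] by simp

lemma psi_eq:
  assumes p: "(t, x) \<in> domain_E A"
  shows "psi \<nu> t x = f (source t x) / jac t (source t x)"
  unfolding psi_def using Psi_deriv_x[OF p] by (rule DERIV_imp_deriv)

lemma psi_pos: "(t, x) \<in> domain_E A \<Longrightarrow> 0 < psi \<nu> t x"
  using psi_eq[of t x] jac_source_pos[of t x] source_props(1)[of t x] f_pos by simp

lemma ratio_deriv_cont: "continuous_on {0<..<A} ratio_deriv"
  unfolding ratio_deriv_def using distfun_pos
  by (intro continuous_on_divide continuous_on_diff continuous_on_mult continuous_on_power continuous_on_id
      f_cont distfun_cont) force

lemma ratio_cont: "continuous_on {0<..<A} (\<lambda>y. y / distfun \<nu> y)"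
  using distfun_pos by (intro continuous_on_divide continuous_on_id distfun_cont) force

lemma jc_cont: "continuous_on (domain_E A) jc"
  unfolding jac_def
  by (intro continuous_on_diff continuous_on_mult continuous_on_const continuous_on_fst continuous_on_id
      comp_source_cont[OF ratio_deriv_cont])

lemma jc_nonzero: "\<forall>p\<in>domain_E A. jc p \<noteq> 0"
  using src_props(5) by force

lemma psi_cont: "continuous_on (domain_E A) (\<lambda>p. f (src p) / jc p)"
  by (intro continuous_on_divide comp_source_cont[OF f_cont] jc_cont jc_nonzero)

lemma Psi_C1: "continuously_differentiable_on (domain_E A) (\<lambda>(t, x). Psi \<nu> t x)"
proof (rule continuously_differentiable_on_partials[OF Psi_has_derivative])
  show "continuous_on (domain_E A) (\<lambda>p. f (src p) * (src p / distfun \<nu> (src p)) / jc p - 1)"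
    by (intro continuous_on_divide continuous_on_diff continuous_on_mult continuous_on_const
      comp_source_cont[OF f_cont] comp_source_cont[OF ratio_cont] jc_cont jc_nonzero)
  show "continuous_on (domain_E A) (\<lambda>p. f (src p) / jc p)" by (rule psi_cont)
qed

text \<open>The derivative in \<open>t\<close> from \<open>Psi_has_derivative\<close> is
  \<open>psi\<close> times \<open>y / F\<close>, minus 1. Since \<open>x = (y / F) (F - t)\<close>
  and \<open>Psi\<close> is \<open>F - t\<close>, the factor \<open>y / F\<close> is
  \<open>x / Psi\<close>.\<close>

lemma Psi_pde:
  assumes p: "(t, x) \<in> domain_E A"
  shows "((\<lambda>s. Psi \<nu> s x) has_real_derivative (x * (psi \<nu> t x / Psi \<nu> t x) - 1)) (at t within {0..})"
proof -
  define y where "y = source t x"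
  note y = source_props[OF p, folded y_def]
  have F: "0 < distfun \<nu> y" "0 < distfun \<nu> y - t" using y distfun_pos by auto
  have e: "x = (y / distfun \<nu> y) * (distfun \<nu> y - t)"
    using y(4) F by (simp add: field_simps)
  have nz: "distfun \<nu> y - t \<noteq> 0" using F by simp
  have "x / Psi \<nu> t x = y / distfun \<nu> y" unfolding y(3) nonzero_divide_eq_eq[OF nz] by (rule e)
  then have "psi \<nu> t x * (x / Psi \<nu> t x) = f y * (y / distfun \<nu> y) / jac t y"
    by (simp add: psi_eq[OF p, folded y_def])
  then have "x * (psi \<nu> t x / Psi \<nu> t x) = f y * (y / distfun \<nu> y) / jac t y"
    by (simp add: mult.commute)
  then show ?thesis
    using partial_derivatives_domain_E(1)[OF Psi_has_derivative[OF p] p A_pos] by (simp add: y_def)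
qed

lemma psi_slice_cont: "t \<in> {0..<1} \<Longrightarrow> continuous_on {0<..<A * (1 - t)} (psi \<nu> t)"
proof -
  assume t: "t \<in> {0..<1}"
  have "continuous_on {0<..<A * (1 - t)} (\<lambda>x. (\<lambda>p. f (src p) / jc p) (t, x))"
    by (rule continuous_on_compose2[OF psi_cont])
      (use t in \<open>auto simp: domain_E_iff intro!: continuous_intros\<close>)
  then show ?thesis
    by (rule continuous_on_eq) (use t in \<open>auto simp: psi_eq domain_E_iff\<close>)
qed

lemma scaled_nu_density:
  assumes t: "t \<in> {0..<1}"
  shows "has_density_on (scaled_nu \<nu> t) (psi \<nu> t) {0<..<A * (1 - t)}"
    and "\<And>y. 0 < y \<Longrightarrow> y < A * (1 - t) \<Longrightarrow> (LBINT z:{0..y}. psi \<nu> t z) = Psi \<nu> t y"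
proof -
  have E: "(t, x) \<in> domain_E A" if "x \<in> {0<..<A * (1 - t)}" for x using that t by (auto simp: domain_E_iff)
  have B: "0 < A * (1 - t)" using t A_pos by auto
  have der: "(Psi \<nu> t has_real_derivative psi \<nu> t x) (at x)" if "x \<in> {0<..<A * (1 - t)}" for x
    using Psi_deriv_x[OF E[OF that]] psi_eq[OF E[OF that]] by simp
  have out: "Psi \<nu> t y = Psi \<nu> t (A * (1 - t))" if "A * (1 - t) \<le> y" for y
    using Psi_outside(2)[OF t] that by simp
  note * = density_of_cdf_derivative[OF scaled_nu_finite_borel[OF t] B cdf_scaled_nu[OF t] Psi_cont[OF t]
      Psi_outside(1)[OF t] out der psi_slice_cont[OF t] less_imp_le[OF psi_pos[OF E]]]
  show "has_density_on (scaled_nu \<nu> t) (psi \<nu> t) {0<..<A * (1 - t)}" by (rule *(1))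
  show "(LBINT z:{0..y}. psi \<nu> t z) = Psi \<nu> t y" if "0 < y" "y < A * (1 - t)" for y
    by (rule *(2)) (use that in auto)
qed

lemma AE_scaled_nu:
  assumes t: "t \<in> {0..<1}"
  shows "AE x in scaled_nu \<nu> t. x \<in> {0..A * (1 - t)}"
proof -
  let ?h = "\<lambda>x. ennreal (psi \<nu> t x) * indicator {0<..<A * (1 - t)} x"
  have "(\<lambda>x. indicator {0<..<A * (1 - t)} x *\<^sub>R psi \<nu> t x) \<in> borel_measurable borel"
    by (rule borel_measurable_continuous_on_indicator[OF _ psi_slice_cont[OF t]]) simp
  then have "(\<lambda>x. ennreal (indicator {0<..<A * (1 - t)} x *\<^sub>R psi \<nu> t x)) \<in> borel_measurable borel" by measurable
  moreover have "?h = (\<lambda>x. ennreal (indicator {0<..<A * (1 - t)} x *\<^sub>R psi \<nu> t x))"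
    by (auto split: split_indicator)
  ultimately have "?h \<in> borel_measurable lborel" by simp
  then have "AE x in density lborel ?h. x \<in> {0..A * (1 - t)}"
    by (subst AE_density) (auto intro!: AE_I2 split: split_indicator_asm)
  with scaled_nu_density(1)[OF t, unfolded has_density_on_def] show ?thesis
    by (rule ssubst[where P = "\<lambda>M. AE x in M. x \<in> {0..A * (1 - t)}"])
qed

section \<open>Continuously differentiable densities\<close>

context
  fixes f' :: "real \<Rightarrow> real"
  assumes f_deriv: "\<And>y. y \<in> {0<..<A} \<Longrightarrow> (f has_real_derivative f' y) (at y)"
    and f'_cont: "continuous_on {0<..<A} f'"
begin

definition ratio_deriv2 :: "real \<Rightarrow> real" where
  "ratio_deriv2 y = (- (y * f' y) * (distfun \<nu> y)\<^sup>2 - (distfun \<nu> y - y * f y) * (2 * distfun \<nu> y * f y)) /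
    ((distfun \<nu> y)\<^sup>2 * (distfun \<nu> y)\<^sup>2)"

lemma ratio_deriv_has_deriv:
  assumes y: "y \<in> {0<..<A}"
  shows "(ratio_deriv has_real_derivative ratio_deriv2 y) (at y)"
  unfolding ratio_deriv_def[abs_def]
  using distfun_pos[OF y]
  by (auto intro!: derivative_eq_intros distfun_deriv[OF y] f_deriv[OF y] simp: ratio_deriv2_def)

lemma ratio_deriv2_cont: "continuous_on {0<..<A} ratio_deriv2"
  unfolding ratio_deriv2_def using distfun_pos
  by (intro continuous_on_divide continuous_on_diff continuous_on_mult continuous_on_minus continuous_on_power
      continuous_on_id continuous_on_const f_cont f'_cont distfun_cont) force

text \<open>The derivative of \<open>f y / jac t y\<close> in \<open>y\<close> by the quotient rule,
  times the derivative \<open>1 / jac\<close> of \<open>y\<close> in \<open>x\<close>.\<close>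

definition psi_x :: "real \<times> real \<Rightarrow> real" where
  "psi_x p = (f' (src p) * jc p + f (src p) * (fst p * ratio_deriv2 (src p))) / (jc p * jc p) * (1 / jc p)"

text \<open>The first term is the direct dependence of \<open>f y / jac t y\<close> on
  \<open>t\<close>; the second comes through \<open>y\<close>, whose derivative in \<open>t\<close>
  is \<open>y / F\<close> times the one in \<open>x\<close>. In this form it is also the product
  rule for the derivative in \<open>x\<close> of \<open>psi\<close> times \<open>y / F\<close>, so
  the equation of (4) can be read off.\<close>

definition psi_t :: "real \<times> real \<Rightarrow> real" where
  "psi_t p = f (src p) * ratio_deriv (src p) / (jc p * jc p) + psi_x p * (src p / distfun \<nu> (src p))"

lemma psi_has_derivative:
  assumes p: "p \<in> domain_E A"
  shows "((\<lambda>(t, x). psi \<nu> t x) has_derivative (\<lambda>h. fst h * psi_t p + snd h * psi_x p)) (at p within domain_E A)"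
proof (rule has_derivative_transform[OF p])
  show "(case q of (t, x) \<Rightarrow> psi \<nu> t x) = f (src q) / jc q" if "q \<in> domain_E A" for q
    using psi_eq[of "fst q" "snd q"] that by (simp add: split_beta)
  note y = src_props[OF p]
  let ?D = "\<lambda>d. fst d * ((src p / distfun \<nu> (src p)) / jc p) + snd d * (1 / jc p)"
  have 1: "((\<lambda>q. f (src q)) has_derivative (\<lambda>d. ?D d * f' (src p))) (at p within domain_E A)"
    by (rule comp_src_has_derivative[OF p f_deriv[OF y(1)]])
  have 2: "((\<lambda>q. ratio_deriv (src q)) has_derivative (\<lambda>d. ?D d * ratio_deriv2 (src p))) (at p within domain_E A)"
    by (rule comp_src_has_derivative[OF p ratio_deriv_has_deriv[OF y(1)]])
  have 3: "(jc has_derivative (\<lambda>d. - (fst p * (?D d * ratio_deriv2 (src p)) + fst d * ratio_deriv (src p)))) (at p within domain_E A)"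
  proof (rule has_derivative_transform[OF p])
    show "jc q = 1 - fst q * ratio_deriv (src q)" for q by (simp add: jac_def)
    show "((\<lambda>q. 1 - fst q * ratio_deriv (src q)) has_derivative
        (\<lambda>d. - (fst p * (?D d * ratio_deriv2 (src p)) + fst d * ratio_deriv (src p)))) (at p within domain_E A)"
      by (rule has_derivative_eq_rhs[OF has_derivative_diff[OF has_derivative_const
          has_derivative_mult[OF has_derivative_fst[OF has_derivative_ident] 2]]]) (simp add: fun_eq_iff)
  qed
  \<comment> \<open>\<open>D1\<close> stands for the differential of \<open>src\<close> and
    \<open>d\<close> for the increment of \<open>t\<close>; the identity separates their
    contributions.\<close>
  have alg: "(D1 * f' (src p) * jc p - f (src p) * - (fst p * (D1 * ratio_deriv2 (src p)) + d * ratio_deriv (src p))) / (jc p * jc p)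
      = d * (f (src p) * ratio_deriv (src p) / (jc p * jc p)) +
        D1 * ((f' (src p) * jc p + f (src p) * (fst p * ratio_deriv2 (src p))) / (jc p * jc p))" for D1 d
    by (simp add: add_divide_distrib diff_divide_distrib algebra_simps)
  have alg2: "d1 * c + (d1 * (r / j) + d2 * (1 / j)) * M = d1 * (c + M * (1 / j) * r) + d2 * (M * (1 / j))"
    for d1 d2 c r j M :: real by (simp add: algebra_simps)
  show "((\<lambda>q. f (src q) / jc q) has_derivative (\<lambda>h. fst h * psi_t p + snd h * psi_x p)) (at p within domain_E A)"
    by (rule has_derivative_eq_rhs[OF has_derivative_divide'[OF 1 3]])
      (use y(5) in simp, rule ext, rule trans[OF alg], unfold psi_t_def psi_x_def, rule alg2)
qed

lemma psi_C1: "continuously_differentiable_on (domain_E A) (\<lambda>(t, x). psi \<nu> t x)"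
proof (rule continuously_differentiable_on_partials[OF psi_has_derivative])
  have nz: "\<forall>p\<in>domain_E A. jc p * jc p \<noteq> 0" using jc_nonzero by simp
  show x: "continuous_on (domain_E A) psi_x"
    unfolding psi_x_def
    by (intro continuous_on_divide continuous_on_add continuous_on_mult continuous_on_const continuous_on_fst continuous_on_id
      comp_source_cont[OF f_cont] comp_source_cont[OF f'_cont] comp_source_cont[OF ratio_deriv2_cont] jc_cont jc_nonzero nz)
  show "continuous_on (domain_E A) psi_t"
    unfolding psi_t_def
    by (intro continuous_on_divide[OF _ _ nz] continuous_on_add continuous_on_mult[OF x] continuous_on_mult
      comp_source_cont[OF f_cont] comp_source_cont[OF ratio_deriv_cont] comp_source_cont[OF ratio_cont] jc_cont)
qed

text \<open>The mean of the density over \<open>{0..y}\<close> is \<open>Psi \<nu> t y / y\<close>,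
  the reciprocal of \<open>source t y / distfun \<nu> (source t y)\<close>. The function
  differentiated in \<open>x\<close> is thus \<open>psi\<close> times that ratio.\<close>

lemma psi_pde:
  assumes p: "(t, x) \<in> domain_E A"
  shows "((\<lambda>s. psi \<nu> s x) has_real_derivative psi_t (t, x)) (at t within {0..})"
    and "((\<lambda>y. psi \<nu> t y / (1 / y * (LBINT z:{0..y}. psi \<nu> t z))) has_real_derivative psi_t (t, x)) (at x)"
proof -
  note part = partial_derivatives_domain_E[OF _ p A_pos]
  show "((\<lambda>s. psi \<nu> s x) has_real_derivative psi_t (t, x)) (at t within {0..})"
    using part(1)[OF psi_has_derivative[OF p]] by simp
  have 1: "(psi \<nu> t has_real_derivative psi_x (t, x)) (at x)"
    using part(2)[OF psi_has_derivative[OF p]] by simp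
  have "((\<lambda>q. src q / distfun \<nu> (src q)) has_derivative
    (\<lambda>d. fst d * ((src (t, x) / distfun \<nu> (src (t, x))) / jc (t, x) * ratio_deriv (src (t, x))) + snd d * (1 / jc (t, x) * ratio_deriv (src (t, x)))))
    (at (t, x) within domain_E A)"
    using comp_src_has_derivative[OF p ratio_has_deriv[OF src_props(1)[OF p]]] by (simp only: distrib_right mult.assoc)
  from part(2)[OF this]
  have 2: "((\<lambda>y. source t y / distfun \<nu> (source t y)) has_real_derivative 1 / jac t (source t x) * ratio_deriv (source t x)) (at x)"
    by simp
  have 3: "((\<lambda>y. psi \<nu> t y * (source t y / distfun \<nu> (source t y))) has_real_derivative psi_t (t, x)) (at x)"
    by (rule DERIV_cong[OF DERIV_mult[OF 1 2]]) (simp add: psi_t_def psi_eq[OF p])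
  have t: "t \<in> {0..<1}" and x: "x \<in> {0<..<A * (1 - t)}" using p by (auto simp: domain_E_iff)
  show "((\<lambda>y. psi \<nu> t y / (1 / y * (LBINT z:{0..y}. psi \<nu> t z))) has_real_derivative psi_t (t, x)) (at x)"
  proof (rule has_field_derivative_transform_within_open[OF 3 _ x])
    fix y assume y: "y \<in> {0<..<A * (1 - t)}"
    then have E: "(t, y) \<in> domain_E A" using t by (simp add: domain_E_iff)
    note s = source_props[OF E]
    have F: "0 < distfun \<nu> (source t y)" "0 < distfun \<nu> (source t y) - t" using s distfun_pos by auto
    have e: "y = (source t y / distfun \<nu> (source t y)) * (distfun \<nu> (source t y) - t)"
      using s(4) F by (simp add: field_simps)
    have nz: "distfun \<nu> (source t y) - t \<noteq> 0" using F by simp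
    have "source t y / distfun \<nu> (source t y) = y / Psi \<nu> t y"
      unfolding s(3) eq_commute[of "source t y / distfun \<nu> (source t y)"] nonzero_divide_eq_eq[OF nz] by (rule e)
    moreover have "(LBINT z:{0..y}. psi \<nu> t z) = Psi \<nu> t y"
      using scaled_nu_density(2)[OF t] y by simp
    ultimately show "psi \<nu> t y * (source t y / distfun \<nu> (source t y)) = psi \<nu> t y / (1 / y * (LBINT z:{0..y}. psi \<nu> t z))"
      by simp
  qed simp
qed

end

end

theorem theorem4p1:
  fixes \<nu>0 :: "real measure" and r :: "nat \<Rightarrow> nat \<Rightarrow> real"
  assumes "real_distribution \<nu>0"
    and "AE x in \<nu>0. 0 \<le> x"
    and "compact (measure_support \<nu>0)"
    and "\<And>n. n \<ge> 1 \<Longrightarrow> mono_on {1..n} (r n)"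
    and "\<And>n j. 1 \<le> j \<Longrightarrow> j \<le> n \<Longrightarrow> 0 \<le> r n j"
    and "weak_conv_m (\<lambda>n. empirical_measure (image_mset (r n) (mset_set {1..n}))) \<nu>0"
  shows
    "(\<comment> \<open>(1)\<close>
      (\<forall>m :: nat \<Rightarrow> nat.
        (\<forall>n\<ge>1. m n > 0) \<and>
        filterlim (\<lambda>n. real (m n) / (real n * ln (real n))) at_top sequentially \<longrightarrow>
        (\<forall>t\<in>{0<..<1}.
          weakly_converges
            (\<lambda>n. root_measure ((pderiv ^^ nat \<lfloor>real n * real (m n) * t\<rfloor>) (P_poly r n (m n))))
            (times_unif (nu \<nu>0 t)))) \<and>
      (\<forall>t\<in>{0<..<1}.
        emeasure (scaled_nu \<nu>0 t) UNIV = ennreal (1 - t) \<and>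
        (\<forall>x\<in>{0..1 - t}.
          quantile (scaled_nu \<nu>0 t) x = x * quantile \<nu>0 (x + t) / (x + t))))
     \<and>
     (\<comment> \<open>(2)\<close>
      \<forall>A>0. cont_incr_bij (distfun \<nu>0) {0..A} {0..1} \<longrightarrow>
        inverse_bijections (Psi \<nu>0 0) (quantile \<nu>0) {0..A} {0..1} \<and>
        (\<forall>t\<in>{0<..<1}.
          cont_incr_bij (Psi \<nu>0 t) {0..A * (1 - t)} {0..1 - t} \<and>
          inverse_bijections (Psi \<nu>0 t) (quantile (scaled_nu \<nu>0 t))
            {0..A * (1 - t)} {0..1 - t} \<and>
          (\<forall>x\<in>{0<..<1 - t}.
            comp_inverse {0..A * (1 - t)} (Psi \<nu>0 t) x / x =
            comp_inverse {0..A} (Psi \<nu>0 0) (x + t) / (x + t))))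
     \<and>
     (\<comment> \<open>(3) and (4)\<close>
      \<forall>A>0. \<forall>f :: real \<Rightarrow> real.
        has_density_on \<nu>0 f {0<..<A} \<and> continuous_on {0<..<A} f \<and> (\<forall>x\<in>{0<..<A}. 0 < f x) \<longrightarrow>
        (\<forall>t\<in>{0..<1}.
          (AE x in scaled_nu \<nu>0 t. x \<in> {0..A * (1 - t)}) \<and>
          continuous_on UNIV (Psi \<nu>0 t) \<and>
          (\<forall>x\<in>{0<..<A * (1 - t)}.
            (Psi \<nu>0 t has_real_derivative psi \<nu>0 t x) (at x) \<and> 0 < psi \<nu>0 t x) \<and>
          has_density_on (scaled_nu \<nu>0 t) (psi \<nu>0 t) {0<..<A * (1 - t)}) \<and>
        continuously_differentiable_on (domain_E A) (\<lambda>(t, x). Psi \<nu>0 t x) \<and>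
        (\<forall>(t, x)\<in>domain_E A.
          ((\<lambda>s. Psi \<nu>0 s x) has_real_derivative (x * (psi \<nu>0 t x / Psi \<nu>0 t x) - 1))
            (at t within {0..})) \<and>
        (continuously_differentiable_on {0<..<A} f \<longrightarrow>
          continuously_differentiable_on (domain_E A) (\<lambda>(t, x). psi \<nu>0 t x) \<and>
          (\<forall>(t, x)\<in>domain_E A. \<exists>D.
            ((\<lambda>s. psi \<nu>0 s x) has_real_derivative D) (at t within {0..}) \<and>
            ((\<lambda>y. psi \<nu>0 t y / (1 / y * (LBINT z:{0..y}. psi \<nu>0 t z)))
              has_real_derivative D) (at x))))"
proof -
  interpret compact_distribution \<nu>0
    using assms(1-3) by (simp add: compact_distribution_def compact_distribution_axioms_def)
  have bij: "bijective_distribution \<nu>0 A" if "0 < A" "cont_incr_bij (distfun \<nu>0) {0..A} {0..1}" for A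
    using that by unfold_locales
  have dens: "density_distribution \<nu>0 A f"
    if "0 < A" "has_density_on \<nu>0 f {0<..<A} \<and> continuous_on {0<..<A} f \<and> (\<forall>x\<in>{0<..<A}. 0 < f x)" for A f
    using that by unfold_locales auto
  show ?thesis
  \<comment> \<open>Cases 1 to 3 belong to (1), 4 to 7 to (2), 8 to 14 to (3), and 15 and 16 to
    (4).\<close>
  proof (intro conjI allI impI ballI, goal_cases)
    case (1 m t)
    then show ?case using assms(4-6) by (intro derivative_roots_convergence) auto
  next
    case (2 t)
    then show ?case by (rule scaled_nu_mass)
  next
    case (3 t x)
    then show ?case by (intro quantile_scaled_nu) auto
  next
    case (4 A)
    then show ?case unfolding Psi_0 by (rule bijective_distribution.quantile_inverse[OF bij])
  next
    case (5 A t)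
    then show ?case by (intro bijective_distribution.Psi_cont_incr(1)[OF bij])
  next
    case (6 A t)
    then show ?case by (intro bijective_distribution.Psi_cont_incr(2)[OF bij])
  next
    case (7 A t x)
    then show ?case by (intro bijective_distribution.comp_inverse_Psi[OF bij])
  next
    case (8 A f t)
    then show ?case by (intro density_distribution.AE_scaled_nu[OF dens])
  next
    case (9 A f t)
    then show ?case by (intro density_distribution.Psi_cont[OF dens])
  next
    case (10 A f t x)
    interpret density_distribution \<nu>0 A f using 10(1,2) by (rule dens)
    have "(t, x) \<in> domain_E A" using 10(3,4) by (auto simp: domain_E_iff)
    then show ?case using Psi_deriv_x[of t x] by (simp add: psi_eq)
  next
    case (11 A f t x)
    interpret density_distribution \<nu>0 A f using 11(1,2) by (rule dens)
    show ?case using 11(3,4) by (intro psi_pos) (auto simp: domain_E_iff)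
  next
    case (12 A f t)
    then show ?case by (intro density_distribution.scaled_nu_density(1)[OF dens])
  next
    case (13 A f)
    then show ?case by (intro density_distribution.Psi_C1[OF dens])
  next
    case (14 A f p)
    interpret density_distribution \<nu>0 A f using 14(1,2) by (rule dens)
    show ?case using Psi_pde[of "fst p" "snd p"] 14(3) by (simp add: split_beta)
  next
    case (15 A f)
    interpret density_distribution \<nu>0 A f using 15(1,2) by (rule dens)
    obtain f' where "\<And>y. y \<in> {0<..<A} \<Longrightarrow> (f has_real_derivative f' y) (at y)" "continuous_on {0<..<A} f'"
      using continuously_differentiable_on_realD[OF 15(3)] by auto
    then show ?case by (rule psi_C1)
  next
    case (16 A f p)
    interpret density_distribution \<nu>0 A f using 16(1,2) by (rule dens)
    obtain f' where f': "\<And>y. y \<in> {0<..<A} \<Longrightarrow> (f has_real_derivative f' y) (at y)" "continuous_on {0<..<A} f'"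
      using continuously_differentiable_on_realD[OF 16(3)] by auto
    have "(fst p, snd p) \<in> domain_E A" using 16(4) by simp
    from psi_pde[OF f' this] show ?case unfolding split_beta by blast
  qed
qed

end
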